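(* Let $\varepsilon\ge0$, let $(\underline\ell_{\mathcal D}^n)_{n\ge1}$ be a given solution to the nonlinear scheme (defined in the context), and let $(\mathfrak u^n_{\mathcal M})_{n\ge1}$, $\mathfrak u_{\mathcal M}^n=e^{\ell_{\mathcal M}^n}$, be the corresponding reconstructed discrete densities, with $\mathfrak u_{\mathcal M}^0=u^0$. Then the following a priori relations hold: (i) the mass is preserved along time: $$\forall n\ge1,\qquad\int_\Omega\mathfrak u_{\mathcal M}^n=\int_\Omega u^0=M;$$ (ii) a discrete entropy/dissipation relation is satisfied: $$\forall n\in\mathbb N,\qquad\frac{\mathbb E^{n+1}-\mathbb E^n}{\Delta t}+\mathbb D^{n+1}\le0,$$ where the discrete entropy and dissipation are the non-negative quantities $$\mathbb E^n=\int_\Omega\mathfrak u_{\mathcal M}^\infty\,\Phi_1\!\left(\frac{\mathfrak u_{\mathcal M}^n}{\mathfrak u_{\mathcal M}^\infty}\right)\ (n\ge 0)\qquad\text{and}\qquad\mathbb D^n=\mathcal T_{\mathcal D}(\underline\ell_{\mathcal D}^n;\underline w_{\mathcal D}^n,\underline w_{\mathcal D}^n)\ \text{ for }n\ge1,$$ with $\Phi_1(s)=s\log(s)-s+1$ for $s>0$ and $\Phi_1(0)=1$.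
   Context: **Data.** $\Omega\subset\mathbb R^d$, $d\in\{2,3\}$, is an open, bounded, connected polytopal set with Lipschitz boundary. $\Lambda\in L^\infty(\Omega)^{d\times d}$ is uniformly elliptic: there is $\lambda_\flat>0$ with $\Lambda(x)\xi\cdot\xi\ge\lambda_\flat|\xi|^2$ for a.e. $x\in\Omega$ and all $\xi\in\mathbb R^d$. $\phi\in W^{1,\infty}(\Omega)$. $u^0\in L^1(\Omega)$ is non-negative with $\int_\Omega u^0\log(u^0)<\infty$ and $M=\int_\Omega u^0>0$. $\Delta t>0$ is the time step, $k\ge 0$ is an integer. **Mesh.** A discretisation is a couple $\mathcal D=(\mathcal M,\mathcal E)$. $\mathcal M$ is a finite collection of disjoint, open, Lipschitz polytopes $K\subset\Omega$ (cells) of positive measure with $\overline\Omega=\bigcup_{K\in\mathcal M}\overline K$. $\mathcal E$ is a finite collection of disjoint, connected, relatively open subsets $\sigma$ of $\overline\Omega$ (faces), with positive $(d-1)$-dimensional measure, each a Lipschitz polytopal subset of an affine hyperplane, with $\partial\mathcal M:=\bigcup_{K\in\mathcal M}\partial K=\bigcup_{\sigma\in\mathcal E}\overline\sigma$; for each $K$ there is $\mathcal E_K\subset\mathcal E$ with $\partial K=\bigcup_{\sigma\in\mathcal E_K}\overline\sigma$. $n_{K,\sigma}$ is the unit normal to $\sigma\in\mathcal E_K$ pointing out of $K$; $h_X$ is the diameter of $X$. It is assumed that $\Lambda_{|K}\in W^{1,\infty}(K)^{d\times d}$ for all $K\in\mathcal M$. **Discrete space and operators.** $\mathbb P^q(X)$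 denotes polynomial functions on $X$ of total degree at most $q$, and $\Pi_X^q$ the $L^2(X)$-orthogonal projector onto it. $\underline V_{\mathcal D}^k$ is the space of $\underline v_{\mathcal D}=((v_K)_{K\in\mathcal M},(v_\sigma)_{\sigma\in\mathcal E})$ with $v_K\in\mathbb P^{k+1}(K)$ and $v_\sigma\in\mathbb P^k(\sigma)$; the restriction of $\underline v_{\mathcal D}$ to $K$ is $\underline v_K=(v_K,(v_\sigma)_{\sigma\in\mathcal E_K})$; $v_{\mathcal M}:\Omega\to\mathbb R$ is the piecewise polynomial function with $(v_{\mathcal M})_{|K}=v_K$; $\underline 1_{\mathcal D}$ is the element with all components equal to $1$. The discrete potential is $\underline\phi_{\mathcal D}=\big((\Pi_K^{k+1}(\phi_{|K}))_{K\in\mathcal M},(\Pi_\sigma^k(\phi_{|\sigma}))_{\sigma\in\mathcal E}\big)\in\underline V^k_{\mathcal D}$, so $(\phi_{\mathcal M})_{|K}=\Pi_K^{k+1}(\phi_{|K})$. The discrete gradient $G_K(\underline v_K)\in\mathbb P^k(K)^d$ is defined by $$\int_K G_K(\underline v_K)\cdot\tau=-\int_K v_K\,\nabla\cdot\tau+\sum_{\sigma\in\mathcal E_K}\int_\sigma v_\sigma\,\tau\cdot n_{K,\sigma}\qquad\forall\tau\in\mathbb P^k(K)^d,$$ and the jump by $J_{K,\sigma}(\underline v_K)=\Pi_\sigma^k(v_{K|\sigma})-v_\sigma$. Let $\Lambda_{K,\sigma}=\|\Lambda_{|K}n_{K,\sigma}\cdot n_{K,\sigma}\|_{L^\infty(\sigma)}$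 and $$a_K(\underline z_K,\underline v_K)=\int_K\Lambda G_K(\underline z_K)\cdot G_K(\underline v_K)+\sum_{\sigma\in\mathcal E_K}\frac{\Lambda_{K,\sigma}}{h_\sigma}\int_\sigma J_{K,\sigma}(\underline z_K)J_{K,\sigma}(\underline v_K).$$ **The map $\mathcal T_{\mathcal D}$.** For a parameter $\varepsilon\ge0$ and $\underline\ell_{\mathcal D},\underline w_{\mathcal D},\underline v_{\mathcal D}\in\underline V_{\mathcal D}^k$, $\mathcal T_{\mathcal D}(\underline\ell_{\mathcal D};\underline w_{\mathcal D},\underline v_{\mathcal D})$ is the sum over $K\in\mathcal M$ of $$\int_K e^{\ell_K}\Lambda G_K(\underline w_K)\cdot G_K(\underline v_K)+\sum_{\sigma\in\mathcal E_K}\frac{\Lambda_{K,\sigma}}{h_\sigma}\int_\sigma\frac{e^{\Pi_\sigma^k(\ell_{K|\sigma})}+e^{\ell_\sigma}}{2}J_{K,\sigma}(\underline w_K)J_{K,\sigma}(\underline v_K)+\varepsilon\,h_K^{k+2}a_K(\underline w_K,\underline v_K).$$ **Nonlinear scheme.** A solution is a sequence $(\underline\ell_{\mathcal D}^n)_{n\ge1}$ in $\underline V_{\mathcal D}^k$ such that, for all $n\in\mathbb N$ (including $n=0$) and all $\underline v_{\mathcal D}\in\underline V_{\mathcal D}^k$, $$\sum_{K\in\mathcal M}\int_K\frac{\mathfrak u_K^{n+1}-\mathfrak u_K^n}{\Delta t}\,v_K+\mathcal T_{\mathcal D}(\underline\ell_{\mathcal D}^{n+1};\underline\ell_{\mathcal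 D}^{n+1}+\underline\phi_{\mathcal D},\underline v_{\mathcal D})=0,$$ where $\mathfrak u_K^{n+1}=e^{\ell_K^{n+1}}$ and $\mathfrak u_K^0=u^0_{|K}$ for all $K\in\mathcal M$. **Equilibrium and quasi-Fermi potential.** $c^M_{nl}=M/\int_\Omega e^{-\phi_{\mathcal M}}$, $\mathfrak u_{\mathcal M}^\infty=c_{nl}^Me^{-\phi_{\mathcal M}}$ in $\Omega$, and $\underline w_{\mathcal D}^n=\underline\ell_{\mathcal D}^n+\underline\phi_{\mathcal D}-\log(c_{nl}^M)\,\underline1_{\mathcal D}$ for $n\ge1$. *)

theory Defs
  imports "HOL-Analysis.Analysis" "HOL-Probability.Essential_Supremum"
begin

section \<open>Polytopal sets with Lipschitz boundary\<close>

text \<open>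
  The ambient affine set \<open>A\<close> is the whole space for the domain and the cells, and a hyperplane for
  the faces.  Near each point of its boundary relative to \<open>A\<close>, the set \<open>S\<close> is the strict hypograph,
  in some direction \<open>e\<close> parallel to \<open>A\<close>, of a Lipschitz function of the coordinates orthogonal to \<open>e\<close>.
\<close>

definition lipschitz_boundary_in :: "(real^'n) set \<Rightarrow> (real^'n) set \<Rightarrow> bool" where
  "lipschitz_boundary_in A S \<longleftrightarrow>
     (\<forall>x \<in> closure S - S. \<exists>e r \<gamma> L.
        norm e = 1 \<and> x + e \<in> A \<and> r > 0 \<and> L-lipschitz_on UNIV (\<gamma> :: real^'n \<Rightarrow> real) \<and>
        (\<forall>y \<in> A \<inter> ball x r. y \<in> S \<longleftrightarrow> e \<bullet> y < \<gamma> (y - (e \<bullet> y) *\<^sub>R e)))"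

text \<open>\<^const>\<open>polytope\<close> is convex; a polytopal set need not be.\<close>

definition lipschitz_polytopal_in :: "(real^'n) set \<Rightarrow> (real^'n) set \<Rightarrow> bool" where
  "lipschitz_polytopal_in A S \<longleftrightarrow>
     openin (top_of_set A) S \<and>
     (\<exists>F. finite F \<and> (\<forall>P\<in>F. polytope P) \<and> closure S = \<Union>F) \<and>
     lipschitz_boundary_in A S"


section \<open>Surface measure on faces and outward normals\<close>

definition unit_normal :: "(real^'n) set \<Rightarrow> real^'n" where
  "unit_normal \<sigma> = (SOME n. norm n = 1 \<and> (\<forall>x\<in>\<sigma>. \<forall>y\<in>\<sigma>. n \<bullet> (x - y) = 0))"

text \<open>
  The \<open>(d-1)\<close>-dimensional Lebesgue measure on the hyperplane \<open>n \<bullet> x = b\<close> containing \<open>\<sigma>\<close> (with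
  \<open>norm n = 1\<close>) is the image of the \<open>d\<close>-dimensional Lebesgue measure on the slab
  \<open>b \<le> n \<bullet> x \<le> b + 1\<close>, whose thickness is one, under the orthogonal projection onto the
  hyperplane.  It does not depend on the choice between \<open>n\<close> and \<open>-n\<close>.
\<close>

definition face_measure :: "(real^'n) set \<Rightarrow> (real^'n) measure" where
  "face_measure \<sigma> =
     (let n = unit_normal \<sigma>; b = n \<bullet> (SOME x. x \<in> \<sigma>) in
        restrict_space
          (distr (restrict_space lborel {x. b \<le> n \<bullet> x \<and> n \<bullet> x \<le> b + 1}) borel
             (\<lambda>x. x - (n \<bullet> x - b) *\<^sub>R n))
          \<sigma>)"

definition outward_normal :: "(real^'n) set \<Rightarrow> (real^'n) set \<Rightarrow> real^'n" where
  "outward_normal K \<sigma> =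
     (THE n. norm n = 1 \<and> (\<forall>x\<in>\<sigma>. \<forall>y\<in>\<sigma>. n \<bullet> (x - y) = 0) \<and>
        (\<forall>x\<in>\<sigma>. \<exists>\<delta>>0. \<forall>t. 0 < t \<and> t < \<delta> \<longrightarrow> x - t *\<^sub>R n \<in> K \<and> x + t *\<^sub>R n \<notin> K))"


section \<open>Discretisations\<close>

record 'n discretisation =
  cells :: "(real^'n) set set"
  faces :: "(real^'n) set set"
  faces_of :: "(real^'n) set \<Rightarrow> (real^'n) set set"

text \<open>
  Faces are relatively open in the hyperplane that contains them.
\<close>

definition polytopal_discretisation ::
    "(real^'n) set \<Rightarrow> 'n::finite discretisation \<Rightarrow> bool" where
  "polytopal_discretisation \<Omega> D \<longleftrightarrow>
     finite (cells D) \<and> disjoint (cells D) \<and>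
     (\<forall>K\<in>cells D. K \<subseteq> \<Omega> \<and> lipschitz_polytopal_in UNIV K \<and> emeasure lborel K > 0) \<and>
     closure \<Omega> = (\<Union>K\<in>cells D. closure K) \<and>
     finite (faces D) \<and> disjoint (faces D) \<and>
     (\<forall>\<sigma>\<in>faces D. \<sigma> \<subseteq> closure \<Omega> \<and> connected \<sigma> \<and>
        (\<exists>n b. n \<noteq> 0 \<and> \<sigma> \<subseteq> {x. n \<bullet> x = b} \<and> lipschitz_polytopal_in {x. n \<bullet> x = b} \<sigma>) \<and>
        emeasure (face_measure \<sigma>) \<sigma> > 0) \<and>
     (\<Union>K\<in>cells D. frontier K) = (\<Union>\<sigma>\<in>faces D. closure \<sigma>) \<and>
     (\<forall>K\<in>cells D. faces_of D K \<subseteq> faces D \<and> frontier K = (\<Union>\<sigma>\<in>faces_of D K. closure \<sigma>))"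


section \<open>Essentially bounded and Sobolev functions, traces\<close>

definition Linf :: "(real^'n) set \<Rightarrow> (real^'n \<Rightarrow> real) \<Rightarrow> bool" where
  "Linf U f \<longleftrightarrow>
     f \<in> borel_measurable (lebesgue_on U) \<and> (\<exists>C. AE x in lebesgue_on U. \<bar>f x\<bar> \<le> C)"

definition Linf_norm :: "'a measure \<Rightarrow> ('a \<Rightarrow> real) \<Rightarrow> real" where
  "Linf_norm M f = real_of_ereal (esssup M (\<lambda>x. ereal \<bar>f x\<bar>))"

definition partial_deriv :: "'n \<Rightarrow> (real^'n \<Rightarrow> real) \<Rightarrow> real^'n \<Rightarrow> real" where
  "partial_deriv i f x = frechet_derivative f (at x) (axis i 1)"

primrec C_k :: "nat \<Rightarrow> (real^'n \<Rightarrow> real) \<Rightarrow> bool" where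
  "C_k 0 f \<longleftrightarrow> continuous_on UNIV f"
| "C_k (Suc m) f \<longleftrightarrow> (\<forall>x. f differentiable (at x)) \<and> (\<forall>i. C_k m (partial_deriv i f))"

definition test_function :: "(real^'n) set \<Rightarrow> (real^'n \<Rightarrow> real) \<Rightarrow> bool" where
  "test_function U \<psi> \<longleftrightarrow>
     (\<forall>m. C_k m \<psi>) \<and> compact (closure {x. \<psi> x \<noteq> 0}) \<and> closure {x. \<psi> x \<noteq> 0} \<subseteq> U"

definition W1inf :: "(real^'n) set \<Rightarrow> (real^'n \<Rightarrow> real) \<Rightarrow> bool" where
  "W1inf U f \<longleftrightarrow> Linf U f \<and>
     (\<forall>i. \<exists>g. Linf U g \<and>
        (\<forall>\<psi>. test_function U \<psi> \<longrightarrow>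
           (\<integral>x. f x * partial_deriv i \<psi> x \<partial>lebesgue_on U) = - (\<integral>x. g x * \<psi> x \<partial>lebesgue_on U)))"

text \<open>
  The trace on \<open>closure U\<close> of a function that is defined almost everywhere in \<open>U\<close>.  A function in
  \<open>W1inf U\<close>, with \<open>U\<close> bounded and Lipschitz, has a representative that is continuous up to the
  boundary, and the limit of averages below is the value of that representative at \<open>x\<close>.
\<close>

definition trace_from :: "(real^'n) set \<Rightarrow> (real^'n \<Rightarrow> real) \<Rightarrow> real^'n \<Rightarrow> real" where
  "trace_from U f x =
     Lim (at_right 0)
       (\<lambda>r. (\<integral>y. f y \<partial>lebesgue_on (U \<inter> ball x r)) / measure lebesgue (U \<inter> ball x r))"


section \<open>Polynomials and the discrete space\<close>

text \<open>
  Polynomial functions of total degree at most \<open>q\<close>.  A polynomial function on a cell or on a face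
  \<open>X\<close> is represented by a polynomial function on the whole space of which it is the restriction.
  On a cell this representation is unique, and the same polynomial gives its values on the boundary
  of the cell.  On a face it is not, but only the values on the face are used below.
\<close>

definition polys :: "nat \<Rightarrow> (real^'n \<Rightarrow> real) set" where
  "polys q =
     {p. \<exists>c. p = (\<lambda>x. \<Sum>\<alpha> \<in> {\<alpha> :: 'n \<Rightarrow> nat. sum \<alpha> UNIV \<le> q}. c \<alpha> * (\<Prod>i\<in>UNIV. (x $ i) ^ \<alpha> i))}"

definition vec_polys :: "nat \<Rightarrow> (real^'n \<Rightarrow> real^'n) set" where
  "vec_polys q = {\<tau>. \<forall>i. (\<lambda>x. \<tau> x $ i) \<in> polys q}"

text \<open>
  The \<open>L\<^sup>2(\<mu>)\<close>-orthogonal projection, for \<open>\<mu>\<close> the measure of a cell or of a face; it is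
  unique up to the choice of the representing polynomial.
\<close>

definition l2_proj :: "(real^'n) measure \<Rightarrow> nat \<Rightarrow> (real^'n \<Rightarrow> real) \<Rightarrow> real^'n \<Rightarrow> real" where
  "l2_proj \<mu> q f =
     (SOME p. p \<in> polys q \<and> (\<forall>r\<in>polys q. (\<integral>x. (f x - p x) * r x \<partial>\<mu>) = 0))"

record 'n dofs =
  cell :: "(real^'n) set \<Rightarrow> real^'n \<Rightarrow> real"
  face :: "(real^'n) set \<Rightarrow> real^'n \<Rightarrow> real"

definition V_space :: "nat \<Rightarrow> 'n::finite discretisation \<Rightarrow> 'n dofs set" where
  "V_space k D =
     {v. (\<forall>K\<in>cells D. cell v K \<in> polys (k + 1)) \<and> (\<forall>\<sigma>\<in>faces D. face v \<sigma> \<in> polys k)}"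

definition dofs_add :: "'n::finite dofs \<Rightarrow> 'n dofs \<Rightarrow> 'n dofs" where
  "dofs_add v w = \<lparr>cell = (\<lambda>K x. cell v K x + cell w K x), face = (\<lambda>\<sigma> x. face v \<sigma> x + face w \<sigma> x)\<rparr>"

definition dofs_scale :: "real \<Rightarrow> 'n::finite dofs \<Rightarrow> 'n dofs" where
  "dofs_scale a v = \<lparr>cell = (\<lambda>K x. a * cell v K x), face = (\<lambda>\<sigma> x. a * face v \<sigma> x)\<rparr>"

definition dofs_one :: "'n::finite dofs" where
  "dofs_one = \<lparr>cell = (\<lambda>K x. 1), face = (\<lambda>\<sigma> x. 1)\<rparr>"

definition reconstruct :: "'n::finite discretisation \<Rightarrow> 'n dofs \<Rightarrow> real^'n \<Rightarrow> real" where
  "reconstruct D v x = (\<Sum>K\<in>cells D. indicator K x * cell v K x)"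

definition interp_potential ::
    "(real^'n) set \<Rightarrow> 'n::finite discretisation \<Rightarrow> nat \<Rightarrow> (real^'n \<Rightarrow> real) \<Rightarrow> 'n dofs" where
  "interp_potential \<Omega> D k \<phi> =
     \<lparr>cell = (\<lambda>K. l2_proj (lebesgue_on K) (k + 1) \<phi>),
      face = (\<lambda>\<sigma>. l2_proj (face_measure \<sigma>) k (trace_from \<Omega> \<phi>))\<rparr>"


section \<open>Discrete operators\<close>

definition divergence :: "(real^'n \<Rightarrow> real^'n) \<Rightarrow> real^'n \<Rightarrow> real" where
  "divergence \<tau> x = (\<Sum>i\<in>UNIV. partial_deriv i (\<lambda>y. \<tau> y $ i) x)"

definition discrete_grad ::
    "'n::finite discretisation \<Rightarrow> nat \<Rightarrow> 'n dofs \<Rightarrow> (real^'n) set \<Rightarrow> real^'n \<Rightarrow> real^'n" where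
  "discrete_grad D k v K =
     (SOME G. G \<in> vec_polys k \<and>
        (\<forall>\<tau>\<in>vec_polys k.
           (\<integral>x. G x \<bullet> \<tau> x \<partial>lebesgue_on K) =
             - (\<integral>x. cell v K x * divergence \<tau> x \<partial>lebesgue_on K)
             + (\<Sum>\<sigma>\<in>faces_of D K. \<integral>x. face v \<sigma> x * (\<tau> x \<bullet> outward_normal K \<sigma>) \<partial>face_measure \<sigma>)))"

definition jump ::
    "nat \<Rightarrow> 'n::finite dofs \<Rightarrow> (real^'n) set \<Rightarrow> (real^'n) set \<Rightarrow> real^'n \<Rightarrow> real" where
  "jump k v K \<sigma> x = l2_proj (face_measure \<sigma>) k (cell v K) x - face v \<sigma> x"

definition face_diffusion ::
    "(real^'n \<Rightarrow> real^'n^'n) \<Rightarrow> (real^'n) set \<Rightarrow> (real^'n) set \<Rightarrow> real" where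
  "face_diffusion \<Lambda> K \<sigma> =
     (let n = outward_normal K \<sigma> in
        Linf_norm (face_measure \<sigma>) (trace_from K (\<lambda>x. (\<Lambda> x *v n) \<bullet> n)))"

definition a_loc ::
    "'n::finite discretisation \<Rightarrow> nat \<Rightarrow> (real^'n \<Rightarrow> real^'n^'n) \<Rightarrow> (real^'n) set
      \<Rightarrow> 'n dofs \<Rightarrow> 'n dofs \<Rightarrow> real" where
  "a_loc D k \<Lambda> K z v =
     (\<integral>x. (\<Lambda> x *v discrete_grad D k z K x) \<bullet> discrete_grad D k v K x \<partial>lebesgue_on K)
     + (\<Sum>\<sigma>\<in>faces_of D K. face_diffusion \<Lambda> K \<sigma> / diameter \<sigma> *
          (\<integral>x. jump k z K \<sigma> x * jump k v K \<sigma> x \<partial>face_measure \<sigma>))"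

definition T_form ::
    "'n::finite discretisation \<Rightarrow> nat \<Rightarrow> (real^'n \<Rightarrow> real^'n^'n) \<Rightarrow> real
      \<Rightarrow> 'n dofs \<Rightarrow> 'n dofs \<Rightarrow> 'n dofs \<Rightarrow> real" where
  "T_form D k \<Lambda> \<epsilon> l w v =
     (\<Sum>K\<in>cells D.
        (\<integral>x. exp (cell l K x) *
             ((\<Lambda> x *v discrete_grad D k w K x) \<bullet> discrete_grad D k v K x) \<partial>lebesgue_on K)
        + (\<Sum>\<sigma>\<in>faces_of D K. face_diffusion \<Lambda> K \<sigma> / diameter \<sigma> *
             (\<integral>x. (exp (l2_proj (face_measure \<sigma>) k (cell l K) x) + exp (face l \<sigma> x)) / 2 *
                  jump k w K \<sigma> x * jump k v K \<sigma> x \<partial>face_measure \<sigma>))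
        + \<epsilon> * diameter K ^ (k + 2) * a_loc D k \<Lambda> K w v)"


section \<open>The nonlinear scheme\<close>

text \<open>The value \<open>l 0\<close> of the sequence of discrete solutions is never used.\<close>

definition local_density ::
    "(real^'n \<Rightarrow> real) \<Rightarrow> (nat \<Rightarrow> 'n::finite dofs) \<Rightarrow> nat \<Rightarrow> (real^'n) set \<Rightarrow> real^'n \<Rightarrow> real" where
  "local_density u0 l n K x = (if n = 0 then u0 x else exp (cell (l n) K x))"

definition scheme_solution ::
    "(real^'n) set \<Rightarrow> 'n::finite discretisation \<Rightarrow> nat \<Rightarrow> (real^'n \<Rightarrow> real^'n^'n) \<Rightarrow> (real^'n \<Rightarrow> real)
      \<Rightarrow> (real^'n \<Rightarrow> real) \<Rightarrow> real \<Rightarrow> real \<Rightarrow> (nat \<Rightarrow> 'n dofs) \<Rightarrow> bool" where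
  "scheme_solution \<Omega> D k \<Lambda> \<phi> u0 \<Delta>t \<epsilon> l \<longleftrightarrow>
     (\<forall>n\<ge>1. l n \<in> V_space k D) \<and>
     (\<forall>n. \<forall>v\<in>V_space k D.
        (\<Sum>K\<in>cells D.
           \<integral>x. (local_density u0 l (n + 1) K x - local_density u0 l n K x) / \<Delta>t * cell v K x
             \<partial>lebesgue_on K)
        + T_form D k \<Lambda> \<epsilon> (l (n + 1)) (dofs_add (l (n + 1)) (interp_potential \<Omega> D k \<phi>)) v = 0)"

definition discrete_density ::
    "'n::finite discretisation \<Rightarrow> (real^'n \<Rightarrow> real) \<Rightarrow> (nat \<Rightarrow> 'n dofs) \<Rightarrow> nat \<Rightarrow> real^'n \<Rightarrow> real" where
  "discrete_density D u0 l n x = (if n = 0 then u0 x else exp (reconstruct D (l n) x))"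


section \<open>Equilibrium, entropy and dissipation\<close>

definition c_nl ::
    "(real^'n) set \<Rightarrow> 'n::finite discretisation \<Rightarrow> nat \<Rightarrow> (real^'n \<Rightarrow> real) \<Rightarrow> (real^'n \<Rightarrow> real) \<Rightarrow> real" where
  "c_nl \<Omega> D k \<phi> u0 =
     (\<integral>x. u0 x \<partial>lebesgue_on \<Omega>) /
     (\<integral>x. exp (- reconstruct D (interp_potential \<Omega> D k \<phi>) x) \<partial>lebesgue_on \<Omega>)"

definition equilibrium ::
    "(real^'n) set \<Rightarrow> 'n::finite discretisation \<Rightarrow> nat \<Rightarrow> (real^'n \<Rightarrow> real) \<Rightarrow> (real^'n \<Rightarrow> real)
      \<Rightarrow> real^'n \<Rightarrow> real" where
  "equilibrium \<Omega> D k \<phi> u0 x =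
     c_nl \<Omega> D k \<phi> u0 * exp (- reconstruct D (interp_potential \<Omega> D k \<phi>) x)"

definition quasi_fermi ::
    "(real^'n) set \<Rightarrow> 'n::finite discretisation \<Rightarrow> nat \<Rightarrow> (real^'n \<Rightarrow> real) \<Rightarrow> (real^'n \<Rightarrow> real)
      \<Rightarrow> (nat \<Rightarrow> 'n dofs) \<Rightarrow> nat \<Rightarrow> 'n dofs" where
  "quasi_fermi \<Omega> D k \<phi> u0 l n =
     dofs_add (dofs_add (l n) (interp_potential \<Omega> D k \<phi>))
       (dofs_scale (- ln (c_nl \<Omega> D k \<phi> u0)) dofs_one)"

definition Phi1 :: "real \<Rightarrow> real" where
  "Phi1 s = (if s = 0 then 1 else s * ln s - s + 1)"

definition discrete_entropy ::
    "(real^'n) set \<Rightarrow> 'n::finite discretisation \<Rightarrow> nat \<Rightarrow> (real^'n \<Rightarrow> real) \<Rightarrow> (real^'n \<Rightarrow> real)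
      \<Rightarrow> (nat \<Rightarrow> 'n dofs) \<Rightarrow> nat \<Rightarrow> real" where
  "discrete_entropy \<Omega> D k \<phi> u0 l n =
     (\<integral>x. equilibrium \<Omega> D k \<phi> u0 x * Phi1 (discrete_density D u0 l n x / equilibrium \<Omega> D k \<phi> u0 x)
        \<partial>lebesgue_on \<Omega>)"

definition discrete_dissipation ::
    "(real^'n) set \<Rightarrow> 'n::finite discretisation \<Rightarrow> nat \<Rightarrow> (real^'n \<Rightarrow> real^'n^'n) \<Rightarrow> (real^'n \<Rightarrow> real)
      \<Rightarrow> (real^'n \<Rightarrow> real) \<Rightarrow> real \<Rightarrow> (nat \<Rightarrow> 'n dofs) \<Rightarrow> nat \<Rightarrow> real" where
  "discrete_dissipation \<Omega> D k \<Lambda> \<phi> u0 \<epsilon> l n =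
     T_form D k \<Lambda> \<epsilon> (l n) (quasi_fermi \<Omega> D k \<phi> u0 l n) (quasi_fermi \<Omega> D k \<phi> u0 l n)"

end

theory Submission
  imports Defs
begin

text \<open>
  Testing the scheme with the constant 1 gives conservation of mass, and testing it with the
  quasi-Fermi potential, whose cell values are \<open>ln (u / u_inf)\<close>, gives the entropy relation by
  convexity of \<^const>\<open>Phi1\<close>.  Both need the discrete gradient and the jumps to be unchanged when a
  constant is added, and for the gradient this is the divergence theorem for polynomials on a cell.
  That theorem is proved by integrating along lines parallel to a fixed direction: almost every
  line meets the boundary of the cell only in the relative interior of finitely many faces that are
  transversal to it, and near such a point the Lipschitz cell is a half space.
\<close>

section \<open>Integration along lines\<close>

text \<open>Fubini is used with a weight instead of adapted coordinates. A line with velocity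
  \<open>v\<close> spends the time \<open>1 / \<bar>m \<bullet> v\<bar>\<close> in the slab
  \<open>b \<le> m \<bullet> x \<le> b + 1\<close>, so the slab indicator times
  \<open>\<bar>m \<bullet> v\<bar>\<close> gives every line total weight one, and translation
  invariance is enough. Since \<open>face_measure\<close> is itself an integral over such a slab,
  comparing two slabs yields the modulus of the flux factor of a face without any Jacobian; its sign
  comes from the side on which the cell lies. Cells need not be convex, and normals, gradients and
  projections are chosen by \<open>SOME\<close> or \<open>THE\<close>. The Lipschitz condition must
  therefore show that a cell lies on one side of each face, the same side all along it, before
  \<open>outward_normal\<close> has a meaning. Face polynomials are determined only on their face,
  so identities for jumps hold almost everywhere with respect to \<open>face_measure\<close>,
  whereas adding a constant leaves the gradient literally unchanged, because the condition under its
  \<open>SOME\<close> stays the same.\<close>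

lemma lborel_nn_integral_translation:
  fixes f :: "'a::euclidean_space \<Rightarrow> ennreal"
  assumes "f \<in> borel_measurable borel"
  shows "(\<integral>\<^sup>+x. f (c + x) \<partial>lborel) = (\<integral>\<^sup>+x. f x \<partial>lborel)"
proof -
  have "(\<integral>\<^sup>+x. f x \<partial>lborel) = (\<integral>\<^sup>+x. f x \<partial>distr lborel borel ((+) c))"
    by (simp add: lborel_distr_plus)
  also have "\<dots> = (\<integral>\<^sup>+x. f (c + x) \<partial>lborel)"
    using assms by (subst nn_integral_distr) auto
  finally show ?thesis by simp
qed

lemma lborel_integral_translation:
  fixes f :: "'a::euclidean_space \<Rightarrow> real"
  assumes "f \<in> borel_measurable borel"
  shows "(\<integral>x. f (c + x) \<partial>lborel) = (\<integral>x. f x \<partial>lborel)"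
proof -
  have "(\<integral>x. f x \<partial>lborel) = (\<integral>x. f x \<partial>distr lborel borel ((+) c))"
    by (simp add: lborel_distr_plus)
  also have "\<dots> = (\<integral>x. f (c + x) \<partial>lborel)"
    using assms by (subst integral_distr) auto
  finally show ?thesis by simp
qed

text \<open>Translating \<open>x\<close> by \<open>t *\<^sub>R v\<close> for fixed \<open>t\<close>
  moves \<open>t\<close> into the weight, whose integral over \<open>t\<close> is one. The same
  computation with absolute values gives the integrability behind both exchanges of
  integrals.\<close>

lemma lborel_integral_lines:
  fixes h w :: "'a::euclidean_space \<Rightarrow> real"
  assumes h: "integrable lborel h"
    and w [measurable]: "w \<in> borel_measurable borel" and w_nonneg: "\<And>x. 0 \<le> w x"
    and w_one: "\<And>y. (\<integral>\<^sup>+t. ennreal (w (y - t *\<^sub>R v)) \<partial>lborel) = 1"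
  shows "(\<integral>x. w x * (\<integral>t. h (x + t *\<^sub>R v) \<partial>lborel) \<partial>lborel) = (\<integral>x. h x \<partial>lborel)"
proof -
  have hm [measurable]: "h \<in> borel_measurable borel"
    using borel_measurable_integrable[OF h] by simp
  have w_int: "(\<integral>t. w (y - t *\<^sub>R v) \<partial>lborel) = 1" for y
    by (rule integral_eq_nn_integral[THEN trans]) (auto simp: w_nonneg w_one)
  have I: "(\<integral>\<^sup>+y. \<integral>\<^sup>+t. ennreal (w (y - t *\<^sub>R v) * \<bar>h y\<bar>) \<partial>lborel \<partial>lborel) = (\<integral>\<^sup>+y. ennreal \<bar>h y\<bar> \<partial>lborel)"
    by (simp add: ennreal_mult w_nonneg nn_integral_multc w_one)
  have shift: "(\<integral>\<^sup>+x. ennreal (w x * \<bar>h (x + t *\<^sub>R v)\<bar>) \<partial>lborel)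
      = (\<integral>\<^sup>+y. ennreal (w (y - t *\<^sub>R v) * \<bar>h y\<bar>) \<partial>lborel)" for t
    by (subst lborel_nn_integral_translation[of _ "- t *\<^sub>R v", symmetric]) (auto simp: algebra_simps)
  have I2: "(\<integral>\<^sup>+t. \<integral>\<^sup>+y. ennreal (w (y - t *\<^sub>R v) * \<bar>h y\<bar>) \<partial>lborel \<partial>lborel) = (\<integral>\<^sup>+y. ennreal \<bar>h y\<bar> \<partial>lborel)"
    by (subst lborel_pair.Fubini') (use I in auto)
  have fin: "(\<integral>\<^sup>+y. ennreal \<bar>h y\<bar> \<partial>lborel) < \<infinity>"
    using h by (simp add: integrable_iff_bounded)
  have int1: "integrable (lborel \<Otimes>\<^sub>M lborel) (\<lambda>(t, x). w x * h (x + t *\<^sub>R v))"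
  proof (rule integrableI_bounded)
    show "(\<integral>\<^sup>+z. ennreal (norm (case z of (t, x) \<Rightarrow> w x * h (x + t *\<^sub>R v))) \<partial>(lborel \<Otimes>\<^sub>M lborel)) < \<infinity>"
      by (subst lborel.nn_integral_fst[symmetric])
        (use fin in \<open>auto simp: split_beta abs_mult w_nonneg shift I2 cong: nn_integral_cong\<close>)
  qed (simp add: borel_prod)
  have int2: "integrable (lborel \<Otimes>\<^sub>M lborel) (\<lambda>(t, y). w (y - t *\<^sub>R v) * h y)"
  proof (rule integrableI_bounded)
    show "(\<integral>\<^sup>+z. ennreal (norm (case z of (t, y) \<Rightarrow> w (y - t *\<^sub>R v) * h y)) \<partial>(lborel \<Otimes>\<^sub>M lborel)) < \<infinity>"
      by (subst lborel.nn_integral_fst[symmetric])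
        (use fin in \<open>auto simp: split_beta abs_mult w_nonneg I2 cong: nn_integral_cong\<close>)
  qed (simp add: borel_prod)
  have "(\<integral>x. w x * (\<integral>t. h (x + t *\<^sub>R v) \<partial>lborel) \<partial>lborel)
      = (\<integral>x. (\<integral>t. w x * h (x + t *\<^sub>R v) \<partial>lborel) \<partial>lborel)"
    by simp
  also have "\<dots> = (\<integral>t. (\<integral>x. w x * h (x + t *\<^sub>R v) \<partial>lborel) \<partial>lborel)"
    using lborel_pair.Fubini_integral[OF int1] by simp
  also have "\<dots> = (\<integral>t. (\<integral>y. w (y - t *\<^sub>R v) * h y \<partial>lborel) \<partial>lborel)"
  proof (rule Bochner_Integration.integral_cong[OF refl])
    fix t
    show "(\<integral>x. w x * h (x + t *\<^sub>R v) \<partial>lborel) = (\<integral>y. w (y - t *\<^sub>R v) * h y \<partial>lborel)"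
      by (subst lborel_integral_translation[of _ "- t *\<^sub>R v", symmetric]) (auto simp: algebra_simps)
  qed
  also have "\<dots> = (\<integral>y. (\<integral>t. w (y - t *\<^sub>R v) * h y \<partial>lborel) \<partial>lborel)"
    using lborel_pair.Fubini_integral[OF int2] by simp
  also have "\<dots> = (\<integral>y. h y \<partial>lborel)"
    by (simp add: w_int)
  finally show ?thesis .
qed

text \<open>The factor is the reciprocal of the time that a line with velocity \<open>v\<close>
  spends in the slab; thickness one is that of the slab in \<open>face_measure\<close>.\<close>

definition slab_weight :: "'a::euclidean_space \<Rightarrow> real \<Rightarrow> 'a \<Rightarrow> 'a \<Rightarrow> real" where
  "slab_weight m b v x = \<bar>m \<bullet> v\<bar> * indicator {b..b + 1} (m \<bullet> x)"

lemma slab_weight_measurable [measurable]: "slab_weight m b v \<in> borel_measurable borel"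
  unfolding slab_weight_def[abs_def] by measurable

lemma slab_weight_nonneg: "0 \<le> slab_weight m b v x"
  by (simp add: slab_weight_def)

lemma nn_integral_slab_weight:
  fixes m v :: "'a::euclidean_space"
  assumes "m \<bullet> v \<noteq> 0"
  shows "(\<integral>\<^sup>+t. ennreal (slab_weight m b v (y - t *\<^sub>R v)) \<partial>lborel) = 1"
proof -
  define c where "c = m \<bullet> v"
  \<comment> \<open>Times at which the line crosses the two bounding hyperplanes; their order
    depends on the sign of \<open>c\<close>.\<close>
  define p q where "p = (m \<bullet> y - b) / c" and "q = (m \<bullet> y - b - 1) / c"
  have c: "c \<noteq> 0" using assms by (simp add: c_def)
  have "indicator {b..b + 1} (m \<bullet> (y - t *\<^sub>R v)) = (indicator {min p q..max p q} t :: real)" for t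
    using c by (cases "c > 0") (auto simp: indicator_def p_def q_def c_def[symmetric] inner_diff_right
        min_def max_def field_simps split: if_splits)
  then have "(\<integral>\<^sup>+t. ennreal (slab_weight m b v (y - t *\<^sub>R v)) \<partial>lborel)
      = (\<integral>\<^sup>+t. ennreal \<bar>c\<bar> * indicator {min p q..max p q} t \<partial>lborel)"
    by (simp add: slab_weight_def c_def ennreal_mult ennreal_indicator)
  also have "\<dots> = ennreal (\<bar>c\<bar> * (max p q - min p q))"
    by (simp add: nn_integral_cmult ennreal_mult)
  also have "\<bar>c\<bar> * (max p q - min p q) = 1"
    using c by (cases "c > 0") (auto simp: p_def q_def min_def max_def field_simps split: if_splits)
  finally show ?thesis by simp
qed

lemma lborel_integral_slab_lines:
  fixes h :: "'a::euclidean_space \<Rightarrow> real"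
  assumes "integrable lborel h" "m \<bullet> v \<noteq> 0"
  shows "(\<integral>x. slab_weight m b v x * (\<integral>t. h (x + t *\<^sub>R v) \<partial>lborel) \<partial>lborel) = (\<integral>x. h x \<partial>lborel)"
  using assms by (intro lborel_integral_lines nn_integral_slab_weight slab_weight_nonneg) auto

lemma integral_slab_weight:
  fixes m v :: "'a::euclidean_space"
  assumes "m \<bullet> v \<noteq> 0"
  shows "(\<integral>t. slab_weight m b v (y + t *\<^sub>R v) \<partial>lborel) = 1"
proof -
  have "(\<integral>\<^sup>+t. ennreal (slab_weight m b v (y + t *\<^sub>R v)) \<partial>lborel)
      = (\<integral>\<^sup>+t. ennreal (slab_weight m b v (y - t *\<^sub>R v)) \<partial>lborel)"
    using nn_integral_distr[of uminus lborel "borel" "\<lambda>t. ennreal (slab_weight m b v (y - t *\<^sub>R v))"]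
    by (simp add: lborel_distr_uminus)
  then show ?thesis
    using nn_integral_slab_weight[OF assms, of b y]
    by (intro integral_eq_nn_integral[THEN trans]) (auto simp: slab_weight_nonneg)
qed

text \<open>The line formula with the first weight is applied to the product of \<open>G\<close> and
  the second weight: on each line \<open>G\<close> is constant and the second weight integrates to
  one.\<close>

lemma lborel_integral_invariant_slab:
  fixes G :: "'a::euclidean_space \<Rightarrow> real"
  assumes inv: "\<And>x t. G (x + t *\<^sub>R v) = G x"
    and int: "integrable lborel (\<lambda>x. slab_weight m2 b2 v x * G x)"
    and nz: "m1 \<bullet> v \<noteq> 0" "m2 \<bullet> v \<noteq> 0"
  shows "(\<integral>x. slab_weight m1 b1 v x * G x \<partial>lborel) = (\<integral>x. slab_weight m2 b2 v x * G x \<partial>lborel)"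
  using lborel_integral_slab_lines[OF int nz(1), of b1] integral_slab_weight[OF nz(2)]
  by (simp add: inv)

text \<open>On each line parallel to \<open>u\<close> the map is a translation by the constant
  \<open>s x\<close>, so it preserves every line integral.\<close>

lemma lborel_integral_shear:
  fixes G :: "'a::euclidean_space \<Rightarrow> real"
  assumes int: "integrable lborel G" "integrable lborel (\<lambda>x. G (x + s x *\<^sub>R u))"
    and inv: "\<And>x t. s (x + t *\<^sub>R u) = s x"
  shows "(\<integral>x. G (x + s x *\<^sub>R u) \<partial>lborel) = (\<integral>x. G x \<partial>lborel)"
proof (cases "u = 0")
  case False
  then have nz: "u \<bullet> u \<noteq> 0" by simp
  have [measurable]: "G \<in> borel_measurable borel"
    using borel_measurable_integrable[OF int(1)] by simp
  have "(\<integral>t. G (x + t *\<^sub>R u + s (x + t *\<^sub>R u) *\<^sub>R u) \<partial>lborel) = (\<integral>t. G (x + t *\<^sub>R u) \<partial>lborel)" for x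
    using lborel_integral_translation[of "\<lambda>t. G (x + t *\<^sub>R u)" "s x"]
    by (simp add: inv algebra_simps)
  then show ?thesis
    using lborel_integral_slab_lines[OF int(1) nz, of 0] lborel_integral_slab_lines[OF int(2) nz, of 0]
    by simp
qed simp


section \<open>Boundary points on lines and flat pieces of Lipschitz boundaries\<close>

lemma indicator_eventually_const:
  fixes t :: real
  assumes "t \<notin> frontier U"
  shows "eventually (\<lambda>y. indicator U t = (indicator U y :: real)) (nhds t)"
proof (cases "t \<in> U")
  case True
  then have "t \<in> interior U"
    using assms closure_subset by (auto simp: frontier_def)
  then have "eventually (\<lambda>y. y \<in> interior U) (nhds t)"
    by (intro eventually_nhds_in_open) auto
  then show ?thesis
    by eventually_elim (use True interior_subset in \<open>auto simp: indicator_def\<close>)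
next
  case False
  then have "t \<in> - closure U"
    using assms interior_subset by (auto simp: frontier_def)
  then have "eventually (\<lambda>y. y \<in> - closure U) (nhds t)"
    by (intro eventually_nhds_in_open) auto
  then show ?thesis
    by eventually_elim (use False closure_subset in \<open>auto simp: indicator_def\<close>)
qed

text \<open>
  The indicator of \<open>U\<close> plus a signed unit step at each boundary point is locally constant, hence
  zero; this turns the integral over \<open>U\<close> into a sum over its boundary points.
\<close>

lemma indicator_eq_steps:
  fixes U :: "real set" and T :: "'i \<Rightarrow> real"
  assumes U: "bounded U" and S: "finite S" "inj_on T S" and fr: "frontier U \<subseteq> T ` S"
    and sgn: "\<And>i. i \<in> S \<Longrightarrow> s i = 1 \<or> s i = (-1 :: real)"
    and loc: "\<And>i. i \<in> S \<Longrightarrow> \<exists>\<rho>>0. \<forall>t. \<bar>t - T i\<bar> < \<rho> \<longrightarrow> (t \<in> U \<longleftrightarrow> s i * (t - T i) < 0)"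
  shows "(\<Sum>i\<in>S. s i) = 0"
    and "t \<notin> T ` S \<Longrightarrow> indicator U t = - (\<Sum>i\<in>S. s i * indicator {T i..} t)"
proof -
  \<comment> \<open>The step includes its jump point exactly when \<open>U\<close> lies to the left
    of it, because \<open>U\<close> itself omits that point. This makes \<open>g\<close> constant
    across the jump, the point included.\<close>
  define J where "J = (\<lambda>i t. indicator (if s i = 1 then {T i..} else {T i<..}) t :: real)"
  define g where "g = (\<lambda>t. indicator U t + (\<Sum>i\<in>S. s i * J i t))"
  have J_const: "eventually (\<lambda>y. J i t = J i y) (nhds t)" if "t \<noteq> T i" for i t
    unfolding J_def by (rule indicator_eventually_const) (use that in auto)
  have g_loc: "eventually (\<lambda>y. g t = g y) (nhds t)" for t
  proof (cases "t \<in> T ` S")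
    case False
    then have "\<forall>i\<in>S. eventually (\<lambda>y. J i t = J i y) (nhds t)"
      by (auto intro: J_const)
    then have "eventually (\<lambda>y. \<forall>i\<in>S. J i t = J i y) (nhds t)"
      using S(1) by (simp add: eventually_ball_finite_distrib)
    moreover have "eventually (\<lambda>y. indicator U t = (indicator U y :: real)) (nhds t)"
      using False fr by (intro indicator_eventually_const) auto
    ultimately show ?thesis
      by eventually_elim (simp add: g_def)
  next
    case True
    then obtain i where i: "i \<in> S" "t = T i" by auto
    obtain \<rho> where \<rho>: "\<rho> > 0" "\<And>y. \<bar>y - t\<bar> < \<rho> \<Longrightarrow> y \<in> U \<longleftrightarrow> s i * (y - t) < 0"
      using loc[OF i(1)] i(2) by auto
    have "\<forall>j\<in>S - {i}. eventually (\<lambda>y. J j t = J j y) (nhds t)"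
      using S(2) i by (auto intro!: J_const dest: inj_onD)
    then have "eventually (\<lambda>y. \<forall>j\<in>S - {i}. J j t = J j y) (nhds t)"
      using S(1) by (simp add: eventually_ball_finite_distrib)
    moreover have "eventually (\<lambda>y. \<bar>y - t\<bar> < \<rho>) (nhds t)"
      unfolding eventually_nhds_metric using \<rho>(1) by (auto simp: dist_real_def)
    ultimately show ?thesis
    proof eventually_elim
      case (elim y)
      have "indicator U t + s i * J i t = indicator U y + s i * J i y"
        using sgn[OF i(1)] \<rho>(2)[of t] \<rho>(2)[OF elim(2)] \<rho>(1) i(2)
        by (auto simp: J_def indicator_def split: if_splits)
      then show ?case
        using elim(1) S(1) i(1) by (simp add: g_def sum.remove)
    qed
  qed
  have "\<forall>t\<in>UNIV. eventually (\<lambda>y. g t = g y) (at t)"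
    using g_loc eventually_nhds_conv_at[of "\<lambda>y. g _ = g y"] by simp
  then have g_const: "g a = g b" for a b
    by (intro connected_local_const[of UNIV]) auto
  have "bounded (U \<union> T ` S)"
    using U S(1) by (simp add: finite_imp_bounded)
  then obtain R where R: "\<And>x. x \<in> U \<union> T ` S \<Longrightarrow> \<bar>x\<bar> < R"
    unfolding bounded_pos_less by (auto simp: real_norm_def)
  \<comment> \<open>To the left of \<open>U\<close> and of all \<open>T i\<close> every term
    vanishes; to the right every step is switched on, so the constant value of \<open>g\<close> is
    also the sum of the signs.\<close>
  have "g (- \<bar>R\<bar>) = 0"
    unfolding g_def J_def using R by (force simp: indicator_def intro!: sum.neutral)
  then have g0: "g a = 0" for a
    using g_const by metis
  have "g \<bar>R\<bar> = (\<Sum>i\<in>S. s i)"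
  proof -
    have "\<bar>R\<bar> \<notin> U" using R by force
    moreover have "J i \<bar>R\<bar> = 1" if "i \<in> S" for i
      using R[of "T i"] that by (auto simp: J_def indicator_def)
    ultimately show ?thesis by (simp add: g_def)
  qed
  then show "(\<Sum>i\<in>S. s i) = 0" using g0 by simp
  assume t: "t \<notin> T ` S"
  have "J i t = indicator {T i..} t" if "i \<in> S" for i
    using t that by (auto simp: J_def indicator_def)
  then show "indicator U t = - (\<Sum>i\<in>S. s i * indicator {T i..} t)"
    using g0[of t] by (simp add: g_def)
qed

text \<open>\<open>U\<close> is not split into intervals. Up to finitely many points its indicator
  is a signed sum of rays, which are cut off at a common bound \<open>R\<close>; the terms
  \<open>q R\<close> cancel because the signs sum to zero.\<close>

lemma integral_deriv_open_real:
  fixes U :: "real set" and T :: "'i \<Rightarrow> real"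
  assumes U: "bounded U" "open U" and S: "finite S" "inj_on T S" and fr: "frontier U \<subseteq> T ` S"
    and sgn: "\<And>i. i \<in> S \<Longrightarrow> s i = 1 \<or> s i = (-1 :: real)"
    and loc: "\<And>i. i \<in> S \<Longrightarrow> \<exists>\<rho>>0. \<forall>t. \<bar>t - T i\<bar> < \<rho> \<longrightarrow> (t \<in> U \<longleftrightarrow> s i * (t - T i) < 0)"
    and q: "\<And>t. (q has_real_derivative q' t) (at t)" and q': "continuous_on UNIV q'"
  shows "(\<integral>t. indicator U t * q' t \<partial>lborel) = (\<Sum>i\<in>S. s i * q (T i))"
proof -
  note steps = indicator_eq_steps[OF U(1) S fr sgn loc]
  have [measurable]: "q' \<in> borel_measurable borel"
    using q' by (rule borel_measurable_continuous_onI)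
  have [measurable]: "U \<in> sets borel" using U(2) by simp
  have "bounded (U \<union> T ` S)"
    using U S(1) by (simp add: finite_imp_bounded)
  then obtain R where R: "\<And>x. x \<in> U \<union> T ` S \<Longrightarrow> \<bar>x\<bar> < R"
    unfolding bounded_pos_less by (auto simp: real_norm_def)
  have FTC: "integrable lborel (\<lambda>t. q' t * indicator {T i..R} t)"
      "(\<integral>t. q' t * indicator {T i..R} t \<partial>lborel) = q R - q (T i)" if "i \<in> S" for i
  proof -
    have le: "T i \<le> R" using R[of "T i"] that by auto
    have "continuous_on A q'" for A using q' continuous_on_subset by blast
    then show "integrable lborel (\<lambda>t. q' t * indicator {T i..R} t)"
      using borel_integrable_atLeastAtMost'[of "T i" R q'] by (simp add: set_integrable_def mult.commute)
    show "(\<integral>t. q' t * indicator {T i..R} t \<partial>lborel) = q R - q (T i)"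
      using q' by (intro integral_FTC_Icc_real le q)
        (auto simp: continuous_on_eq_continuous_at)
  qed
  have "AE t in lborel. t \<notin> T ` S"
    using S(1) by (intro AE_not_in countable_imp_null_set_lborel countable_finite) auto
  then have ae: "AE t in lborel. indicator U t * q' t
      = - (\<Sum>i\<in>S. s i * (q' t * indicator {T i..R} t))"
  proof eventually_elim
    case (elim t)
    show ?case
    proof (cases "t \<le> R")
      case True
      then have "indicator {T i..R} t = (indicator {T i..} t :: real)" for i
        by (auto simp: indicator_def)
      then show ?thesis
        using steps(2)[OF _ _ elim] by (simp add: sum_distrib_left sum_distrib_right mult_ac)
    next
      case False
      then show ?thesis using R[of t] by (auto simp: indicator_def)
    qed
  qed
  have "(\<integral>t. indicator U t * q' t \<partial>lborel)
      = (\<integral>t. - (\<Sum>i\<in>S. s i * (q' t * indicator {T i..R} t)) \<partial>lborel)"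
    using ae by (intro integral_cong_AE) measurable
  also have "\<dots> = - (\<Sum>i\<in>S. s i * (q R - q (T i)))"
    using FTC by simp
  also have "\<dots> = (\<Sum>i\<in>S. s i * q (T i)) - (\<Sum>i\<in>S. s i) * q R"
    by (simp add: right_diff_distrib sum_subtractf sum_distrib_right)
  finally show ?thesis
    using steps(1) by simp
qed

section \<open>Lipschitz sets near flat pieces of their boundary\<close>

lemma above_graph_not_in_closure:
  fixes \<gamma> :: "real^'n \<Rightarrow> real"
  assumes "S \<subseteq> A" "L-lipschitz_on UNIV \<gamma>"
    and "\<forall>y \<in> A \<inter> ball x r. y \<in> S \<longleftrightarrow> e \<bullet> y < \<gamma> (y - (e \<bullet> y) *\<^sub>R e)"
    and "y \<in> ball x r" "e \<bullet> y > \<gamma> (y - (e \<bullet> y) *\<^sub>R e)"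
  shows "y \<notin> closure S"
proof
  assume y: "y \<in> closure S"
  have cont: "continuous_on UNIV \<gamma>"
    using assms(2) by (rule lipschitz_on_continuous_on)
  \<comment> \<open>A chart describes \<open>S\<close> only. The strict reverse inequality is an
    open condition, so points satisfying it are away from the closure as well.\<close>
  define W where "W = {z. \<gamma> (z - (e \<bullet> z) *\<^sub>R e) < e \<bullet> z} \<inter> ball x r"
  have "open W"
    unfolding W_def
    by (intro open_Int open_ball open_Collect_less continuous_intros continuous_on_compose2[OF cont]) auto
  moreover have "y \<in> W" using assms(4,5) by (simp add: W_def)
  ultimately obtain z where "z \<in> S" "z \<in> W"
    using y by (metis IntE all_not_in_conv open_Int_closure_eq_empty IntI)
  then show False
    using assms(1,3) by (force simp: W_def)
qed

lemma openin_hyperplane_ball: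
  assumes "openin (top_of_set {x. n \<bullet> x = b}) \<sigma>" "x \<in> \<sigma>"
  obtains \<rho> where "\<rho> > 0" "\<And>y. y \<in> ball x \<rho> \<Longrightarrow> n \<bullet> y = b \<Longrightarrow> y \<in> \<sigma>"
  using assms unfolding openin_contains_ball by blast

text \<open>Points of \<open>\<sigma>\<close> near \<open>x\<close> satisfy neither strict
  inequality of the chart, so they lie on the graph of \<open>\<gamma>\<close>. The graph thus
  contains a piece of the hyperplane, \<open>\<gamma>\<close> is affine there, and its strict
  hypograph is a half space. In particular \<open>K\<close> cannot lie on both sides.\<close>

lemma open_lipschitz_halfspace_at_flat_point:
  fixes K \<sigma> :: "(real^'n) set"
  assumes K: "open K" "lipschitz_boundary_in UNIV K"
    and n: "norm n = 1" and \<sigma>: "openin (top_of_set {x. n \<bullet> x = b}) \<sigma>" "\<sigma> \<subseteq> frontier K" "x \<in> \<sigma>"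
  obtains s \<rho> where "s = 1 \<or> s = (-1::real)" "\<rho> > 0"
    "\<And>z. z \<in> ball x \<rho> \<Longrightarrow> z \<in> K \<longleftrightarrow> s * (n \<bullet> z - b) < 0"
proof -
  have \<sigma>K: "\<sigma> \<subseteq> closure K - K"
    using \<sigma>(2) K(1) by (auto simp: frontier_def interior_open)
  have xb: "n \<bullet> x = b"
    using \<sigma>(1,3) openin_subset[OF \<sigma>(1)] by auto
  obtain e r \<gamma> L where e: "norm e = 1" and r: "r > 0" and L: "L-lipschitz_on UNIV (\<gamma> :: real^'n \<Rightarrow> real)"
    and chart: "\<forall>y \<in> UNIV \<inter> ball x r. y \<in> K \<longleftrightarrow> e \<bullet> y < \<gamma> (y - (e \<bullet> y) *\<^sub>R e)"
    using K(2) \<sigma>K \<sigma>(3) unfolding lipschitz_boundary_in_def by blast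
  obtain \<rho>0 where \<rho>0: "\<rho>0 > 0" "\<And>y. y \<in> ball x \<rho>0 \<Longrightarrow> n \<bullet> y = b \<Longrightarrow> y \<in> \<sigma>"
    using openin_hyperplane_ball[OF \<sigma>(1,3)] by blast
  define \<rho>1 where "\<rho>1 = min \<rho>0 r"
  have \<rho>1: "\<rho>1 > 0" "\<rho>1 \<le> \<rho>0" "\<rho>1 \<le> r" using \<rho>0(1) r by (auto simp: \<rho>1_def)
  have ee: "e \<bullet> e = 1" using e by (simp add: norm_eq_1)
  have graph: "e \<bullet> y = \<gamma> (y - (e \<bullet> y) *\<^sub>R e)" if "y \<in> ball x \<rho>1" "n \<bullet> y = b" for y
  proof -
    have yr: "y \<in> ball x r" and "y \<in> \<sigma>"
      using that \<rho>0(2) \<rho>1 by auto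
    then have y: "y \<in> closure K" "y \<notin> K" using \<sigma>K by auto
    have "\<not> e \<bullet> y < \<gamma> (y - (e \<bullet> y) *\<^sub>R e)"
      using y(2) chart yr by auto
    moreover have "\<not> e \<bullet> y > \<gamma> (y - (e \<bullet> y) *\<^sub>R e)"
      using y(1) above_graph_not_in_closure[OF _ L chart yr] by auto
    ultimately show ?thesis by simp
  qed
  \<comment> \<open>If \<open>e\<close> were parallel to the hyperplane, a step along
    \<open>e\<close> would stay on the graph and raise \<open>e \<bullet> y\<close>, yet leave the
    argument of \<open>\<gamma>\<close> unchanged.\<close>
  have ne: "n \<bullet> e \<noteq> 0"
  proof
    assume 0: "n \<bullet> e = 0"
    define y where "y = x + (\<rho>1 / 2) *\<^sub>R e"
    have "y \<in> ball x \<rho>1" "n \<bullet> y = b"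
      using e \<rho>1 0 xb by (auto simp: y_def dist_norm inner_add_right)
    then have "e \<bullet> y = \<gamma> (y - (e \<bullet> y) *\<^sub>R e)" by (rule graph)
    moreover have "y - (e \<bullet> y) *\<^sub>R e = x - (e \<bullet> x) *\<^sub>R e"
      by (simp add: y_def inner_add_right ee algebra_simps)
    moreover have "e \<bullet> x = \<gamma> (x - (e \<bullet> x) *\<^sub>R e)"
      using graph[of x] \<rho>1 xb by simp
    ultimately have "e \<bullet> y = e \<bullet> x" by metis
    then show False
      using \<rho>1 by (simp add: y_def inner_add_right ee)
  qed
  \<comment> \<open>Projection along \<open>e\<close> onto the hyperplane. It keeps the argument of
    \<open>\<gamma>\<close>, so for \<open>z\<close> near \<open>x\<close> the value of
    \<open>\<gamma>\<close> can be read off at \<open>Q z\<close>, which is on the graph.\<close>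
  define Q where "Q = (\<lambda>z. z - ((n \<bullet> z - b) / (n \<bullet> e)) *\<^sub>R e)"
  have Qx: "Q x = x" using xb by (simp add: Q_def)
  have "continuous (at x) Q"
    unfolding Q_def using ne by (intro continuous_intros) auto
  then obtain \<rho>2 where \<rho>2: "\<rho>2 > 0" "\<And>z. dist z x < \<rho>2 \<Longrightarrow> dist (Q z) (Q x) < \<rho>1"
    unfolding continuous_at_eps_delta using \<rho>1(1) by blast
  define s where "s = sgn (n \<bullet> e)"
  have "z \<in> K \<longleftrightarrow> s * (n \<bullet> z - b) < 0" if z: "z \<in> ball x (min \<rho>2 \<rho>1)" for z
  proof -
    have "Q z \<in> ball x \<rho>1"
      using \<rho>2(2)[of z] z Qx by (simp add: dist_commute)
    moreover have "n \<bullet> Q z = b"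
      using ne by (simp add: Q_def inner_diff_right)
    ultimately have "e \<bullet> Q z = \<gamma> (Q z - (e \<bullet> Q z) *\<^sub>R e)"
      by (rule graph)
    moreover have "Q z - (e \<bullet> Q z) *\<^sub>R e = z - (e \<bullet> z) *\<^sub>R e"
      by (simp add: Q_def inner_diff_right ee algebra_simps)
    ultimately have "\<gamma> (z - (e \<bullet> z) *\<^sub>R e) = e \<bullet> Q z" by simp
    also have "\<dots> = e \<bullet> z - (n \<bullet> z - b) / (n \<bullet> e)"
      by (simp add: Q_def inner_diff_right ee)
    finally have "\<gamma> (z - (e \<bullet> z) *\<^sub>R e) = e \<bullet> z - (n \<bullet> z - b) / (n \<bullet> e)" .
    moreover have "z \<in> K \<longleftrightarrow> e \<bullet> z < \<gamma> (z - (e \<bullet> z) *\<^sub>R e)"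
      using chart z \<rho>1 by auto
    ultimately have "z \<in> K \<longleftrightarrow> (n \<bullet> z - b) / (n \<bullet> e) < 0" by simp
    then show ?thesis
      using ne by (auto simp: s_def sgn_if divide_less_0_iff mult_less_0_iff)
  qed
  moreover have "s = 1 \<or> s = -1" using ne by (auto simp: s_def sgn_if)
  ultimately show ?thesis
    using that[of s "min \<rho>2 \<rho>1"] \<rho>1(1) \<rho>2(1) by auto
qed

text \<open>\<open>outward_normal\<close> is one vector for the whole face, so the side must not
  vary. The ball at \<open>x\<close> contains balls about nearby points in which the same sign is
  valid; the sign is therefore locally constant, and connectedness makes it constant.\<close>

lemma open_lipschitz_halfspace_along_face:
  fixes K \<sigma> :: "(real^'n) set"
  assumes K: "open K" "lipschitz_boundary_in UNIV K"
    and n: "norm n = 1" and \<sigma>: "openin (top_of_set {x. n \<bullet> x = b}) \<sigma>" "\<sigma> \<subseteq> frontier K"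
    and "connected \<sigma>"
  obtains s where "s = 1 \<or> s = (-1::real)"
    "\<And>x. x \<in> \<sigma> \<Longrightarrow> \<exists>\<rho>>0. \<forall>z\<in>ball x \<rho>. z \<in> K \<longleftrightarrow> s * (n \<bullet> z - b) < 0"
proof -
  define P where "P = (\<lambda>x s. \<exists>\<rho>>0. \<forall>z\<in>ball x \<rho>. z \<in> K \<longleftrightarrow> (s::real) * (n \<bullet> z - b) < 0)"
  have ex: "P x 1 \<or> P x (-1)" if "x \<in> \<sigma>" for x
  proof -
    from open_lipschitz_halfspace_at_flat_point[OF K n \<sigma> that] obtain s \<rho> where
      "s = 1 \<or> s = (-1::real)" "\<rho> > 0" "\<And>z. z \<in> ball x \<rho> \<Longrightarrow> z \<in> K \<longleftrightarrow> s * (n \<bullet> z - b) < 0"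
      by metis
    then show ?thesis unfolding P_def by blast
  qed
  have uniq: "\<not> (P x 1 \<and> P x (-1))" if "x \<in> \<sigma>" for x
  proof
    assume "P x 1 \<and> P x (-1)"
    then obtain \<rho>1 \<rho>2 where \<rho>: "\<rho>1 > 0" "\<rho>2 > 0" and
      1: "\<And>z. z \<in> ball x \<rho>1 \<Longrightarrow> z \<in> K \<longleftrightarrow> n \<bullet> z - b < 0" and
      2: "\<And>z. z \<in> ball x \<rho>2 \<Longrightarrow> z \<in> K \<longleftrightarrow> - (n \<bullet> z - b) < 0"
      unfolding P_def by fastforce
    \<comment> \<open>A point slightly on the positive side would be both inside and outside
      \<open>K\<close>.\<close>
    define z where "z = x + (min \<rho>1 \<rho>2 / 2) *\<^sub>R n"
    have "n \<bullet> x = b" using that openin_subset[OF \<sigma>(1)] by auto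
    moreover have "n \<bullet> n = 1" using n by (simp add: norm_eq_1)
    ultimately have "n \<bullet> z - b > 0" using \<rho> by (simp add: z_def inner_add_right)
    moreover have "z \<in> ball x \<rho>1" "z \<in> ball x \<rho>2"
      using \<rho> n by (auto simp: z_def dist_norm min_def)
    ultimately show False using 1 2 by fastforce
  qed
  have near: "eventually (\<lambda>y. P y s) (at x within \<sigma>)" if Px: "P x s" for x s
  proof -
    obtain \<rho> where \<rho>: "\<rho> > 0" "\<forall>z\<in>ball x \<rho>. z \<in> K \<longleftrightarrow> s * (n \<bullet> z - b) < 0"
      using Px unfolding P_def by blast
    have "eventually (\<lambda>y. y \<in> ball x \<rho>) (at x within \<sigma>)"
      using \<rho>(1) by (auto simp: eventually_at intro!: exI[of _ \<rho>] simp: dist_commute)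
    then show ?thesis
    proof eventually_elim
      case (elim y)
      have "z \<in> ball x \<rho>" if "z \<in> ball y (\<rho> - dist x y)" for z
        using that dist_triangle[of x z y] by auto
      then show ?case
        using \<rho>(2) elim unfolding P_def by (intro exI[of _ "\<rho> - dist x y"]) auto
    qed
  qed
  define f where "f = (\<lambda>x. if P x 1 then 1 else (-1::real))"
  have Pf: "P x (f x)" if "x \<in> \<sigma>" for x using ex[OF that] by (auto simp: f_def)
  have "f x = f y" if "x \<in> \<sigma>" "y \<in> \<sigma>" for x y
  proof (rule connected_local_const[OF \<open>connected \<sigma>\<close> that], intro ballI)
    fix a assume a: "a \<in> \<sigma>"
    have "eventually (\<lambda>y. y \<in> \<sigma>) (at a within \<sigma>)"
      by (auto simp: eventually_at_filter)
    with near[OF Pf[OF a]] show "eventually (\<lambda>y. f a = f y) (at a within \<sigma>)"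
      by eventually_elim (use uniq in \<open>auto simp: f_def split: if_splits\<close>)
  qed
  then obtain s where fs: "\<And>x. x \<in> \<sigma> \<Longrightarrow> f x = s" by metis
  then have "\<And>x. x \<in> \<sigma> \<Longrightarrow> P x s" using Pf by metis
  moreover have "s = 1 \<or> s = -1" if \<open>\<sigma> \<noteq> {}\<close>
  proof -
    obtain x where "x \<in> \<sigma>" using \<open>\<sigma> \<noteq> {}\<close> by blast
    then have "s = f x" using fs by simp
    then show ?thesis by (simp add: f_def)
  qed
  ultimately show ?thesis
    using that[of s] that[of 1] unfolding P_def by (cases "\<sigma> = {}") auto
qed

text \<open>A face contains a small disc of its hyperplane. Moving from \<open>x\<close> by a small
  multiple of the tangential part \<open>u\<close> of \<open>m\<close> stays in the face, so
  \<open>u\<close> is orthogonal to \<open>m\<close> and hence zero.\<close>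

lemma unit_vector_normal_to_face:
  fixes \<sigma> :: "'a::euclidean_space set"
  assumes n: "norm n = 1" and \<sigma>: "openin (top_of_set {x. n \<bullet> x = b}) \<sigma>" "\<sigma> \<noteq> {}"
    and m: "norm m = 1" "\<forall>x\<in>\<sigma>. \<forall>y\<in>\<sigma>. m \<bullet> (x - y) = 0"
  shows "m = n \<or> m = - n"
proof -
  obtain x where x: "x \<in> \<sigma>" using \<sigma>(2) by auto
  have nx: "n \<bullet> x = b" using x openin_subset[OF \<sigma>(1)] by auto
  have nn: "n \<bullet> n = 1" "m \<bullet> m = 1" using n m(1) by (auto simp: norm_eq_1)
  obtain \<rho> where \<rho>: "\<rho> > 0" "\<And>y. y \<in> ball x \<rho> \<Longrightarrow> n \<bullet> y = b \<Longrightarrow> y \<in> \<sigma>"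
    using openin_hyperplane_ball[OF \<sigma>(1) x] by blast
  define u where "u = m - (m \<bullet> n) *\<^sub>R n"
  obtain t where t: "t > 0" "t * norm u < \<rho>"
  proof (cases "u = 0")
    case False
    then show ?thesis using that[of "\<rho> / (2 * norm u)"] \<rho>(1) by simp
  qed (use that[of 1] \<rho>(1) in simp)
  have nu: "n \<bullet> u = 0" by (simp add: u_def inner_diff_right nn inner_commute)
  have "x + t *\<^sub>R u \<in> \<sigma>"
    using t nu nx by (intro \<rho>(2)) (auto simp: dist_norm inner_add_right)
  then have "m \<bullet> (t *\<^sub>R u) = 0" using m(2) x by fastforce
  then have "m \<bullet> u = 0" using t by simp
  then have "u \<bullet> u = 0" using nu by (simp add: u_def inner_diff_left)
  then have eq: "m = (m \<bullet> n) *\<^sub>R n" by (simp add: u_def)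
  then have "1 = \<bar>m \<bullet> n\<bar>" using n m(1) by (metis norm_scaleR mult.right_neutral)
  then have "m \<bullet> n = 1 \<or> m \<bullet> n = -1" by linarith
  then show ?thesis using eq by (metis scaleR_minus1_left scaleR_one)
qed

text \<open>Reconciles the arbitrary choices in \<open>face_measure\<close> with the hyperplane
  given by the mesh: the chosen normal may be either of two opposite ones and the base point any
  point of the face, but the hyperplane is the same.\<close>

lemma unit_normal_hyperplane:
  fixes \<sigma> :: "(real^'n) set"
  assumes n: "n \<noteq> 0" and \<sigma>: "openin (top_of_set {x. n \<bullet> x = b}) \<sigma>" "\<sigma> \<noteq> {}"
  shows "norm (unit_normal \<sigma>) = 1"
    and "{x. unit_normal \<sigma> \<bullet> x = unit_normal \<sigma> \<bullet> (SOME x. x \<in> \<sigma>)} = {x. n \<bullet> x = b}"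
proof -
  define n' where "n' = n /\<^sub>R norm n"
  have n': "norm n' = 1" using n by (simp add: n'_def)
  have H: "{x. n \<bullet> x = b} = {x. n' \<bullet> x = b / norm n}"
    using n by (auto simp: n'_def field_simps)
  have \<sigma>H: "n' \<bullet> x = b / norm n" if "x \<in> \<sigma>" for x
    using that openin_subset[OF \<sigma>(1)] H by auto
  have "\<exists>m. norm m = 1 \<and> (\<forall>x\<in>\<sigma>. \<forall>y\<in>\<sigma>. m \<bullet> (x - y) = 0)"
    using n' \<sigma>H by (intro exI[of _ n']) (auto simp: inner_diff_right)
  then have u: "norm (unit_normal \<sigma>) = 1" "\<forall>x\<in>\<sigma>. \<forall>y\<in>\<sigma>. unit_normal \<sigma> \<bullet> (x - y) = 0"
    unfolding unit_normal_def by (rule someI2_ex; blast)+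
  then have "unit_normal \<sigma> = n' \<or> unit_normal \<sigma> = - n'"
    using unit_vector_normal_to_face[OF n' _ \<sigma>(2) u] \<sigma>(1) H by simp
  moreover have "(SOME x. x \<in> \<sigma>) \<in> \<sigma>" using \<sigma>(2) by (simp add: some_in_eq)
  ultimately show "{x. unit_normal \<sigma> \<bullet> x = unit_normal \<sigma> \<bullet> (SOME x. x \<in> \<sigma>)} = {x. n \<bullet> x = b}"
    unfolding H using \<sigma>H[of "SOME x. x \<in> \<sigma>"] by auto
  show "norm (unit_normal \<sigma>) = 1" by (rule u(1))
qed

text \<open>Evaluates the definite description: there are only two opposite unit normals, and the
  wrong one would require the same short step from \<open>x\<close> to end both inside and outside
  \<open>K\<close>.\<close>

lemma outward_normal_eq:
  fixes K \<sigma> :: "(real^'n) set"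
  assumes n: "norm n = 1" and \<sigma>: "openin (top_of_set {x. n \<bullet> x = b}) \<sigma>" "\<sigma> \<noteq> {}"
    and s: "s = 1 \<or> s = -1"
    and half: "\<And>x. x \<in> \<sigma> \<Longrightarrow> \<exists>\<rho>>0. \<forall>z\<in>ball x \<rho>. z \<in> K \<longleftrightarrow> s * (n \<bullet> z - b) < 0"
  shows "outward_normal K \<sigma> = s *\<^sub>R n"
  unfolding outward_normal_def
proof (rule the_equality)
  have \<sigma>H: "n \<bullet> x = b" if "x \<in> \<sigma>" for x
    using that openin_subset[OF \<sigma>(1)] by auto
  have nn: "n \<bullet> n = 1" and ss: "s * s = 1" using n s by (auto simp: norm_eq_1)
  have dir: "\<exists>\<delta>>0. \<forall>t. 0 < t \<and> t < \<delta> \<longrightarrow> x - t *\<^sub>R (s *\<^sub>R n) \<in> K \<and> x + t *\<^sub>R (s *\<^sub>R n) \<notin> K"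
    if x: "x \<in> \<sigma>" for x
  proof -
    obtain \<rho> where \<rho>: "\<rho> > 0" "\<And>z. z \<in> ball x \<rho> \<Longrightarrow> z \<in> K \<longleftrightarrow> s * (n \<bullet> z - b) < 0"
      using half[OF x] by auto
    have "x - t *\<^sub>R (s *\<^sub>R n) \<in> K \<and> x + t *\<^sub>R (s *\<^sub>R n) \<notin> K" if t: "0 < t" "t < \<rho>" for t
    proof -
      have "x - t *\<^sub>R (s *\<^sub>R n) \<in> ball x \<rho>" "x + t *\<^sub>R (s *\<^sub>R n) \<in> ball x \<rho>"
        using t s n by (auto simp: dist_norm)
      then show ?thesis
        using \<rho>(2)[of "x - t *\<^sub>R (s *\<^sub>R n)"] \<rho>(2)[of "x + t *\<^sub>R (s *\<^sub>R n)"] t s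
        by (auto simp: inner_diff_right inner_add_right \<sigma>H[OF x] nn)
    qed
    then show ?thesis using \<rho>(1) by blast
  qed
  show good: "norm (s *\<^sub>R n) = 1 \<and> (\<forall>x\<in>\<sigma>. \<forall>y\<in>\<sigma>. (s *\<^sub>R n) \<bullet> (x - y) = 0) \<and>
     (\<forall>x\<in>\<sigma>. \<exists>\<delta>>0. \<forall>t. 0 < t \<and> t < \<delta> \<longrightarrow> x - t *\<^sub>R (s *\<^sub>R n) \<in> K \<and> x + t *\<^sub>R (s *\<^sub>R n) \<notin> K)"
    using dir n s \<sigma>H by (auto simp: inner_diff_right)
  fix m
  assume m: "norm m = 1 \<and> (\<forall>x\<in>\<sigma>. \<forall>y\<in>\<sigma>. m \<bullet> (x - y) = 0) \<and>
     (\<forall>x\<in>\<sigma>. \<exists>\<delta>>0. \<forall>t. 0 < t \<and> t < \<delta> \<longrightarrow> x - t *\<^sub>R m \<in> K \<and> x + t *\<^sub>R m \<notin> K)"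
  then have "m = n \<or> m = - n" by (intro unit_vector_normal_to_face[OF n \<sigma>]) auto
  then have "m = s *\<^sub>R n \<or> m = - (s *\<^sub>R n)" using s by auto
  moreover have "m \<noteq> - (s *\<^sub>R n)"
  proof
    assume eq: "m = - (s *\<^sub>R n)"
    obtain x where x: "x \<in> \<sigma>" using \<sigma>(2) by auto
    obtain \<delta>1 where 1: "\<delta>1 > 0" "\<And>t. 0 < t \<Longrightarrow> t < \<delta>1 \<Longrightarrow> x - t *\<^sub>R (s *\<^sub>R n) \<in> K"
      using dir[OF x] by blast
    obtain \<delta>2 where 2: "\<delta>2 > 0" "\<And>t. 0 < t \<Longrightarrow> t < \<delta>2 \<Longrightarrow> x + t *\<^sub>R m \<notin> K"
      using m x by blast
    show False
      using 1(1) 2(1) 1(2)[of "min \<delta>1 \<delta>2 / 2"] 2(2)[of "min \<delta>1 \<delta>2 / 2"]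
      by (cases "\<delta>1 \<le> \<delta>2") (auto simp: eq min_def)
  qed
  ultimately show "m = s *\<^sub>R n" by blast
qed

text \<open>The closure of the face is a finite union of polytopes. Their preimages under the affine
  projection are convex, and frontiers of convex sets are negligible. The Lipschitz chart of the
  face shows that preimages of its relative boundary points lie on these frontiers.\<close>

lemma face_boundary_projection_negligible:
  fixes \<sigma> :: "(real^'n) set"
  assumes \<sigma>: "lipschitz_polytopal_in {x. n \<bullet> x = b} \<sigma>" and nv: "n \<bullet> v \<noteq> 0"
  shows "negligible {x. x - ((n \<bullet> x - b) / (n \<bullet> v)) *\<^sub>R v \<in> closure \<sigma> - \<sigma>}"
proof -
  define H where "H = {x. n \<bullet> x = b}"
  define Q where "Q = (\<lambda>x. x - ((n \<bullet> x - b) / (n \<bullet> v)) *\<^sub>R v)"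
  have op: "openin (top_of_set H) \<sigma>" and lb: "lipschitz_boundary_in H \<sigma>"
    using \<sigma> by (auto simp: lipschitz_polytopal_in_def H_def)
  obtain F where F: "finite F" "\<And>P. P \<in> F \<Longrightarrow> polytope P" "closure \<sigma> = \<Union>F"
    using \<sigma> by (auto simp: lipschitz_polytopal_in_def)
  have \<sigma>H: "\<sigma> \<subseteq> H" using openin_subset[OF op] by simp
  have "closed H" unfolding H_def by (rule closed_hyperplane)
  then have cH: "closure \<sigma> \<subseteq> H" using \<sigma>H by (simp add: closure_minimal)
  have conv: "convex (Q -` P)" if "P \<in> F" for P
  proof -
    have "Q (u *\<^sub>R x + w *\<^sub>R y) = u *\<^sub>R Q x + w *\<^sub>R Q y" if "u + w = 1" for u w x y
    proof -
      have "b = u * b + w * b" using that by (metis distrib_right mult_1)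
      then have "n \<bullet> (u *\<^sub>R x + w *\<^sub>R y) - b = u * (n \<bullet> x - b) + w * (n \<bullet> y - b)"
        by (simp add: inner_add_right algebra_simps)
      then have "(n \<bullet> (u *\<^sub>R x + w *\<^sub>R y) - b) / (n \<bullet> v)
          = u * ((n \<bullet> x - b) / (n \<bullet> v)) + w * ((n \<bullet> y - b) / (n \<bullet> v))"
        by (simp add: add_divide_distrib)
      then show ?thesis
        by (simp add: Q_def algebra_simps)
    qed
    then show ?thesis
      using polytope_imp_convex[OF F(2)[OF that]] by (auto simp: convex_def)
  qed
  have "{x. Q x \<in> closure \<sigma> - \<sigma>} \<subseteq> (\<Union>P\<in>F. frontier (Q -` P))"
  proof
    fix x assume "x \<in> {x. Q x \<in> closure \<sigma> - \<sigma>}"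
    then have x: "Q x \<in> closure \<sigma>" "Q x \<notin> \<sigma>" by auto
    then obtain P where P: "P \<in> F" "Q x \<in> P" using F(3) by auto
    obtain e r \<gamma> L where e: "norm e = 1" "Q x + e \<in> H" and r: "r > 0"
      and L: "L-lipschitz_on UNIV (\<gamma> :: real^'n \<Rightarrow> real)"
      and chart: "\<forall>y \<in> H \<inter> ball (Q x) r. y \<in> \<sigma> \<longleftrightarrow> e \<bullet> y < \<gamma> (y - (e \<bullet> y) *\<^sub>R e)"
      using lb x unfolding lipschitz_boundary_in_def by blast
    have QH: "Q x \<in> H" using x cH by auto
    then have ne: "n \<bullet> e = 0" using e(2) by (simp add: H_def inner_add_right)
    have ee: "e \<bullet> e = 1" using e by (simp add: norm_eq_1)
    \<comment> \<open>\<open>Q x\<close> is not in the face, so it lies on or above the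
      graph.\<close>
    have ge: "e \<bullet> Q x \<ge> \<gamma> (Q x - (e \<bullet> Q x) *\<^sub>R e)"
      using chart QH r x(2) by force
    \<comment> \<open>As \<open>e\<close> is parallel to the hyperplane, \<open>Q\<close> carries a
      small step along \<open>e\<close> over unchanged. For interior \<open>x\<close> the step would
      stay in \<open>P\<close>, but from a point on or above the graph it leaves the closure of the
      face.\<close>
    have "x \<notin> interior (Q -` P)"
    proof
      assume "x \<in> interior (Q -` P)"
      then obtain \<rho> where \<rho>: "\<rho> > 0" "ball x \<rho> \<subseteq> Q -` P"
        by (auto simp: mem_interior)
      define t where "t = min \<rho> r / 2"
      have t: "t > 0" "t < \<rho>" "t < r" using \<rho>(1) r by (auto simp: t_def)
      have Qt: "Q (x + t *\<^sub>R e) = Q x + t *\<^sub>R e"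
        by (simp add: Q_def inner_add_right ne)
      have "x + t *\<^sub>R e \<in> ball x \<rho>" using t e by (simp add: dist_norm)
      then have "Q (x + t *\<^sub>R e) \<in> P" using \<rho>(2) by blast
      then have "Q x + t *\<^sub>R e \<in> closure \<sigma>"
        unfolding Qt F(3) using P(1) by blast
      moreover have "Q x + t *\<^sub>R e \<notin> closure \<sigma>"
      proof (rule above_graph_not_in_closure[OF \<sigma>H L chart])
        show "Q x + t *\<^sub>R e \<in> ball (Q x) r" using t e by (simp add: dist_norm)
        have "Q x + t *\<^sub>R e - (e \<bullet> (Q x + t *\<^sub>R e)) *\<^sub>R e = Q x - (e \<bullet> Q x) *\<^sub>R e"
          by (simp add: inner_add_right ee algebra_simps)
        moreover have "e \<bullet> Q x < e \<bullet> (Q x + t *\<^sub>R e)"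
          using t by (simp add: inner_add_right ee)
        ultimately show "\<gamma> (Q x + t *\<^sub>R e - (e \<bullet> (Q x + t *\<^sub>R e)) *\<^sub>R e) < e \<bullet> (Q x + t *\<^sub>R e)"
          using ge by (metis order_le_less_trans)
      qed
      ultimately show False by contradiction
    qed
    then have "x \<in> frontier (Q -` P)"
      using P(2) closure_subset[of "Q -` P"] by (auto simp: frontier_def)
    then show "x \<in> (\<Union>P\<in>F. frontier (Q -` P))" using P(1) by blast
  qed
  moreover have "negligible (\<Union>P\<in>F. frontier (Q -` P))"
    using F(1) conv by (intro negligible_Union) (auto intro: negligible_convex_frontier)
  ultimately show ?thesis
    using negligible_subset unfolding Q_def by blast
qed


section \<open>The divergence theorem on a domain with flat faces\<close>

text \<open>Turns the pushforward into a Lebesgue integral over the slab, the form that can be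
  compared with projections along other directions.\<close>

lemma integral_face_measure:
  fixes \<sigma> :: "(real^'n) set" and f :: "real^'n \<Rightarrow> real"
  assumes m: "m = unit_normal \<sigma>" and b: "b = m \<bullet> (SOME x. x \<in> \<sigma>)"
    and [measurable]: "\<sigma> \<in> sets borel" "f \<in> borel_measurable borel"
  shows "(\<integral>x. f x \<partial>face_measure \<sigma>) =
    (\<integral>x. indicator {b..b + 1} (m \<bullet> x) *
      (indicator \<sigma> (x - (m \<bullet> x - b) *\<^sub>R m) * f (x - (m \<bullet> x - b) *\<^sub>R m)) \<partial>lborel)"
proof -
  define P where "P = (\<lambda>x. x - (m \<bullet> x - b) *\<^sub>R m)"
  have [measurable]: "P \<in> borel_measurable borel"
    unfolding P_def by measurable
  define A where "A = {x. b \<le> m \<bullet> x \<and> m \<bullet> x \<le> b + 1}"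
  have [measurable]: "A \<in> sets borel" unfolding A_def by measurable
  have "face_measure \<sigma> = restrict_space (distr (restrict_space lborel A) borel P) \<sigma>"
    by (simp add: face_measure_def Let_def m b A_def P_def)
  then have "(\<integral>x. f x \<partial>face_measure \<sigma>) = (\<integral>x. indicator \<sigma> x * f x \<partial>distr (restrict_space lborel A) borel P)"
    using integral_restrict_space[of \<sigma> "distr (restrict_space lborel A) borel P" f] assms(3) by simp
  also have "\<dots> = (\<integral>x. indicator \<sigma> (P x) * f (P x) \<partial>restrict_space lborel A)"
    by (rule integral_distr) (auto intro!: measurable_restrict_space1)
  also have "\<dots> = (\<integral>x. indicator A x * (indicator \<sigma> (P x) * f (P x)) \<partial>lborel)"
    by (simp add: integral_restrict_space)
  also have "(\<lambda>x. indicator A x) = (\<lambda>x. indicator {b..b + 1} (m \<bullet> x) :: real)"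
    by (auto simp: A_def indicator_def)
  finally show ?thesis by (simp add: P_def)
qed

text \<open>A slab can be unbounded, but the integrand has bounded support: if \<open>x\<close> is
  in the slab and its shift along \<open>v\<close> lands in the bounded set \<open>\<sigma>\<close>,
  then the shift is bounded because \<open>v\<close> is transversal to the slab.\<close>

lemma integrable_slab_oblique_projection:
  fixes \<sigma> :: "'a::euclidean_space set" and f :: "'a \<Rightarrow> real"
  assumes [measurable]: "\<sigma> \<in> sets borel" and \<sigma>: "bounded \<sigma>" and f: "continuous_on UNIV f"
    and nz: "m' \<bullet> v \<noteq> 0" and [measurable]: "g \<in> borel_measurable borel"
  shows "integrable lborel (\<lambda>x. slab_weight m' b' v x *
    (indicator \<sigma> (x - g x *\<^sub>R v) * f (x - g x *\<^sub>R v)))"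
proof -
  have [measurable]: "f \<in> borel_measurable borel"
    using f by (rule borel_measurable_continuous_onI)
  obtain R where R: "\<And>x. x \<in> \<sigma> \<Longrightarrow> norm x \<le> R"
    using \<sigma> by (auto simp: bounded_iff)
  have "compact (closure \<sigma>)" using \<sigma> by (simp add: compact_closure)
  then have "bounded (f ` closure \<sigma>)"
    using f by (intro compact_imp_bounded compact_continuous_image) (auto intro: continuous_on_subset)
  then obtain B where "\<And>x. x \<in> \<sigma> \<Longrightarrow> \<bar>f x\<bar> \<le> B"
    using closure_subset by (fastforce simp: bounded_iff)
  \<comment> \<open>\<open>\<sigma>\<close> may be empty, so \<open>B\<close> itself could be
    negative.\<close>
  then have B: "\<And>x. x \<in> \<sigma> \<Longrightarrow> \<bar>f x\<bar> \<le> \<bar>B\<bar>"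
    by (meson abs_ge_self order_trans)
  \<comment> \<open>The bound for points of \<open>\<sigma>\<close> plus the longest possible shift;
    \<open>\<bar>g x\<bar> * \<bar>m' \<bullet> v\<bar>\<close> is the change of
    \<open>m' \<bullet> x\<close> under the shift, and both values are bounded.\<close>
  define C where "C = R + (\<bar>b'\<bar> + 1 + norm m' * R) / \<bar>m' \<bullet> v\<bar> * norm v"
  show ?thesis
  proof (rule integrableI_bounded_set[where A="cball 0 C" and B="\<bar>m' \<bullet> v\<bar> * \<bar>B\<bar>"])
    show "AE x \<in> cball 0 C in lborel. norm (slab_weight m' b' v x *
        (indicator \<sigma> (x - g x *\<^sub>R v) * f (x - g x *\<^sub>R v))) \<le> \<bar>m' \<bullet> v\<bar> * \<bar>B\<bar>"
      using B R by (intro AE_I2) (auto simp: slab_weight_def indicator_def abs_mult intro!: mult_left_mono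
          intro: order_trans[OF abs_ge_zero])
    have "norm x \<le> C" if "b' \<le> m' \<bullet> x" "m' \<bullet> x \<le> b' + 1" "x - g x *\<^sub>R v \<in> \<sigma>" for x
    proof -
      define y where "y = x - g x *\<^sub>R v"
      have y: "norm y \<le> R" using R that by (simp add: y_def)
      have "m' \<bullet> x - m' \<bullet> y = g x * (m' \<bullet> v)"
        by (simp add: y_def inner_diff_right)
      then have "\<bar>g x\<bar> * \<bar>m' \<bullet> v\<bar> = \<bar>m' \<bullet> x - m' \<bullet> y\<bar>"
        by (simp add: abs_mult)
      also have "\<dots> \<le> \<bar>b'\<bar> + 1 + norm m' * norm y"
        using that Cauchy_Schwarz_ineq2[of m' y] by linarith
      also have "\<dots> \<le> \<bar>b'\<bar> + 1 + norm m' * R"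
        using y by (simp add: mult_left_mono)
      finally have "\<bar>g x\<bar> \<le> (\<bar>b'\<bar> + 1 + norm m' * R) / \<bar>m' \<bullet> v\<bar>"
        using nz by (simp add: field_simps)
      then have "\<bar>g x\<bar> * norm v \<le> (\<bar>b'\<bar> + 1 + norm m' * R) / \<bar>m' \<bullet> v\<bar> * norm v"
        by (intro mult_right_mono) auto
      moreover have "norm x \<le> norm y + \<bar>g x\<bar> * norm v"
        using norm_triangle_ineq[of y "g x *\<^sub>R v"] by (simp add: y_def)
      ultimately show ?thesis using y by (simp add: C_def)
    qed
    then show "AE x in lborel. x \<notin> cball 0 C \<longrightarrow> slab_weight m' b' v x *
        (indicator \<sigma> (x - g x *\<^sub>R v) * f (x - g x *\<^sub>R v)) = 0"
      by (intro AE_I2) (auto simp: slab_weight_def indicator_def)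
  qed (use emeasure_bounded_finite[OF bounded_cball, of "0::'a" C] in auto)
qed

text \<open>The integrand is constant along \<open>v\<close>, so the slab may be exchanged for the
  one at the hyperplane of the face, whose weight leaves the factor
  \<open>\<bar>m \<bullet> v\<bar>\<close>. A shear parallel to the hyperplane then turns the
  oblique projection into the orthogonal one.\<close>

lemma integral_oblique_projection:
  fixes \<sigma> :: "'a::euclidean_space set" and f :: "'a \<Rightarrow> real" and b :: real
  assumes m: "norm m = 1" and \<sigma>b [measurable]: "\<sigma> \<in> sets borel" and \<sigma>: "bounded \<sigma>"
    and f: "continuous_on UNIV f" and mv: "m \<bullet> v \<noteq> 0" and wv: "m' \<bullet> v \<noteq> 0"
  defines "Q \<equiv> \<lambda>x. x - ((m \<bullet> x - b) / (m \<bullet> v)) *\<^sub>R v"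
    and "P \<equiv> \<lambda>x. x - (m \<bullet> x - b) *\<^sub>R m"
  shows "(\<integral>x. slab_weight m' b' v x * (indicator \<sigma> (Q x) * f (Q x)) \<partial>lborel)
    = \<bar>m \<bullet> v\<bar> * (\<integral>x. indicator {b..b + 1} (m \<bullet> x) * (indicator \<sigma> (P x) * f (P x)) \<partial>lborel)"
proof -
  have mm: "m \<bullet> m = 1" using m by (simp add: norm_eq_1)
  have [measurable]: "f \<in> borel_measurable borel"
    using f by (rule borel_measurable_continuous_onI)
  define G where "G = (\<lambda>x. indicator {b..b + 1} (m \<bullet> x) * (indicator \<sigma> (P x) * f (P x)))"
  \<comment> \<open>Tangential to the hyperplane, with \<open>u - m\<close> parallel to
    \<open>v\<close>: after the shear by \<open>(m \<bullet> x - b) *\<^sub>R u\<close>, the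
    orthogonal projection \<open>P\<close> returns \<open>Q x\<close>.\<close>
  define u where "u = m - (1 / (m \<bullet> v)) *\<^sub>R v"
  have mu: "m \<bullet> u = 0" using mv by (simp add: u_def inner_diff_right mm)
  have Qinv: "Q (x + t *\<^sub>R v) = Q x" for x t
    using mv by (simp add: Q_def inner_add_right add_divide_distrib diff_divide_distrib algebra_simps)
  have int: "integrable lborel (\<lambda>x. slab_weight m b v x * (indicator \<sigma> (Q x) * f (Q x)))"
    unfolding Q_def by (rule integrable_slab_oblique_projection[OF \<sigma>b \<sigma> f mv]) measurable
  have GQ: "(\<lambda>x. indicator {b..b + 1} (m \<bullet> x) * (indicator \<sigma> (Q x) * f (Q x)))
      = (\<lambda>x. G (x + (m \<bullet> x - b) *\<^sub>R u))"
  proof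
    fix x
    have "P (x + (m \<bullet> x - b) *\<^sub>R u) = Q x"
    proof -
      have "P (x + (m \<bullet> x - b) *\<^sub>R u) = x + (m \<bullet> x - b) *\<^sub>R (u - m)"
        by (simp add: P_def inner_add_right mu algebra_simps)
      then show ?thesis by (simp add: Q_def u_def)
    qed
    then show "indicator {b..b + 1} (m \<bullet> x) * (indicator \<sigma> (Q x) * f (Q x)) = G (x + (m \<bullet> x - b) *\<^sub>R u)"
      by (simp add: G_def inner_add_right mu)
  qed
  have "(\<integral>x. slab_weight m' b' v x * (indicator \<sigma> (Q x) * f (Q x)) \<partial>lborel)
      = (\<integral>x. slab_weight m b v x * (indicator \<sigma> (Q x) * f (Q x)) \<partial>lborel)"
    by (rule lborel_integral_invariant_slab[OF _ int wv mv]) (simp add: Qinv)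
  also have "\<dots> = \<bar>m \<bullet> v\<bar> * (\<integral>x. indicator {b..b + 1} (m \<bullet> x) * (indicator \<sigma> (Q x) * f (Q x)) \<partial>lborel)"
    by (simp add: slab_weight_def mult.assoc)
  also note GQ
  also have "(\<integral>x. G (x + (m \<bullet> x - b) *\<^sub>R u) \<partial>lborel) = (\<integral>x. G x \<partial>lborel)"
  proof (rule lborel_integral_shear)
    show "integrable lborel G"
      using integrable_slab_oblique_projection[OF \<sigma>b \<sigma> f, of m m "\<lambda>x. m \<bullet> x - b" b]
      by (simp add: G_def P_def slab_weight_def mm)
    have "(\<lambda>x. G (x + (m \<bullet> x - b) *\<^sub>R u)) = (\<lambda>x. (1 / \<bar>m \<bullet> v\<bar>) * (slab_weight m b v x * (indicator \<sigma> (Q x) * f (Q x))))"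
      unfolding GQ[symmetric] using mv by (auto simp: slab_weight_def)
    then show "integrable lborel (\<lambda>x. G (x + (m \<bullet> x - b) *\<^sub>R u))"
      using int by simp
  qed (simp add: inner_add_right mu)
  finally show ?thesis by (simp add: G_def)
qed

lemma AE_lborel_not_in_negligible:
  "negligible N \<Longrightarrow> AE x in lborel. x \<notin> N"
  using AE_not_in[of N lebesgue] by (simp add: negligible_iff_null_sets AE_completion_iff)

text \<open>A crossing of \<open>\<sigma>\<close> contributes the sign
  \<open>s \<sigma> * sgn (m \<sigma> \<bullet> v)\<close> on its line, and averaging the crossings
  over all lines contributes \<open>\<bar>m \<sigma> \<bullet> v\<bar>\<close>. The product is
  \<open>outward_normal K \<sigma> \<bullet> v\<close>.\<close>

theorem divergence_theorem_flat_faces: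
  fixes K :: "(real^'n) set"
  assumes K: "open K" "bounded K" "lipschitz_boundary_in UNIV K"
    and F: "finite F" "disjoint F" "frontier K = (\<Union>\<sigma>\<in>F. closure \<sigma>)"
    and face: "\<And>\<sigma>. \<sigma> \<in> F \<Longrightarrow> \<sigma> \<noteq> {} \<and> connected \<sigma> \<and>
        (\<exists>n b. n \<noteq> 0 \<and> lipschitz_polytopal_in {x. n \<bullet> x = b} \<sigma>)"
    and v: "norm v = 1"
    and p: "\<And>x t. ((\<lambda>t. p (x + t *\<^sub>R v)) has_real_derivative p' (x + t *\<^sub>R v)) (at t)"
    and cont: "continuous_on UNIV p" "continuous_on UNIV p'"
  shows "(\<integral>x. indicator K x * p' x \<partial>lborel)
    = (\<Sum>\<sigma>\<in>F. (outward_normal K \<sigma> \<bullet> v) * (\<integral>x. p x \<partial>face_measure \<sigma>))"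
proof -
  define m where "m = (unit_normal :: (real^'n) set \<Rightarrow> real^'n)"
  define b where "b = (\<lambda>\<sigma>. m \<sigma> \<bullet> (SOME x. x \<in> \<sigma>))"
  \<comment> \<open>For a face transversal to \<open>v\<close>, the point where the line through
    \<open>x\<close> meets the hyperplane of the face; \<open>T\<close> is the time of that
    meeting.\<close>
  define Q where "Q = (\<lambda>\<sigma> x. x - ((m \<sigma> \<bullet> x - b \<sigma>) / (m \<sigma> \<bullet> v)) *\<^sub>R v)"
  define T where "T = (\<lambda>\<sigma> x. - ((m \<sigma> \<bullet> x - b \<sigma>) / (m \<sigma> \<bullet> v)))"
  have QT: "Q \<sigma> x = x + T \<sigma> x *\<^sub>R v" for \<sigma> x by (simp add: Q_def T_def)
  have vv: "v \<bullet> v = 1" using v by (simp add: norm_eq_1)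
  have hyp: "norm (m \<sigma>) = 1" "lipschitz_polytopal_in {x. m \<sigma> \<bullet> x = b \<sigma>} \<sigma>" if \<sigma>: "\<sigma> \<in> F" for \<sigma>
  proof -
    obtain n c where n: "n \<noteq> 0" "lipschitz_polytopal_in {x. n \<bullet> x = c} \<sigma>" using face[OF \<sigma>] by blast
    then have o: "openin (top_of_set {x. n \<bullet> x = c}) \<sigma>" by (simp add: lipschitz_polytopal_in_def)
    show "norm (m \<sigma>) = 1" "lipschitz_polytopal_in {x. m \<sigma> \<bullet> x = b \<sigma>} \<sigma>"
      using unit_normal_hyperplane[OF n(1) o] face[OF \<sigma>] n(2) by (auto simp: m_def b_def)
  qed
  have op: "openin (top_of_set {x. m \<sigma> \<bullet> x = b \<sigma>}) \<sigma>" if "\<sigma> \<in> F" for \<sigma>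
    using hyp(2)[OF that] by (simp add: lipschitz_polytopal_in_def)
  have \<sigma>H: "closure \<sigma> \<subseteq> {x. m \<sigma> \<bullet> x = b \<sigma>}" if "\<sigma> \<in> F" for \<sigma>
    using openin_subset[OF op[OF that]] by (intro closure_minimal closed_hyperplane) auto
  have \<sigma>b: "\<sigma> \<in> sets borel" if \<sigma>: "\<sigma> \<in> F" for \<sigma>
  proof -
    obtain W where "open W" "\<sigma> = {x. m \<sigma> \<bullet> x = b \<sigma>} \<inter> W"
      using op[OF \<sigma>] unfolding openin_open by blast
    then show ?thesis by (metis borel_closed borel_open closed_hyperplane sets.Int)
  qed
  have \<sigma>fr: "\<sigma> \<subseteq> frontier K" if "\<sigma> \<in> F" for \<sigma>
    using F(3) that closure_subset by fastforce
  have \<sigma>bd: "bounded \<sigma>" if "\<sigma> \<in> F" for \<sigma>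
    using \<sigma>fr[OF that] K(2) unfolding frontier_def
    by (meson Diff_subset bounded_closure bounded_subset)
  have "\<exists>s. (s = 1 \<or> s = (-1::real)) \<and>
      (\<forall>x\<in>\<sigma>. \<exists>\<rho>>0. \<forall>z\<in>ball x \<rho>. z \<in> K \<longleftrightarrow> s * (m \<sigma> \<bullet> z - b \<sigma>) < 0)" if "\<sigma> \<in> F" for \<sigma>
    using open_lipschitz_halfspace_along_face[OF K(1,3) hyp(1)[OF that] op[OF that] \<sigma>fr[OF that]]
      face[OF that] by metis
  then obtain s where s: "\<And>\<sigma>. \<sigma> \<in> F \<Longrightarrow> s \<sigma> = 1 \<or> s \<sigma> = (-1::real)"
    and half: "\<And>\<sigma> x. \<sigma> \<in> F \<Longrightarrow> x \<in> \<sigma> \<Longrightarrow> \<exists>\<rho>>0. \<forall>z\<in>ball x \<rho>. z \<in> K \<longleftrightarrow> s \<sigma> * (m \<sigma> \<bullet> z - b \<sigma>) < 0"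
    by metis
  have normal: "outward_normal K \<sigma> = s \<sigma> *\<^sub>R m \<sigma>" if "\<sigma> \<in> F" for \<sigma>
    using outward_normal_eq[OF hyp(1)[OF that] op[OF that] _ s[OF that] half[OF that]] face[OF that] by blast
  \<comment> \<open>Faces parallel to \<open>v\<close> carry no flux, as their normal is orthogonal
    to \<open>v\<close>.\<close>
  define A where "A = {\<sigma>\<in>F. m \<sigma> \<bullet> v \<noteq> 0}"
  have A: "finite A" "A \<subseteq> F" using F(1) by (auto simp: A_def)
  \<comment> \<open>Excluded are the lines inside the hyperplane of a parallel face and those
    through the relative boundary of a transversal one.\<close>
  define good where "good = (\<lambda>x. (\<forall>\<sigma>\<in>F. m \<sigma> \<bullet> v = 0 \<longrightarrow> m \<sigma> \<bullet> x \<noteq> b \<sigma>) \<and> (\<forall>\<sigma>\<in>A. Q \<sigma> x \<notin> closure \<sigma> - \<sigma>))"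
  have ae: "AE x in lborel. good x"
  proof -
    have "AE x in lborel. m \<sigma> \<bullet> x \<noteq> b \<sigma>" if "\<sigma> \<in> F" for \<sigma>
    proof -
      have "m \<sigma> \<noteq> 0" using hyp(1)[OF that] by force
      then show ?thesis
        using AE_lborel_not_in_negligible[OF negligible_hyperplane[of "m \<sigma>" "b \<sigma>"]] by simp
    qed
    then have "AE x in lborel. \<forall>\<sigma>\<in>F. m \<sigma> \<bullet> x \<noteq> b \<sigma>"
      using F(1) by (simp add: AE_finite_all)
    moreover have "AE x in lborel. Q \<sigma> x \<notin> closure \<sigma> - \<sigma>" if "\<sigma> \<in> A" for \<sigma>
      using AE_lborel_not_in_negligible[OF face_boundary_projection_negligible[OF hyp(2), of \<sigma> v]] that
      by (simp add: A_def Q_def)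
    then have "AE x in lborel. \<forall>\<sigma>\<in>A. Q \<sigma> x \<notin> closure \<sigma> - \<sigma>"
      using A(1) by (simp add: AE_finite_all)
    ultimately show ?thesis
      by eventually_elim (auto simp: good_def)
  qed
  have line: "(\<integral>t. indicator K (x + t *\<^sub>R v) * p' (x + t *\<^sub>R v) \<partial>lborel)
      = (\<Sum>\<sigma>\<in>A. s \<sigma> * sgn (m \<sigma> \<bullet> v) * (indicator \<sigma> (Q \<sigma> x) * p (Q \<sigma> x)))" if x: "good x" for x
  proof -
    define U where "U = {t. x + t *\<^sub>R v \<in> K}"
    define S where "S = {\<sigma>\<in>A. Q \<sigma> x \<in> \<sigma>}"
    have tcont: "continuous_on UNIV (\<lambda>t. x + t *\<^sub>R v)" by (intro continuous_intros)
    have oU: "open U" unfolding U_def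
      using open_vimage[OF K(1) tcont] by (simp add: vimage_def)
    have bU: "bounded U"
    proof -
      obtain R where R: "\<And>y. y \<in> K \<Longrightarrow> norm y \<le> R" using K(2) by (auto simp: bounded_iff)
      have "\<bar>t\<bar> \<le> R + norm x" if "t \<in> U" for t
        using R[of "x + t *\<^sub>R v"] norm_triangle_ineq4[of "x + t *\<^sub>R v" x] that v by (simp add: U_def)
      then show ?thesis by (auto simp: bounded_iff)
    qed
    have frU: "frontier U \<subseteq> (\<lambda>\<sigma>. T \<sigma> x) ` S"
    proof
      fix t assume "t \<in> frontier U"
      then have t: "t \<in> closure U" "t \<notin> U" using oU by (auto simp: frontier_def interior_open)
      have "U \<subseteq> (\<lambda>t. x + t *\<^sub>R v) -` closure K"
        using closure_subset by (auto simp: U_def)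
      moreover have "closed ((\<lambda>t. x + t *\<^sub>R v) -` closure K)"
        by (rule closed_vimage[OF closed_closure tcont])
      ultimately have "x + t *\<^sub>R v \<in> closure K"
        using t(1) closure_minimal by blast
      then have "x + t *\<^sub>R v \<in> frontier K"
        using t(2) K(1) by (auto simp: U_def frontier_def interior_open)
      then obtain \<sigma> where \<sigma>: "\<sigma> \<in> F" "x + t *\<^sub>R v \<in> closure \<sigma>" using F(3) by auto
      then have eq: "m \<sigma> \<bullet> x + t * (m \<sigma> \<bullet> v) = b \<sigma>"
        using \<sigma>H[OF \<sigma>(1)] by (auto simp: inner_add_right)
      then have nz: "m \<sigma> \<bullet> v \<noteq> 0" using x \<sigma>(1) by (auto simp: good_def)
      then have tT: "t = T \<sigma> x" using eq by (auto simp: T_def field_simps)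
      then have "Q \<sigma> x \<in> \<sigma>"
        using x nz \<sigma> by (auto simp: good_def A_def QT)
      then show "t \<in> (\<lambda>\<sigma>. T \<sigma> x) ` S"
        using tT nz \<sigma>(1) by (auto simp: S_def A_def)
    qed
    have inj: "inj_on (\<lambda>\<sigma>. T \<sigma> x) S"
    proof (rule inj_onI)
      fix \<sigma> \<tau> assume *: "\<sigma> \<in> S" "\<tau> \<in> S" "T \<sigma> x = T \<tau> x"
      then have "Q \<sigma> x \<in> \<sigma> \<inter> \<tau>" by (auto simp: S_def QT)
      then show "\<sigma> = \<tau>" using F(2) * by (auto simp: S_def A_def disjoint_def)
    qed
    have loc: "\<exists>\<rho>>0. \<forall>t. \<bar>t - T \<sigma> x\<bar> < \<rho> \<longrightarrow> (t \<in> U \<longleftrightarrow> s \<sigma> * sgn (m \<sigma> \<bullet> v) * (t - T \<sigma> x) < 0)"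
      if "\<sigma> \<in> S" for \<sigma>
    proof -
      have \<sigma>: "\<sigma> \<in> F" "m \<sigma> \<bullet> v \<noteq> 0" "Q \<sigma> x \<in> \<sigma>" using that by (auto simp: S_def A_def)
      obtain \<rho> where \<rho>: "\<rho> > 0" "\<And>z. z \<in> ball (Q \<sigma> x) \<rho> \<Longrightarrow> z \<in> K \<longleftrightarrow> s \<sigma> * (m \<sigma> \<bullet> z - b \<sigma>) < 0"
        using half[OF \<sigma>(1,3)] by blast
      have "t \<in> U \<longleftrightarrow> s \<sigma> * sgn (m \<sigma> \<bullet> v) * (t - T \<sigma> x) < 0" if t: "\<bar>t - T \<sigma> x\<bar> < \<rho>" for t
      proof -
        have "dist (Q \<sigma> x) (x + t *\<^sub>R v) = \<bar>t - T \<sigma> x\<bar>"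
          using v by (simp add: QT dist_norm abs_minus_commute flip: scaleR_left.diff)
        then have "t \<in> U \<longleftrightarrow> s \<sigma> * (m \<sigma> \<bullet> (x + t *\<^sub>R v) - b \<sigma>) < 0"
          using \<rho>(2) t by (simp add: U_def)
        also have "m \<sigma> \<bullet> (x + t *\<^sub>R v) - b \<sigma> = (t - T \<sigma> x) * (m \<sigma> \<bullet> v)"
          using \<sigma>(2) by (simp add: T_def inner_add_right field_simps)
        also have "s \<sigma> * ((t - T \<sigma> x) * (m \<sigma> \<bullet> v)) < 0 \<longleftrightarrow> s \<sigma> * sgn (m \<sigma> \<bullet> v) * (t - T \<sigma> x) < 0"
          using \<sigma>(2) by (auto simp: sgn_if mult_less_0_iff zero_less_mult_iff)
        finally show ?thesis .
      qed
      then show ?thesis using \<rho>(1) by blast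
    qed
    have "(\<integral>t. indicator U t * p' (x + t *\<^sub>R v) \<partial>lborel)
        = (\<Sum>\<sigma>\<in>S. s \<sigma> * sgn (m \<sigma> \<bullet> v) * p (x + T \<sigma> x *\<^sub>R v))"
    proof (rule integral_deriv_open_real[OF bU oU _ inj frU _ loc p])
      show "finite S" using A(1) by (simp add: S_def)
      show "s \<sigma> * sgn (m \<sigma> \<bullet> v) = 1 \<or> s \<sigma> * sgn (m \<sigma> \<bullet> v) = - 1" if "\<sigma> \<in> S" for \<sigma>
        using that s[of \<sigma>] by (auto simp: S_def A_def sgn_if)
      show "continuous_on UNIV (\<lambda>t. p' (x + t *\<^sub>R v))"
        by (intro continuous_on_compose2[OF cont(2) tcont]) auto
    qed
    also have "\<dots> = (\<Sum>\<sigma>\<in>A. s \<sigma> * sgn (m \<sigma> \<bullet> v) * (indicator \<sigma> (Q \<sigma> x) * p (Q \<sigma> x)))"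
      unfolding S_def using A(1) by (auto simp: sum.inter_filter QT indicator_def intro!: sum.cong)
    finally show ?thesis by (simp add: U_def indicator_def)
  qed
  have pm [measurable]: "p \<in> borel_measurable borel" "p' \<in> borel_measurable borel"
    using cont by (auto intro: borel_measurable_continuous_onI)
  have [measurable]: "K \<in> sets borel" using K(1) by simp
  have intK: "integrable lborel (\<lambda>x. indicator K x * p' x)"
  proof -
    have "bounded (p' ` closure K)"
      using cont(2) K(2) by (intro compact_imp_bounded compact_continuous_image) (auto intro: continuous_on_subset simp: compact_closure)
    then obtain B where B: "\<And>x. x \<in> K \<Longrightarrow> \<bar>p' x\<bar> \<le> B"
      using closure_subset by (fastforce simp: bounded_iff)
    show ?thesis
      using B emeasure_bounded_finite[OF K(2)]
      by (intro integrableI_bounded_set[where A=K and B=B]) (auto simp: indicator_def)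
  qed
  have intA: "integrable lborel (\<lambda>x. slab_weight v 0 v x * (indicator \<sigma> (Q \<sigma> x) * p (Q \<sigma> x)))" if "\<sigma> \<in> A" for \<sigma>
    unfolding Q_def using that A(2) vv
    by (intro integrable_slab_oblique_projection \<sigma>b \<sigma>bd cont) auto
  \<comment> \<open>The lines are averaged over the slab orthogonal to \<open>v\<close>, which
    serves all faces at once; the passage to the slab of each face is made term by term at the
    end.\<close>
  have "(\<integral>x. indicator K x * p' x \<partial>lborel)
      = (\<integral>x. slab_weight v 0 v x * (\<integral>t. indicator K (x + t *\<^sub>R v) * p' (x + t *\<^sub>R v) \<partial>lborel) \<partial>lborel)"
    using lborel_integral_slab_lines[OF intK, of v v 0] vv by simp
  also have "\<dots> = (\<integral>x. (\<Sum>\<sigma>\<in>A. s \<sigma> * sgn (m \<sigma> \<bullet> v) *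
      (slab_weight v 0 v x * (indicator \<sigma> (Q \<sigma> x) * p (Q \<sigma> x)))) \<partial>lborel)"
  proof (rule integral_cong_AE)
    show "(\<lambda>x. \<Sum>\<sigma>\<in>A. s \<sigma> * sgn (m \<sigma> \<bullet> v) *
      (slab_weight v 0 v x * (indicator \<sigma> (Q \<sigma> x) * p (Q \<sigma> x)))) \<in> borel_measurable lborel"
      by (intro borel_measurable_sum borel_measurable_times[OF borel_measurable_const]
          borel_measurable_integrable intA)
    show "AE x in lborel. slab_weight v 0 v x * (\<integral>t. indicator K (x + t *\<^sub>R v) * p' (x + t *\<^sub>R v) \<partial>lborel)
      = (\<Sum>\<sigma>\<in>A. s \<sigma> * sgn (m \<sigma> \<bullet> v) * (slab_weight v 0 v x * (indicator \<sigma> (Q \<sigma> x) * p (Q \<sigma> x))))"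
      using ae by eventually_elim (simp add: line sum_distrib_left mult.left_commute)
  qed measurable
  also have "\<dots> = (\<Sum>\<sigma>\<in>A. s \<sigma> * sgn (m \<sigma> \<bullet> v) *
      (\<integral>x. slab_weight v 0 v x * (indicator \<sigma> (Q \<sigma> x) * p (Q \<sigma> x)) \<partial>lborel))"
    using intA by simp
  also have "\<dots> = (\<Sum>\<sigma>\<in>A. (outward_normal K \<sigma> \<bullet> v) * (\<integral>x. p x \<partial>face_measure \<sigma>))"
  proof (rule sum.cong[OF refl])
    fix \<sigma> assume \<sigma>: "\<sigma> \<in> A"
    then have \<sigma>F: "\<sigma> \<in> F" and nz: "m \<sigma> \<bullet> v \<noteq> 0" by (auto simp: A_def)
    have "(\<integral>x. slab_weight v 0 v x * (indicator \<sigma> (Q \<sigma> x) * p (Q \<sigma> x)) \<partial>lborel)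
        = \<bar>m \<sigma> \<bullet> v\<bar> * (\<integral>x. p x \<partial>face_measure \<sigma>)"
      unfolding Q_def using vv
      by (subst integral_oblique_projection[OF hyp(1)[OF \<sigma>F] \<sigma>b[OF \<sigma>F] \<sigma>bd[OF \<sigma>F] cont(1) nz])
        (auto simp: integral_face_measure[OF fun_cong[OF m_def] fun_cong[OF b_def] \<sigma>b[OF \<sigma>F] pm(1)])
    then show "s \<sigma> * sgn (m \<sigma> \<bullet> v) * (\<integral>x. slab_weight v 0 v x * (indicator \<sigma> (Q \<sigma> x) * p (Q \<sigma> x)) \<partial>lborel)
        = (outward_normal K \<sigma> \<bullet> v) * (\<integral>x. p x \<partial>face_measure \<sigma>)"
      using sgn_mult_abs[of "m \<sigma> \<bullet> v"] by (auto simp: normal[OF \<sigma>F] sgn_if)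
  qed
  also have "\<dots> = (\<Sum>\<sigma>\<in>F. (outward_normal K \<sigma> \<bullet> v) * (\<integral>x. p x \<partial>face_measure \<sigma>))"
    using F(1) A(2) by (intro sum.mono_neutral_left) (auto simp: A_def normal)
  finally show ?thesis .
qed


section \<open>Polynomials and orthogonal projections\<close>

lemma finite_multi_indices: "finite {\<alpha> :: 'n::finite \<Rightarrow> nat. sum \<alpha> UNIV \<le> q}"
proof (rule finite_subset)
  show "{\<alpha> :: 'n \<Rightarrow> nat. sum \<alpha> UNIV \<le> q} \<subseteq> PiE UNIV (\<lambda>_. {..q})"
  proof (intro subsetI PiE_I)
    fix \<alpha> :: "'n \<Rightarrow> nat" and i assume "\<alpha> \<in> {\<alpha>. sum \<alpha> UNIV \<le> q}"
    then show "\<alpha> i \<in> {..q}" using member_le_sum[of i UNIV \<alpha>] by simp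
  qed simp
qed (simp add: finite_PiE)

definition monomial :: "('n \<Rightarrow> nat) \<Rightarrow> real^'n \<Rightarrow> real" where
  "monomial \<alpha> x = (\<Prod>i\<in>UNIV. (x $ i) ^ \<alpha> i)"

text \<open>A linear span given by explicit generators, so that a projection can be built by
  induction on the generating set. The generators may be dependent modulo null sets, as monomials on
  a face in general are.\<close>

definition lincombs :: "'i set \<Rightarrow> ('i \<Rightarrow> 'a \<Rightarrow> real) \<Rightarrow> ('a \<Rightarrow> real) set" where
  "lincombs A e = {p. \<exists>c. p = (\<lambda>x. \<Sum>i\<in>A. c i * e i x)}"

lemma polys_eq_lincombs: "polys q = lincombs {\<alpha>. sum \<alpha> UNIV \<le> q} monomial"
  by (simp add: polys_def lincombs_def monomial_def)

lemma lincombs_lin: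
  assumes "p \<in> lincombs A e" "r \<in> lincombs A e"
  shows "(\<lambda>x. a * p x + b * r x) \<in> lincombs A e"
proof -
  obtain c d where "p = (\<lambda>x. \<Sum>i\<in>A. c i * e i x)" "r = (\<lambda>x. \<Sum>i\<in>A. d i * e i x)"
    using assms by (auto simp: lincombs_def)
  then show ?thesis
    unfolding lincombs_def
    by (intro CollectI exI[of _ "\<lambda>i. a * c i + b * d i"])
      (auto simp: sum_distrib_left sum.distrib algebra_simps)
qed

lemma polys_lin: "p \<in> polys q \<Longrightarrow> r \<in> polys q \<Longrightarrow> (\<lambda>x. a * p x + b * r x) \<in> polys q"
  unfolding polys_eq_lincombs by (rule lincombs_lin)

lemma polys_add: "p \<in> polys q \<Longrightarrow> r \<in> polys q \<Longrightarrow> (\<lambda>x. p x + r x) \<in> polys q"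
  using polys_lin[of p q r 1 1] by simp

lemma polys_diff: "p \<in> polys q \<Longrightarrow> r \<in> polys q \<Longrightarrow> (\<lambda>x. p x - r x) \<in> polys q"
  using polys_lin[of p q r 1 "-1"] by simp

lemma polys_const: "(\<lambda>x :: real^'n. a) \<in> polys q"
proof -
  have "(\<Sum>\<alpha> \<in> {\<alpha> :: 'n \<Rightarrow> nat. sum \<alpha> UNIV \<le> q}. (if \<alpha> = (\<lambda>_. 0) then a else 0) * monomial \<alpha> x) = a"
    for x :: "real^'n"
    by (subst sum.remove[OF finite_multi_indices, of "\<lambda>_. 0"]) (auto simp: monomial_def intro!: sum.neutral)
  then show ?thesis
    unfolding polys_eq_lincombs lincombs_def
    by (intro CollectI exI[of _ "\<lambda>\<alpha>. if \<alpha> = (\<lambda>_. 0) then a else 0"]) (simp add: fun_eq_iff)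
qed

text \<open>Continuity of the derivative is stated for each fixed direction, the form needed for
  partial derivatives; in finite dimension it amounts to continuity in operator norm.\<close>

definition C1_fun :: "('a::euclidean_space \<Rightarrow> real) \<Rightarrow> bool" where
  "C1_fun f \<longleftrightarrow> (\<exists>f'. (\<forall>x. (f has_derivative f' x) (at x)) \<and> (\<forall>v. continuous_on UNIV (\<lambda>x. f' x v)))"

lemma C1_fun_continuous: "C1_fun f \<Longrightarrow> continuous_on S f"
  unfolding C1_fun_def
  by (blast intro: continuous_at_imp_continuous_on has_derivative_continuous)

lemma C1_fun_const: "C1_fun (\<lambda>x. c)"
  unfolding C1_fun_def by (intro exI[of _ "\<lambda>x v. 0"]) (auto intro!: derivative_eq_intros)

lemma C1_fun_nth: "C1_fun (\<lambda>x::real^'n. x $ i)"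
  unfolding C1_fun_def
proof (intro exI[of _ "\<lambda>x v. v $ i"] conjI allI)
  show "((\<lambda>x::real^'n. x $ i) has_derivative (\<lambda>v. v $ i)) (at x)" for x
    by (rule bounded_linear_imp_has_derivative[OF bounded_linear_vec_nth])
qed (rule continuous_on_const)

lemma C1_fun_add:
  assumes "C1_fun f" "C1_fun g"
  shows "C1_fun (\<lambda>x. f x + g x)"
proof -
  obtain f' g' where "\<forall>x. (f has_derivative f' x) (at x)" "\<forall>v. continuous_on UNIV (\<lambda>x. f' x v)"
      "\<forall>x. (g has_derivative g' x) (at x)" "\<forall>v. continuous_on UNIV (\<lambda>x. g' x v)"
    using assms by (auto simp: C1_fun_def)
  then show ?thesis
    unfolding C1_fun_def
    by (intro exI[of _ "\<lambda>x v. f' x v + g' x v"]) (auto intro!: derivative_intros continuous_intros)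
qed

lemma C1_fun_mult:
  assumes "C1_fun f" "C1_fun g"
  shows "C1_fun (\<lambda>x. f x * g x)"
proof -
  obtain f' g' where "\<forall>x. (f has_derivative f' x) (at x)" "\<forall>v. continuous_on UNIV (\<lambda>x. f' x v)"
      "\<forall>x. (g has_derivative g' x) (at x)" "\<forall>v. continuous_on UNIV (\<lambda>x. g' x v)"
    using assms by (auto simp: C1_fun_def)
  moreover note C1_fun_continuous[OF assms(1)] C1_fun_continuous[OF assms(2)]
  ultimately show ?thesis
    unfolding C1_fun_def
    by (intro exI[of _ "\<lambda>x v. f x * g' x v + f' x v * g x"])
      (auto intro!: has_derivative_mult continuous_intros)
qed

lemma C1_fun_sum: "(\<And>i. i \<in> A \<Longrightarrow> C1_fun (f i)) \<Longrightarrow> C1_fun (\<lambda>x. \<Sum>i\<in>A. f i x)"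
  by (induction A rule: infinite_finite_induct) (auto intro: C1_fun_const C1_fun_add)

lemma C1_fun_prod: "(\<And>i. i \<in> A \<Longrightarrow> C1_fun (f i)) \<Longrightarrow> C1_fun (\<lambda>x. \<Prod>i\<in>A. f i x)"
  by (induction A rule: infinite_finite_induct) (auto intro: C1_fun_const C1_fun_mult)

lemma C1_fun_power: "C1_fun f \<Longrightarrow> C1_fun (\<lambda>x. f x ^ n)"
  by (induction n) (auto intro: C1_fun_const C1_fun_mult)

lemma C1_fun_polys: "p \<in> polys q \<Longrightarrow> C1_fun p"
  unfolding polys_def
  by (auto intro!: C1_fun_sum C1_fun_mult C1_fun_const C1_fun_prod C1_fun_power C1_fun_nth)

lemmas continuous_polys = C1_fun_continuous[OF C1_fun_polys]

lemma C1_fun_partial_deriv: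
  fixes p :: "real^'n \<Rightarrow> real"
  assumes "C1_fun p"
  shows "((\<lambda>t. p (x + t *\<^sub>R axis i 1)) has_real_derivative partial_deriv i p (x + t *\<^sub>R axis i 1)) (at t)"
    and "continuous_on S (partial_deriv i p)"
proof -
  obtain p' where p': "\<And>x. (p has_derivative p' x) (at x)" "\<And>v. continuous_on UNIV (\<lambda>x. p' x v)"
    using assms by (auto simp: C1_fun_def)
  have eq: "partial_deriv i p x = p' x (axis i 1)" for x
    by (simp add: partial_deriv_def frechet_derivative_at[OF p'(1), symmetric])
  show "continuous_on S (partial_deriv i p)"
    using p'(2)[of "axis i 1"] eq by (metis (no_types, lifting) continuous_on_cong continuous_on_subset subset_UNIV)
  have "((\<lambda>t. x + t *\<^sub>R axis i 1) has_derivative (\<lambda>t. t *\<^sub>R axis i (1::real))) (at t)"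
    by (auto intro!: derivative_eq_intros)
  from has_derivative_compose[OF this p'(1)]
  have "((\<lambda>t. p (x + t *\<^sub>R axis i 1)) has_derivative (\<lambda>s. p' (x + t *\<^sub>R axis i 1) (s *\<^sub>R axis i 1))) (at t)" .
  moreover have "p' y (s *\<^sub>R axis i 1) = partial_deriv i p y * s" for y s
    using has_derivative_linear[OF p'(1), of y] by (simp add: eq linear_cmul)
  ultimately show "((\<lambda>t. p (x + t *\<^sub>R axis i 1)) has_real_derivative partial_deriv i p (x + t *\<^sub>R axis i 1)) (at t)"
    by (simp add: has_field_derivative_def)
qed

text \<open>
  The projection of \<open>f\<close> is taken onto the polynomials \<open>r\<close> with \<open>f * r\<close> integrable; the remaining
  orthogonality relations hold because the integral of a non-integrable function is zero.  Hence no
  regularity of \<open>f\<close> is needed.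
\<close>

lemma l2_orthogonal_projection:
  fixes e :: "'i \<Rightarrow> 'a \<Rightarrow> real"
  assumes "finite A"
    and int: "\<And>p r. p \<in> lincombs A e \<Longrightarrow> r \<in> lincombs A e \<Longrightarrow> integrable \<mu> (\<lambda>x. p x * r x)"
    and W: "W \<subseteq> lincombs A e" "(\<lambda>x. 0) \<in> W"
      "\<And>p r a b. p \<in> W \<Longrightarrow> r \<in> W \<Longrightarrow> (\<lambda>x. a * p x + b * r x) \<in> W"
    and f: "\<And>r. r \<in> W \<Longrightarrow> integrable \<mu> (\<lambda>x. f x * r x)"
  shows "\<exists>p\<in>W. \<forall>r\<in>W. (\<integral>x. (f x - p x) * r x \<partial>\<mu>) = 0"
  using assms
proof (induction A arbitrary: W f rule: finite_induct)
  case empty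
  then have "W = {\<lambda>x. 0}" by (auto simp: lincombs_def)
  then show ?case by simp
next
  case (insert a A)
  have sub: "lincombs A e \<subseteq> lincombs (insert a A) e"
  proof
    fix p assume "p \<in> lincombs A e"
    then obtain c where c: "p = (\<lambda>x. \<Sum>i\<in>A. c i * e i x)" by (auto simp: lincombs_def)
    have "(\<Sum>i\<in>insert a A. (if i = a then 0 else c i) * e i x) = (\<Sum>i\<in>A. c i * e i x)" for x
      using insert.hyps by (auto intro!: sum.cong)
    then show "p \<in> lincombs (insert a A) e"
      unfolding lincombs_def c by (intro CollectI exI[of _ "\<lambda>i. if i = a then 0 else c i"]) simp
  qed
  \<comment> \<open>The members of \<open>W\<close> that do without the new generator: the induction
    hypothesis applies to them, and they have codimension at most one in \<open>W\<close>.\<close>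
  define W0 where "W0 = W \<inter> lincombs A e"
  have zero: "(\<lambda>x. 0) \<in> lincombs A e" by (auto simp: lincombs_def intro!: exI[of _ "\<lambda>_. 0"])
  have W0: "W0 \<subseteq> lincombs A e" "(\<lambda>x. 0) \<in> W0"
    "\<And>p r a b. p \<in> W0 \<Longrightarrow> r \<in> W0 \<Longrightarrow> (\<lambda>x. a * p x + b * r x) \<in> W0" "W0 \<subseteq> W"
    using insert.prems(3,4) zero by (auto simp: W0_def lincombs_lin)
  have intA: "integrable \<mu> (\<lambda>x. p x * r x)" if "p \<in> W" "r \<in> W" for p r
    using insert.prems(1,2) that by blast
  note IH = insert.IH[OF _ W0(1,2,3)]
  obtain p0 where p0: "p0 \<in> W0" "\<And>r. r \<in> W0 \<Longrightarrow> (\<integral>x. (f x - p0 x) * r x \<partial>\<mu>) = 0"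
    using IH[of f] insert.prems(1,5) sub W0(4) by (metis subsetD)
  show ?case
  proof (cases "W \<subseteq> lincombs A e")
    case True
    then have "W0 = W" by (auto simp: W0_def)
    then show ?thesis using p0 by blast
  next
    case False
    then obtain r0 where r0: "r0 \<in> W" "r0 \<notin> lincombs A e" by blast
    then obtain c0 where c0: "r0 = (\<lambda>x. \<Sum>i\<in>insert a A. c0 i * e i x)"
      using insert.prems(2) by (auto simp: lincombs_def)
    have c0a: "c0 a \<noteq> 0"
    proof
      assume "c0 a = 0"
      then have "r0 = (\<lambda>x. \<Sum>i\<in>A. c0 i * e i x)" using insert.hyps by (simp add: c0)
      then show False using r0(2) by (auto simp: lincombs_def)
    qed
    \<comment> \<open>The induction hypothesis is general in \<open>f\<close>, so it also projects
      \<open>r0\<close>; the remainder \<open>d\<close> is the Gram-Schmidt direction that completes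
      \<open>W0\<close> to \<open>W\<close>.\<close>
    obtain q where q: "q \<in> W0" "\<And>r. r \<in> W0 \<Longrightarrow> (\<integral>x. (r0 x - q x) * r x \<partial>\<mu>) = 0"
      using IH[of r0] insert.prems(1) intA[OF r0(1)] sub W0(4) by (metis subsetD)
    define d where "d = (\<lambda>x. r0 x - q x)"
    have dW: "d \<in> W"
      using insert.prems(4)[of r0 q 1 "-1"] r0(1) q(1) W0(4) by (auto simp: d_def)
    have split: "\<exists>w\<in>W0. \<exists>t. r = (\<lambda>x. w x + t * d x)" if r: "r \<in> W" for r
    proof -
      obtain c where c: "r = (\<lambda>x. \<Sum>i\<in>insert a A. c i * e i x)"
        using r insert.prems(2) by (auto simp: lincombs_def)
      \<comment> \<open>Chosen to cancel the coefficient of the generator \<open>a\<close>.\<close>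
      define t where "t = c a / c0 a"
      define w1 where "w1 = (\<lambda>x. 1 * r x + (- t) * r0 x)"
      have "w1 \<in> W" unfolding w1_def by (rule insert.prems(4)[OF r r0(1)])
      moreover have "w1 = (\<lambda>x. \<Sum>i\<in>A. (c i - t * c0 i) * e i x)"
        using insert.hyps c0a
        by (auto simp: w1_def c c0 t_def algebra_simps sum_distrib_left sum_subtractf sum_negf)
      ultimately have w1: "w1 \<in> W0" by (auto simp: W0_def lincombs_def)
      have "(\<lambda>x. 1 * w1 x + t * q x) \<in> W0" by (rule W0(3)[OF w1 q(1)])
      moreover have "r = (\<lambda>x. (1 * w1 x + t * q x) + t * d x)"
        by (auto simp: w1_def d_def algebra_simps)
      ultimately show ?thesis
        by (intro bexI[where x="\<lambda>x. 1 * w1 x + t * q x"] exI[of _ t])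
    qed
    have intf: "integrable \<mu> (\<lambda>x. (f x - p x) * r x)" if "p \<in> W" "r \<in> W" for p r
      using insert.prems(5)[OF that(2)] intA[OF that] by (simp add: left_diff_distrib)
    have p0W: "p0 \<in> W" using p0(1) W0(4) by blast
    define N where "N = (\<integral>x. d x * d x \<partial>\<mu>)"
    have d_orth: "(\<integral>x. d x * r x \<partial>\<mu>) = 0" if "r \<in> W0" for r
      using q(2)[OF that] by (simp add: d_def)
    show ?thesis
    proof (cases "N = 0")
      \<comment> \<open>The pairing under \<open>\<mu>\<close> is only semidefinite. A direction of
        norm zero vanishes almost everywhere, so \<open>p0\<close> needs no correction.\<close>
      case True
      then have "AE x in \<mu>. d x * d x = 0"
        using integral_nonneg_eq_0_iff_AE[OF intA[OF dW dW]] by (simp add: N_def)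
      then have "(\<integral>x. (f x - p0 x) * d x \<partial>\<mu>) = 0"
        by (intro integral_eq_zero_AE) (auto elim: eventually_mono)
      then have "(\<integral>x. (f x - p0 x) * (w x + t * d x) \<partial>\<mu>) = 0" if "w \<in> W0" for w t
      proof -
        have "(\<integral>x. (f x - p0 x) * (w x + t * d x) \<partial>\<mu>)
            = (\<integral>x. (f x - p0 x) * w x + t * ((f x - p0 x) * d x) \<partial>\<mu>)"
          by (simp add: algebra_simps)
        also have "\<dots> = 0"
          using intf[OF p0W, of w] intf[OF p0W dW] that W0(4) p0(2)[OF that]
            \<open>(\<integral>x. (f x - p0 x) * d x \<partial>\<mu>) = 0\<close> by (subst Bochner_Integration.integral_add) auto
        finally show ?thesis .
      qed
      then show ?thesis using split p0W by metis
    next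
      case False
      define s where "s = (\<integral>x. (f x - p0 x) * d x \<partial>\<mu>) / N"
      define p where "p = (\<lambda>x. 1 * p0 x + s * d x)"
      have pW: "p \<in> W" unfolding p_def by (rule insert.prems(4)[OF p0W dW])
      have "(\<integral>x. (f x - p x) * r x \<partial>\<mu>) = (\<integral>x. (f x - p0 x) * r x \<partial>\<mu>) - s * (\<integral>x. d x * r x \<partial>\<mu>)"
        if "r \<in> W" for r
      proof -
        have "(\<integral>x. (f x - p x) * r x \<partial>\<mu>) = (\<integral>x. (f x - p0 x) * r x - s * (d x * r x) \<partial>\<mu>)"
          by (simp add: p_def algebra_simps)
        then show ?thesis
          using intf[OF p0W that] intA[OF dW that] by simp
      qed
      then have pd: "(\<integral>x. (f x - p x) * d x \<partial>\<mu>) = 0" and pw: "\<And>w. w \<in> W0 \<Longrightarrow> (\<integral>x. (f x - p x) * w x \<partial>\<mu>) = 0"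
        using False dW W0(4) p0(2) d_orth by (auto simp: s_def N_def subset_iff)
      have "(\<integral>x. (f x - p x) * (w x + t * d x) \<partial>\<mu>) = 0" if "w \<in> W0" for w t
      proof -
        have "(\<integral>x. (f x - p x) * (w x + t * d x) \<partial>\<mu>)
            = (\<integral>x. (f x - p x) * w x + t * ((f x - p x) * d x) \<partial>\<mu>)"
          by (simp add: algebra_simps)
        also have "\<dots> = 0"
          using intf[OF pW, of w] intf[OF pW dW] that W0(4) pw[OF that] pd
          by (subst Bochner_Integration.integral_add) auto
        finally show ?thesis .
      qed
      then show ?thesis using split pW by metis
    qed
  qed
qed

lemma l2_proj_properties:
  fixes \<mu> :: "(real^'n) measure"
  assumes cont: "\<And>g. continuous_on UNIV g \<Longrightarrow> integrable \<mu> (g :: real^'n \<Rightarrow> real)"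
  shows l2_proj_polys: "l2_proj \<mu> q f \<in> polys q"
    and l2_proj_orthogonal: "r \<in> polys q \<Longrightarrow> (\<integral>x. (f x - l2_proj \<mu> q f x) * r x \<partial>\<mu>) = 0"
proof -
  have int: "integrable \<mu> (\<lambda>x. p x * r x)" if "p \<in> polys q" "r \<in> polys q" for p r
    using that by (intro cont continuous_intros continuous_polys)
  define W where "W = {r \<in> polys q. integrable \<mu> (\<lambda>x. f x * r x)}"
  have Wlin: "(\<lambda>x. a * p x + b * r x) \<in> W" if "p \<in> W" "r \<in> W" for p r a b
  proof -
    have "integrable \<mu> (\<lambda>x. a * (f x * p x) + b * (f x * r x))"
      using that by (auto simp: W_def)
    then show ?thesis using that polys_lin by (auto simp: W_def algebra_simps)
  qed
  have "\<exists>p\<in>W. \<forall>r\<in>W. (\<integral>x. (f x - p x) * r x \<partial>\<mu>) = 0"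
  proof (rule l2_orthogonal_projection[OF finite_multi_indices])
    show "W \<subseteq> lincombs {\<alpha>. sum \<alpha> UNIV \<le> q} monomial"
      unfolding W_def polys_eq_lincombs by blast
    show "(\<lambda>x. 0) \<in> W" using polys_const[of 0 q] by (simp add: W_def)
  qed (use int Wlin in \<open>auto simp: W_def polys_eq_lincombs\<close>)
  then obtain p where p: "p \<in> W" "\<And>r. r \<in> W \<Longrightarrow> (\<integral>x. (f x - p x) * r x \<partial>\<mu>) = 0" by blast
  \<comment> \<open>For \<open>r\<close> outside \<open>W\<close> the product of \<open>f\<close>
    and \<open>r\<close> is not integrable while that of \<open>p\<close> and \<open>r\<close> is,
    so the integral of the difference takes its default value zero.\<close>
  have "(\<integral>x. (f x - p x) * r x \<partial>\<mu>) = 0" if r: "r \<in> polys q" for r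
  proof (cases "r \<in> W")
    case False
    have "\<not> integrable \<mu> (\<lambda>x. (f x - p x) * r x)"
    proof
      assume "integrable \<mu> (\<lambda>x. (f x - p x) * r x)"
      moreover have "integrable \<mu> (\<lambda>x. p x * r x)" using p(1) r int by (simp add: W_def)
      ultimately have "integrable \<mu> (\<lambda>x. (f x - p x) * r x + p x * r x)" by simp
      then show False using False r by (simp add: W_def algebra_simps)
    qed
    then show ?thesis by (rule not_integrable_integral_eq)
  qed (rule p(2))
  then have "\<exists>p. p \<in> polys q \<and> (\<forall>r\<in>polys q. (\<integral>x. (f x - p x) * r x \<partial>\<mu>) = 0)"
    using p(1) by (auto simp: W_def)
  from someI_ex[OF this] show "l2_proj \<mu> q f \<in> polys q"
    "r \<in> polys q \<Longrightarrow> (\<integral>x. (f x - l2_proj \<mu> q f x) * r x \<partial>\<mu>) = 0"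
    unfolding l2_proj_def by blast+
qed

text \<open>The difference of two candidates is itself an admissible test polynomial, hence
  orthogonal to itself. For a face this says nothing off the face, where the representing
  polynomials may differ.\<close>

lemma l2_proj_unique:
  fixes \<mu> :: "(real^'n) measure"
  assumes cont: "\<And>g. continuous_on UNIV g \<Longrightarrow> integrable \<mu> (g :: real^'n \<Rightarrow> real)"
    and f: "continuous_on UNIV f" and p: "p \<in> polys q"
    and orth: "\<And>r. r \<in> polys q \<Longrightarrow> (\<integral>x. (f x - p x) * r x \<partial>\<mu>) = 0"
  shows "AE x in \<mu>. l2_proj \<mu> q f x = p x"
proof -
  let ?P = "l2_proj \<mu> q f"
  define d where "d = (\<lambda>x. ?P x - p x)"
  have P: "?P \<in> polys q" by (rule l2_proj_polys[OF cont])
  have d: "d \<in> polys q" unfolding d_def by (rule polys_diff[OF P p])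
  note c = continuous_polys[OF P] continuous_polys[OF p] continuous_polys[OF d] f
  have "(\<integral>x. d x * d x \<partial>\<mu>) = (\<integral>x. (f x - p x) * d x - (f x - ?P x) * d x \<partial>\<mu>)"
    by (simp add: d_def algebra_simps)
  also have "\<dots> = (\<integral>x. (f x - p x) * d x \<partial>\<mu>) - (\<integral>x. (f x - ?P x) * d x \<partial>\<mu>)"
    by (intro Bochner_Integration.integral_diff cont continuous_intros c)
  also have "\<dots> = 0"
    using orth[OF d] l2_proj_orthogonal[OF cont d, of f] by simp
  finally have "(\<integral>x. d x * d x \<partial>\<mu>) = 0" .
  moreover have "integrable \<mu> (\<lambda>x. d x * d x)"
    by (intro cont continuous_intros c)
  ultimately have "AE x in \<mu>. d x * d x = 0"
    using integral_nonneg_eq_0_iff_AE[of \<mu> "\<lambda>x. d x * d x"] by simp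
  then show ?thesis by eventually_elim (simp add: d_def)
qed

lemma l2_proj_add_const:
  fixes \<mu> :: "(real^'n) measure"
  assumes cont: "\<And>g. continuous_on UNIV g \<Longrightarrow> integrable \<mu> (g :: real^'n \<Rightarrow> real)"
    and f: "continuous_on UNIV f"
  shows "AE x in \<mu>. l2_proj \<mu> q (\<lambda>x. f x + c) x = l2_proj \<mu> q f x + c"
proof (rule l2_proj_unique[OF cont])
  show "(\<lambda>x. l2_proj \<mu> q f x + c) \<in> polys q"
    by (intro polys_add l2_proj_polys cont polys_const)
  show "(\<integral>x. (f x + c - (l2_proj \<mu> q f x + c)) * r x \<partial>\<mu>) = 0" if "r \<in> polys q" for r
    using l2_proj_orthogonal[OF cont that, of f] by simp
qed (auto intro!: continuous_intros f)

text \<open>The slab of \<open>face_measure\<close> is traversed along its own unit normal, so the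
  slab weight is the plain indicator and the bounded support argument applies.\<close>

lemma integrable_face_measure:
  fixes \<sigma> :: "(real^'n) set" and f :: "real^'n \<Rightarrow> real"
  assumes m: "norm (unit_normal \<sigma>) = 1" and \<sigma> [measurable]: "\<sigma> \<in> sets borel" and bd: "bounded \<sigma>"
    and f: "continuous_on UNIV f"
  shows "integrable (face_measure \<sigma>) f"
proof -
  define m where "m = unit_normal \<sigma>"
  define b where "b = m \<bullet> (SOME x. x \<in> \<sigma>)"
  have mm: "m \<bullet> m = 1" using m by (simp add: m_def norm_eq_1)
  define P where "P = (\<lambda>x. x - (m \<bullet> x - b) *\<^sub>R m)"
  have [measurable]: "P \<in> borel_measurable borel"
    unfolding P_def by measurable
  have [measurable]: "f \<in> borel_measurable borel"
    using f by (rule borel_measurable_continuous_onI)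
  define A where "A = {x. b \<le> m \<bullet> x \<and> m \<bullet> x \<le> b + 1}"
  have [measurable]: "A \<in> sets borel" unfolding A_def by measurable
  have eq: "face_measure \<sigma> = restrict_space (distr (restrict_space lborel A) borel P) \<sigma>"
    by (simp add: face_measure_def Let_def m_def b_def A_def P_def)
  have "integrable lborel (\<lambda>x. slab_weight m b m x *
      (indicator \<sigma> (x - (m \<bullet> x - b) *\<^sub>R m) * f (x - (m \<bullet> x - b) *\<^sub>R m)))"
    using mm by (intro integrable_slab_oblique_projection \<sigma> bd f) auto
  also have "(\<lambda>x. slab_weight m b m x *
      (indicator \<sigma> (x - (m \<bullet> x - b) *\<^sub>R m) * f (x - (m \<bullet> x - b) *\<^sub>R m)))
      = (\<lambda>x. indicator A x * (indicator \<sigma> (P x) * f (P x)))"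
    by (auto simp: slab_weight_def mm A_def P_def indicator_def)
  finally have "integrable (restrict_space lborel A) (\<lambda>x. indicator \<sigma> (P x) * f (P x))"
    by (subst integrable_restrict_space) auto
  then have "integrable (distr (restrict_space lborel A) borel P) (\<lambda>x. indicator \<sigma> x * f x)"
    by (subst integrable_distr_eq) (auto intro!: measurable_restrict_space1)
  then show ?thesis
    unfolding eq using \<sigma> by (subst integrable_restrict_space) auto
qed

section \<open>Lebesgue integrals over bounded open sets\<close>

lemma integral_lebesgue_on_borel:
  fixes f :: "'a::euclidean_space \<Rightarrow> real"
  assumes "K \<in> sets borel" "f \<in> borel_measurable borel"
  shows "(\<integral>x. f x \<partial>lebesgue_on K) = (\<integral>x. indicator K x * f x \<partial>lborel)"
proof -
  have "(\<integral>x. f x \<partial>lebesgue_on K) = (\<integral>x. indicator K x * f x \<partial>lebesgue)"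
    using assms(1) by (subst integral_restrict_space) auto
  also have "\<dots> = (\<integral>x. indicator K x * f x \<partial>lborel)"
    using assms by (intro integral_completion) auto
  finally show ?thesis .
qed

lemma integrable_lebesgue_on_bounded:
  fixes f :: "'a::euclidean_space \<Rightarrow> real"
  assumes K: "open K" "bounded K" and f: "f \<in> borel_measurable borel" "\<And>x. x \<in> K \<Longrightarrow> \<bar>f x\<bar> \<le> B"
  shows "integrable (lebesgue_on K) f"
proof -
  have [measurable]: "K \<in> sets borel" "f \<in> borel_measurable borel" using K(1) f by auto
  have "integrable lborel (\<lambda>x. indicator K x * f x)"
    using f(2) emeasure_bounded_finite[OF K(2)]
    by (intro integrableI_bounded_set[where A=K and B=B]) (auto simp: indicator_def)
  then have "integrable lebesgue (\<lambda>x. indicator K x * f x)"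
    by (subst integrable_completion) auto
  then show ?thesis
    by (subst integrable_restrict_space) auto
qed

lemma continuous_bounded_on_bounded:
  fixes f :: "'a::euclidean_space \<Rightarrow> real"
  assumes "bounded K" "continuous_on UNIV f"
  obtains B where "\<And>x. x \<in> K \<Longrightarrow> \<bar>f x\<bar> \<le> B" "B \<ge> 0"
proof -
  have "bounded (f ` closure K)"
    using assms by (intro compact_imp_bounded compact_continuous_image)
      (auto intro: continuous_on_subset simp: compact_closure)
  then obtain B where "\<And>x. x \<in> K \<Longrightarrow> \<bar>f x\<bar> \<le> B"
    using closure_subset by (fastforce simp: bounded_iff)
  then have "\<And>x. x \<in> K \<Longrightarrow> \<bar>f x\<bar> \<le> \<bar>B\<bar>" by (meson abs_ge_self order_trans)
  then show ?thesis by (intro that[of "\<bar>B\<bar>"]) auto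
qed


section \<open>Discrete operators on a mesh\<close>

locale polytopal_mesh =
  fixes \<Omega> :: "(real^'n::finite) set" and D :: "'n discretisation"
  assumes domain: "open \<Omega>" "bounded \<Omega>" and mesh: "polytopal_discretisation \<Omega> D"
begin

lemma finite_cells: "finite (cells D)"
  using mesh by (simp add: polytopal_discretisation_def)

lemma disjoint_cells: "disjoint (cells D)"
  using mesh by (simp add: polytopal_discretisation_def)

lemma disjoint_faces: "disjoint (faces D)"
  using mesh by (simp add: polytopal_discretisation_def)

lemma cell_props:
  assumes "K \<in> cells D"
  shows "K \<subseteq> \<Omega>" "open K" "bounded K" "lipschitz_boundary_in UNIV K"
    "faces_of D K \<subseteq> faces D" "finite (faces_of D K)" "frontier K = (\<Union>\<sigma>\<in>faces_of D K. closure \<sigma>)"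
proof -
  show 1: "K \<subseteq> \<Omega>" "open K" "lipschitz_boundary_in UNIV K"
    "faces_of D K \<subseteq> faces D" "frontier K = (\<Union>\<sigma>\<in>faces_of D K. closure \<sigma>)"
    using mesh assms by (auto simp: polytopal_discretisation_def lipschitz_polytopal_in_def)
  show "bounded K" using 1(1) domain(2) bounded_subset by blast
  have "finite (faces D)" using mesh by (simp add: polytopal_discretisation_def)
  then show "finite (faces_of D K)" using 1(4) finite_subset by blast
qed

lemma face_props:
  assumes "\<sigma> \<in> faces D"
  shows "\<sigma> \<noteq> {}" "connected \<sigma>" "norm (unit_normal \<sigma>) = 1" "\<sigma> \<in> sets borel" "bounded \<sigma>"
    "\<exists>n b. n \<noteq> 0 \<and> \<sigma> \<subseteq> {x. n \<bullet> x = b} \<and> lipschitz_polytopal_in {x. n \<bullet> x = b} \<sigma>"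
proof -
  have "\<forall>\<sigma>\<in>faces D. \<sigma> \<subseteq> closure \<Omega> \<and> connected \<sigma> \<and>
        (\<exists>n b. n \<noteq> 0 \<and> \<sigma> \<subseteq> {x. n \<bullet> x = b} \<and> lipschitz_polytopal_in {x. n \<bullet> x = b} \<sigma>) \<and>
        emeasure (face_measure \<sigma>) \<sigma> > 0"
    using mesh unfolding polytopal_discretisation_def by (elim conjE)
  then have \<sigma>: "\<sigma> \<subseteq> closure \<Omega>" "connected \<sigma>"
    "\<exists>n b. n \<noteq> 0 \<and> \<sigma> \<subseteq> {x. n \<bullet> x = b} \<and> lipschitz_polytopal_in {x. n \<bullet> x = b} \<sigma>"
    "emeasure (face_measure \<sigma>) \<sigma> > 0"
    using assms by blast+
  show ne: "\<sigma> \<noteq> {}" using \<sigma>(4) by force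
  show "connected \<sigma>" by (rule \<sigma>(2))
  show "bounded \<sigma>" using \<sigma>(1) domain(2) bounded_closure bounded_subset by blast
  show "\<exists>n b. n \<noteq> 0 \<and> \<sigma> \<subseteq> {x. n \<bullet> x = b} \<and> lipschitz_polytopal_in {x. n \<bullet> x = b} \<sigma>" by (rule \<sigma>(3))
  obtain n b where n: "n \<noteq> 0" "openin (top_of_set {x. n \<bullet> x = b}) \<sigma>"
    using \<sigma>(3) by (auto simp: lipschitz_polytopal_in_def)
  show "norm (unit_normal \<sigma>) = 1" by (rule unit_normal_hyperplane(1)[OF n ne])
  obtain W where "open W" "\<sigma> = {x. n \<bullet> x = b} \<inter> W"
    using n(2) unfolding openin_open by blast
  then show "\<sigma> \<in> sets borel" by (metis borel_closed borel_open closed_hyperplane sets.Int)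
qed

lemma integrable_cell:
  fixes f :: "real^'n \<Rightarrow> real"
  assumes K: "K \<in> cells D" and f: "continuous_on UNIV f"
  shows "integrable (lebesgue_on K) f"
proof -
  obtain B where "\<And>x. x \<in> K \<Longrightarrow> \<bar>f x\<bar> \<le> B"
    using continuous_bounded_on_bounded[OF cell_props(3)[OF K] f] by blast
  then show ?thesis
    using f by (intro integrable_lebesgue_on_bounded[OF cell_props(2,3)[OF K]]) (auto intro: borel_measurable_continuous_onI)
qed

lemma integrable_face:
  fixes f :: "real^'n \<Rightarrow> real"
  assumes "\<sigma> \<in> faces D" "continuous_on UNIV f"
  shows "integrable (face_measure \<sigma>) f"
  using face_props[OF assms(1)] assms(2) by (intro integrable_face_measure)

lemma vec_polys_C1: "\<tau> \<in> vec_polys k \<Longrightarrow> C1_fun (\<lambda>x. \<tau> x $ i)"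
  unfolding vec_polys_def by (auto intro: C1_fun_polys)

lemma continuous_divergence: "\<tau> \<in> vec_polys k \<Longrightarrow> continuous_on UNIV (divergence \<tau>)"
  unfolding divergence_def[abs_def]
  by (intro continuous_intros C1_fun_partial_deriv vec_polys_C1)

lemma continuous_vec_polys: "\<tau> \<in> vec_polys k \<Longrightarrow> continuous_on UNIV \<tau>"
  using continuous_on_vec_lambda[of UNIV "\<lambda>i x. \<tau> x $ i"]
  by (simp add: C1_fun_continuous vec_polys_C1)

text \<open>The directional version is applied to the \<open>i\<close>-th component in the direction
  \<open>axis i 1\<close>, and the sum over \<open>i\<close> reassembles the inner product with the
  normal.\<close>

lemma divergence_theorem:
  assumes K: "K \<in> cells D" and \<tau>: "\<tau> \<in> vec_polys k"
  shows "(\<integral>x. divergence \<tau> x \<partial>lebesgue_on K)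
    = (\<Sum>\<sigma>\<in>faces_of D K. \<integral>x. \<tau> x \<bullet> outward_normal K \<sigma> \<partial>face_measure \<sigma>)"
proof -
  note Kp = cell_props[OF K]
  note C = vec_polys_C1[OF \<tau>]
  have comp: "(\<integral>x. partial_deriv i (\<lambda>y. \<tau> y $ i) x \<partial>lebesgue_on K)
      = (\<Sum>\<sigma>\<in>faces_of D K. (outward_normal K \<sigma> \<bullet> axis i 1) * (\<integral>x. \<tau> x $ i \<partial>face_measure \<sigma>))" for i
  proof -
    have "(\<integral>x. partial_deriv i (\<lambda>y. \<tau> y $ i) x \<partial>lebesgue_on K)
        = (\<integral>x. indicator K x * partial_deriv i (\<lambda>y. \<tau> y $ i) x \<partial>lborel)"
      using Kp(2) C1_fun_partial_deriv(2)[OF C, of UNIV i i]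
      by (intro integral_lebesgue_on_borel) (auto intro: borel_measurable_continuous_onI)
    also have "\<dots> = (\<Sum>\<sigma>\<in>faces_of D K. (outward_normal K \<sigma> \<bullet> axis i 1) * (\<integral>x. \<tau> x $ i \<partial>face_measure \<sigma>))"
    proof (rule divergence_theorem_flat_faces[OF Kp(2,3,4,6) _ Kp(7)])
      show "disjoint (faces_of D K)"
        using disjoint_faces Kp(5) unfolding disjoint_def by blast
      show "\<sigma> \<noteq> {} \<and> connected \<sigma> \<and> (\<exists>n b. n \<noteq> 0 \<and> lipschitz_polytopal_in {x. n \<bullet> x = b} \<sigma>)"
        if "\<sigma> \<in> faces_of D K" for \<sigma>
        using face_props[of \<sigma>] that Kp(5) by blast
      show "((\<lambda>t. \<tau> (x + t *\<^sub>R axis i 1) $ i) has_real_derivative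
          partial_deriv i (\<lambda>y. \<tau> y $ i) (x + t *\<^sub>R axis i 1)) (at t)" for x t
        by (rule C1_fun_partial_deriv(1)[OF C])
    qed (auto intro: C1_fun_continuous C1_fun_partial_deriv C)
    finally show ?thesis .
  qed
  have "(\<integral>x. divergence \<tau> x \<partial>lebesgue_on K)
      = (\<Sum>i\<in>UNIV. \<integral>x. partial_deriv i (\<lambda>y. \<tau> y $ i) x \<partial>lebesgue_on K)"
    unfolding divergence_def
    by (intro Bochner_Integration.integral_sum integrable_cell K C1_fun_partial_deriv C)
  also have "\<dots> = (\<Sum>\<sigma>\<in>faces_of D K. \<Sum>i\<in>UNIV. (outward_normal K \<sigma> \<bullet> axis i 1) * (\<integral>x. \<tau> x $ i \<partial>face_measure \<sigma>))"
    unfolding comp by (rule sum.swap)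
  also have "\<dots> = (\<Sum>\<sigma>\<in>faces_of D K. \<integral>x. \<tau> x \<bullet> outward_normal K \<sigma> \<partial>face_measure \<sigma>)"
  proof (rule sum.cong[OF refl])
    fix \<sigma> assume \<sigma>: "\<sigma> \<in> faces_of D K"
    have int: "integrable (face_measure \<sigma>) (\<lambda>x. \<tau> x $ i)" for i
      using \<sigma> Kp(5) by (intro integrable_face C1_fun_continuous C) auto
    show "(\<Sum>i\<in>UNIV. (outward_normal K \<sigma> \<bullet> axis i 1) * (\<integral>x. \<tau> x $ i \<partial>face_measure \<sigma>))
        = (\<integral>x. \<tau> x \<bullet> outward_normal K \<sigma> \<partial>face_measure \<sigma>)"
      using int by (simp add: inner_vec_def[where y="outward_normal K \<sigma>"] inner_axis mult.commute)
  qed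
  finally show ?thesis .
qed

text \<open>The constant adds \<open>- c\<close> times the integral of the divergence and
  \<open>c\<close> times the total flux, which cancel. The condition under \<open>SOME\<close> is
  then the same for both arguments, so the chosen functions coincide and not merely almost
  everywhere.\<close>

lemma discrete_grad_add_const:
  assumes K: "K \<in> cells D"
    and z: "continuous_on UNIV (cell z K)" "\<And>\<sigma>. \<sigma> \<in> faces_of D K \<Longrightarrow> continuous_on UNIV (face z \<sigma>)"
    and w: "\<And>x. cell w K x = cell z K x + c" "\<And>\<sigma> x. \<sigma> \<in> faces_of D K \<Longrightarrow> face w \<sigma> x = face z \<sigma> x + c"
  shows "discrete_grad D k w K = discrete_grad D k z K"
proof -
  note Kp = cell_props[OF K]
  have "- (\<integral>x. cell w K x * divergence \<tau> x \<partial>lebesgue_on K)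
      + (\<Sum>\<sigma>\<in>faces_of D K. \<integral>x. face w \<sigma> x * (\<tau> x \<bullet> outward_normal K \<sigma>) \<partial>face_measure \<sigma>)
    = - (\<integral>x. cell z K x * divergence \<tau> x \<partial>lebesgue_on K)
      + (\<Sum>\<sigma>\<in>faces_of D K. \<integral>x. face z \<sigma> x * (\<tau> x \<bullet> outward_normal K \<sigma>) \<partial>face_measure \<sigma>)"
    if \<tau>: "\<tau> \<in> vec_polys k" for \<tau>
  proof -
    note cont = continuous_divergence[OF \<tau>] continuous_vec_polys[OF \<tau>]
    have "(\<integral>x. cell w K x * divergence \<tau> x \<partial>lebesgue_on K)
        = (\<integral>x. cell z K x * divergence \<tau> x + c * divergence \<tau> x \<partial>lebesgue_on K)"
      by (simp add: w algebra_simps)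
    also have "\<dots> = (\<integral>x. cell z K x * divergence \<tau> x \<partial>lebesgue_on K) + (\<integral>x. c * divergence \<tau> x \<partial>lebesgue_on K)"
      by (intro Bochner_Integration.integral_add integrable_cell K continuous_intros z cont)
    finally have 1: "(\<integral>x. cell w K x * divergence \<tau> x \<partial>lebesgue_on K)
        = (\<integral>x. cell z K x * divergence \<tau> x \<partial>lebesgue_on K) + c * (\<integral>x. divergence \<tau> x \<partial>lebesgue_on K)"
      by simp
    have 2: "(\<integral>x. face w \<sigma> x * (\<tau> x \<bullet> outward_normal K \<sigma>) \<partial>face_measure \<sigma>)
        = (\<integral>x. face z \<sigma> x * (\<tau> x \<bullet> outward_normal K \<sigma>) \<partial>face_measure \<sigma>)
          + c * (\<integral>x. \<tau> x \<bullet> outward_normal K \<sigma> \<partial>face_measure \<sigma>)" if \<sigma>: "\<sigma> \<in> faces_of D K" for \<sigma>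
    proof -
      have "(\<integral>x. face w \<sigma> x * (\<tau> x \<bullet> outward_normal K \<sigma>) \<partial>face_measure \<sigma>)
          = (\<integral>x. face z \<sigma> x * (\<tau> x \<bullet> outward_normal K \<sigma>) + c * (\<tau> x \<bullet> outward_normal K \<sigma>) \<partial>face_measure \<sigma>)"
        by (simp add: w(2)[OF \<sigma>] algebra_simps)
      also have "\<dots> = (\<integral>x. face z \<sigma> x * (\<tau> x \<bullet> outward_normal K \<sigma>) \<partial>face_measure \<sigma>)
          + (\<integral>x. c * (\<tau> x \<bullet> outward_normal K \<sigma>) \<partial>face_measure \<sigma>)"
        using Kp(5) \<sigma>
        by (intro Bochner_Integration.integral_add integrable_face continuous_intros z(2) cont) auto
      finally show ?thesis by simp
    qed
    show ?thesis
      using divergence_theorem[OF K \<tau>]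
      by (simp add: 1 2 sum.distrib sum_distrib_left[symmetric])
  qed
  then show ?thesis
    unfolding discrete_grad_def by (metis (no_types, lifting))
qed

text \<open>By the divergence theorem the zero field satisfies the defining condition, so the chosen
  field does too; testing it with itself shows that its square integrates to zero.\<close>

lemma discrete_grad_one:
  assumes K: "K \<in> cells D"
  shows "AE x in lebesgue_on K. discrete_grad D k dofs_one K x = 0"
proof -
  let ?G = "discrete_grad D k dofs_one K"
  have "(\<lambda>x. 0) \<in> vec_polys k"
    by (simp add: vec_polys_def polys_const)
  moreover have "(\<integral>x. 0 \<bullet> \<tau> x \<partial>lebesgue_on K) =
      - (\<integral>x. cell dofs_one K x * divergence \<tau> x \<partial>lebesgue_on K)
      + (\<Sum>\<sigma>\<in>faces_of D K. \<integral>x. face dofs_one \<sigma> x * (\<tau> x \<bullet> outward_normal K \<sigma>) \<partial>face_measure \<sigma>)"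
    if "\<tau> \<in> vec_polys k" for \<tau>
    using divergence_theorem[OF K that] by (simp add: dofs_one_def)
  ultimately have G: "?G \<in> vec_polys k \<and> (\<forall>\<tau>\<in>vec_polys k. (\<integral>x. ?G x \<bullet> \<tau> x \<partial>lebesgue_on K) =
      - (\<integral>x. cell dofs_one K x * divergence \<tau> x \<partial>lebesgue_on K)
      + (\<Sum>\<sigma>\<in>faces_of D K. \<integral>x. face dofs_one \<sigma> x * (\<tau> x \<bullet> outward_normal K \<sigma>) \<partial>face_measure \<sigma>))"
    unfolding discrete_grad_def
    by (intro someI[where P="\<lambda>G. G \<in> vec_polys k \<and> (\<forall>\<tau>\<in>vec_polys k. (\<integral>x. G x \<bullet> \<tau> x \<partial>lebesgue_on K) = _ \<tau>)"] conjI ballI)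
  then have "(\<integral>x. ?G x \<bullet> ?G x \<partial>lebesgue_on K) = 0"
    using divergence_theorem[OF K, of ?G k] by (simp add: dofs_one_def)
  moreover have "integrable (lebesgue_on K) (\<lambda>x. ?G x \<bullet> ?G x)"
    using G by (intro integrable_cell K continuous_intros continuous_vec_polys[of _ k]) auto
  ultimately have "AE x in lebesgue_on K. ?G x \<bullet> ?G x = 0"
    using integral_nonneg_eq_0_iff_AE[of "lebesgue_on K" "\<lambda>x. ?G x \<bullet> ?G x"] by simp
  then show ?thesis by simp
qed

text \<open>Constants are polynomials of every degree, so the projection reproduces the added
  constant and the face value subtracts it again.\<close>

lemma jump_add_const:
  assumes \<sigma>: "\<sigma> \<in> faces D" and z: "continuous_on UNIV (cell z K)"
    and w: "\<And>x. cell w K x = cell z K x + c" "\<And>x. face w \<sigma> x = face z \<sigma> x + c"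
  shows "AE x in face_measure \<sigma>. jump k w K \<sigma> x = jump k z K \<sigma> x"
proof -
  have "cell w K = (\<lambda>x. cell z K x + c)" using w(1) by auto
  then show ?thesis
    using l2_proj_add_const[OF integrable_face[OF \<sigma>] z, of k c]
    by (auto simp: jump_def w(2) elim: eventually_mono)
qed

lemma jump_one:
  assumes \<sigma>: "\<sigma> \<in> faces D"
  shows "AE x in face_measure \<sigma>. jump k dofs_one K \<sigma> x = 0"
proof -
  have "AE x in face_measure \<sigma>. l2_proj (face_measure \<sigma>) k (\<lambda>x. 1) x = 1"
    by (rule l2_proj_unique[OF integrable_face[OF \<sigma>]]) (auto intro: polys_const)
  then show ?thesis by (auto simp: jump_def dofs_one_def elim: eventually_mono)
qed

lemma jump_continuous:
  assumes "\<sigma> \<in> faces D" "v \<in> V_space k D"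
  shows "continuous_on UNIV (jump k v K \<sigma>)"
proof -
  have "l2_proj (face_measure \<sigma>) k (cell v K) \<in> polys k"
    by (rule l2_proj_polys[OF integrable_face[OF assms(1)]])
  moreover have "face v \<sigma> \<in> polys k" using assms by (simp add: V_space_def)
  ultimately show ?thesis
    unfolding jump_def[abs_def] by (intro continuous_intros continuous_polys)
qed

lemma dofs_one_in_V_space: "dofs_one \<in> V_space k D"
  by (auto simp: V_space_def dofs_one_def polys_const)

lemma dofs_add_in_V_space: "v \<in> V_space k D \<Longrightarrow> w \<in> V_space k D \<Longrightarrow> dofs_add v w \<in> V_space k D"
  by (auto simp: V_space_def dofs_add_def polys_add)

lemma interp_potential_in_V_space: "interp_potential \<Omega> D k \<phi> \<in> V_space k D"
  by (auto simp: V_space_def interp_potential_def intro!: l2_proj_polys integrable_face integrable_cell)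

text \<open>Every integrand contains the gradient or the jump of the test element as a factor, and
  both vanish almost everywhere for \<open>dofs_one\<close>.\<close>

lemma T_form_one: "T_form D k \<Lambda> \<epsilon> l z dofs_one = 0"
proof -
  have G: "(\<integral>x. g x * ((\<Lambda> x *v discrete_grad D k z K x) \<bullet> discrete_grad D k dofs_one K x) \<partial>lebesgue_on K) = 0"
    if "K \<in> cells D" for K g
    using discrete_grad_one[OF that, of k] by (intro integral_eq_zero_AE) (auto elim: eventually_mono)
  have J: "(\<integral>x. g x * jump k z K \<sigma> x * jump k dofs_one K \<sigma> x \<partial>face_measure \<sigma>) = 0"
    if "K \<in> cells D" "\<sigma> \<in> faces_of D K" for K \<sigma> g
  proof (rule integral_eq_zero_AE)
    have "AE x in face_measure \<sigma>. jump k dofs_one K \<sigma> x = 0"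
      using jump_one that cell_props(5) by blast
    then show "AE x in face_measure \<sigma>. g x * jump k z K \<sigma> x * jump k dofs_one K \<sigma> x = 0"
      by eventually_elim simp
  qed
  have "a_loc D k \<Lambda> K z dofs_one = 0" if "K \<in> cells D" for K
    unfolding a_loc_def using G[OF that, of "\<lambda>_. 1"] J[OF that, of _ "\<lambda>_. 1"] by simp
  then show ?thesis
    unfolding T_form_def using G J by simp
qed

text \<open>Gradients can be replaced inside the terms, but jumps agree only almost everywhere, so
  their integrals are compared by \<open>integral_cong_AE\<close>; membership in
  \<open>V_space\<close> supplies the measurability through continuity.\<close>

lemma T_form_add_const:
  assumes l: "l \<in> V_space k D" and z: "z \<in> V_space k D" and w: "w \<in> V_space k D" and v: "v \<in> V_space k D"
    and zw: "\<And>K x. cell w K x = cell z K x + c" "\<And>\<sigma> x. face w \<sigma> x = face z \<sigma> x + c"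
  shows "T_form D k \<Lambda> \<epsilon> l z v = T_form D k \<Lambda> \<epsilon> l w v"
proof -
  have G: "discrete_grad D k w K = discrete_grad D k z K" if K: "K \<in> cells D" for K
  proof (rule discrete_grad_add_const[OF K _ _ zw])
    show "continuous_on UNIV (cell z K)" "\<And>\<sigma>. \<sigma> \<in> faces_of D K \<Longrightarrow> continuous_on UNIV (face z \<sigma>)"
      using z K cell_props(5)[OF K] by (auto simp: V_space_def intro: continuous_polys)
  qed
  have J: "(\<integral>x. g x * jump k z K \<sigma> x * jump k v K \<sigma> x \<partial>face_measure \<sigma>)
      = (\<integral>x. g x * jump k w K \<sigma> x * jump k v K \<sigma> x \<partial>face_measure \<sigma>)"
    if K: "K \<in> cells D" and \<sigma>: "\<sigma> \<in> faces_of D K" and g: "continuous_on UNIV g" for K \<sigma> g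
  proof (rule integral_cong_AE)
    have \<sigma>D: "\<sigma> \<in> faces D" using \<sigma> cell_props(5)[OF K] by auto
    note cont = jump_continuous[OF \<sigma>D z] jump_continuous[OF \<sigma>D w] jump_continuous[OF \<sigma>D v] g
    show "(\<lambda>x. g x * jump k z K \<sigma> x * jump k v K \<sigma> x) \<in> borel_measurable (face_measure \<sigma>)"
      "(\<lambda>x. g x * jump k w K \<sigma> x * jump k v K \<sigma> x) \<in> borel_measurable (face_measure \<sigma>)"
      by (intro borel_measurable_integrable integrable_face \<sigma>D continuous_intros cont)+
    have "continuous_on UNIV (cell z K)"
      using z K by (auto simp: V_space_def intro: continuous_polys)
    from jump_add_const[OF \<sigma>D this zw, of k]
    show "AE x in face_measure \<sigma>. g x * jump k z K \<sigma> x * jump k v K \<sigma> x = g x * jump k w K \<sigma> x * jump k v K \<sigma> x"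
      by eventually_elim simp
  qed
  have E: "continuous_on UNIV (\<lambda>x. (exp (l2_proj (face_measure \<sigma>) k (cell l K) x) + exp (face l \<sigma> x)) / 2)"
    if K: "K \<in> cells D" and \<sigma>: "\<sigma> \<in> faces_of D K" for K \<sigma>
  proof -
    have "\<sigma> \<in> faces D" using \<sigma> cell_props(5)[OF K] by auto
    then have "l2_proj (face_measure \<sigma>) k (cell l K) \<in> polys k" "face l \<sigma> \<in> polys k"
      using l by (auto simp: V_space_def intro!: l2_proj_polys integrable_face)
    then show ?thesis by (intro continuous_intros continuous_polys) auto
  qed
  have a: "a_loc D k \<Lambda> K z v = a_loc D k \<Lambda> K w v" if "K \<in> cells D" for K
    unfolding a_loc_def using G[OF that] J[OF that, of _ "\<lambda>_. 1"] by simp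
  then show ?thesis
    unfolding T_form_def by (simp only: G J[OF _ _ E] a cong: sum.cong)
qed

end

text \<open>\<open>real_of_ereal\<close> sends both infinite values to zero, which covers
  non-measurable functions and null measures. A finite negative essential supremum would bound an
  absolute value by a negative number almost everywhere, hence also by minus infinity.\<close>

lemma Linf_norm_nonneg: "0 \<le> Linf_norm M f"
proof (rule ccontr)
  assume "\<not> 0 \<le> Linf_norm M f"
  then obtain r where r: "esssup M (\<lambda>x. ereal \<bar>f x\<bar>) = ereal r" "r < 0"
    unfolding Linf_norm_def by (cases "esssup M (\<lambda>x. ereal \<bar>f x\<bar>)") auto
  have m: "(\<lambda>x. ereal \<bar>f x\<bar>) \<in> borel_measurable M"
    using r(1) by (auto simp: esssup_def top_ereal_def split: if_splits)
  have "AE x in M. ereal \<bar>f x\<bar> \<le> ereal r"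
    using esssup_AE[of "\<lambda>x. ereal \<bar>f x\<bar>" M] r(1) by simp
  then have "AE x in M. ereal \<bar>f x\<bar> \<le> -\<infinity>"
    by eventually_elim (use r(2) in auto)
  then have "esssup M (\<lambda>x. ereal \<bar>f x\<bar>) \<le> -\<infinity>"
    unfolding esssup_eq_AE[OF m] by (intro Inf_lower) simp
  then show False using r(1) by simp
qed

context polytopal_mesh
begin

lemma T_form_nonneg:
  assumes \<Lambda>: "lam > 0" "AE x in lebesgue_on \<Omega>. \<forall>\<xi>. (\<Lambda> x *v \<xi>) \<bullet> \<xi> \<ge> lam * (norm \<xi>)\<^sup>2" and eps: "\<epsilon> \<ge> 0"
  shows "T_form D k \<Lambda> \<epsilon> l w w \<ge> 0"
proof -
  \<comment> \<open>Ellipticity has the vector quantified inside the almost-everywhere statement, so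
    it may be used with a vector field such as the discrete gradient.\<close>
  have ae: "AE x in lebesgue_on K. (\<Lambda> x *v \<xi> x) \<bullet> \<xi> x \<ge> 0" if K: "K \<in> cells D" for K \<xi>
  proof -
    have "AE x in lebesgue. x \<in> \<Omega> \<longrightarrow> (\<forall>\<xi>. (\<Lambda> x *v \<xi>) \<bullet> \<xi> \<ge> lam * (norm \<xi>)\<^sup>2)"
      using \<Lambda>(2) domain(1) by (subst (asm) AE_restrict_space_iff) auto
    then have "AE x in lebesgue. x \<in> K \<longrightarrow> (\<Lambda> x *v \<xi> x) \<bullet> \<xi> x \<ge> 0"
    proof eventually_elim
      case (elim x)
      then show ?case
        using cell_props(1)[OF K] \<Lambda>(1) by (meson order_trans subsetD mult_nonneg_nonneg less_imp_le zero_le_power2)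
    qed
    then show ?thesis
      using cell_props(2)[OF K] by (subst AE_restrict_space_iff) auto
  qed
  have G: "(\<integral>x. g x * ((\<Lambda> x *v discrete_grad D k w K x) \<bullet> discrete_grad D k w K x) \<partial>lebesgue_on K) \<ge> 0"
    if "K \<in> cells D" "\<And>x. g x \<ge> 0" for K g
    using ae[OF that(1), of "discrete_grad D k w K"] that(2)
    by (intro integral_nonneg_AE) (auto elim!: eventually_mono)
  have J: "(\<integral>x. g x * jump k w K \<sigma> x * jump k w K \<sigma> x \<partial>face_measure \<sigma>) \<ge> 0" if "\<And>x. g x \<ge> 0" for K \<sigma> g
    using that by (intro Bochner_Integration.integral_nonneg) (simp add: mult.assoc)
  have F: "face_diffusion \<Lambda> K \<sigma> / diameter \<sigma> \<ge> 0" if "K \<in> cells D" "\<sigma> \<in> faces_of D K" for K \<sigma>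
  proof -
    have "bounded \<sigma>" using that cell_props(5) face_props(5) by blast
    then show ?thesis
      by (simp add: face_diffusion_def Let_def Linf_norm_nonneg diameter_ge_0)
  qed
  have a: "a_loc D k \<Lambda> K w w \<ge> 0" if "K \<in> cells D" for K
    unfolding a_loc_def using G[OF that, of "\<lambda>_. 1"] J[of "\<lambda>_. 1"]
    by (intro add_nonneg_nonneg sum_nonneg mult_nonneg_nonneg F[OF that]) auto
  show ?thesis
    unfolding T_form_def
    by (intro sum_nonneg add_nonneg_nonneg mult_nonneg_nonneg J F G a eps zero_le_power
        diameter_ge_0 cell_props(3) divide_nonneg_nonneg) auto
qed

end


section \<open>Entropy and dissipation\<close>

lemma Phi1_nonneg:
  assumes "s \<ge> 0"
  shows "Phi1 s \<ge> 0"
proof (cases "s = 0")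
  case False
  then have s: "s > 0" using assms by simp
  have "ln (1 / s) \<le> 1 / s - 1" using s by (intro ln_le_minus_one) simp
  then have "s * (- ln s) \<le> s * (1 / s - 1)"
    using s by (intro mult_left_mono) (auto simp: ln_div)
  then show ?thesis using s by (simp add: Phi1_def right_diff_distrib)
qed (simp add: Phi1_def)

text \<open>Holds at \<open>a = 0\<close> too: there both sides are \<open>s\<close>, as
  \<open>Phi1 0 = 1\<close> and the logarithm is multiplied by zero.\<close>

lemma scaled_Phi1_eq:
  assumes "a \<ge> 0" "s > 0"
  shows "s * Phi1 (a / s) = a * ln a - a * ln s - a + s"
  using assms by (auto simp: Phi1_def ln_div algebra_simps)

text \<open>Tangent inequality at \<open>b\<close> for the convex function that sends
  \<open>a\<close> to \<open>s * Phi1 (a / s)\<close>, whose slope there is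
  \<open>ln b - ln s\<close>. Allowing \<open>a = 0\<close> admits an initial density that vanishes
  on some set.\<close>

lemma scaled_Phi1_diff_le:
  assumes "a \<ge> 0" "b > 0" "s > 0"
  shows "s * Phi1 (b / s) - s * Phi1 (a / s) \<le> (b - a) * (ln b - ln s)"
proof (cases "a = 0")
  case False
  then have a: "a > 0" using assms(1) by simp
  have "a * (ln b - ln a) \<le> a * (b / a - 1)"
    using ln_le_minus_one[of "b / a"] a assms(2) by (intro mult_left_mono) (auto simp: ln_div)
  then have "a * ln b - a * ln a \<le> b - a"
    using a by (simp add: right_diff_distrib)
  then show ?thesis
    using assms by (simp add: scaled_Phi1_eq algebra_simps)
qed (use assms in \<open>simp add: scaled_Phi1_eq Phi1_def ln_div algebra_simps\<close>)

lemma Phi1_measurable [measurable]: "Phi1 \<in> borel_measurable borel"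
  unfolding Phi1_def[abs_def] by measurable

context polytopal_mesh
begin

section \<open>Passage from the cells to the domain\<close>

lemma reconstruct_on_cell:
  assumes "K \<in> cells D" "x \<in> K"
  shows "reconstruct D v x = cell v K x"
proof -
  have "x \<notin> K'" if "K' \<in> cells D" "K' \<noteq> K" for K'
    using disjoint_cells assms that by (auto simp: disjoint_def)
  then have "reconstruct D v x = (\<Sum>K'\<in>{K}. indicator K' x * cell v K' x)"
    unfolding reconstruct_def using finite_cells assms
    by (intro sum.mono_neutral_right) (auto simp: indicator_def)
  then show ?thesis using assms(2) by simp
qed

lemma reconstruct_measurable:
  assumes "v \<in> V_space k D"
  shows "reconstruct D v \<in> borel_measurable borel"
  unfolding reconstruct_def[abs_def]
proof (rule borel_measurable_sum)
  fix K assume K: "K \<in> cells D"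
  have "cell v K \<in> borel_measurable borel"
    using assms K by (auto simp: V_space_def intro!: borel_measurable_continuous_onI continuous_polys)
  moreover have "K \<in> sets borel" using cell_props(2)[OF K] by simp
  ultimately show "(\<lambda>x. indicator K x * cell v K x) \<in> borel_measurable borel"
    by measurable
qed

lemma reconstruct_bounded:
  assumes "v \<in> V_space k D"
  obtains B where "\<And>x. \<bar>reconstruct D v x\<bar> \<le> B"
proof -
  have "\<exists>B. \<forall>x. \<bar>indicator K x * cell v K x\<bar> \<le> B" if K: "K \<in> cells D" for K
  proof -
    have "continuous_on UNIV (cell v K)"
      using assms K by (auto simp: V_space_def intro: continuous_polys)
    then obtain B where "\<And>x. x \<in> K \<Longrightarrow> \<bar>cell v K x\<bar> \<le> B" "B \<ge> 0"
      using continuous_bounded_on_bounded[OF cell_props(3)[OF K]] by metis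
    then show ?thesis by (intro exI[of _ B]) (auto simp: indicator_def)
  qed
  then obtain B where B: "\<And>K x. K \<in> cells D \<Longrightarrow> \<bar>indicator K x * cell v K x\<bar> \<le> B K" by metis
  have "\<bar>reconstruct D v x\<bar> \<le> (\<Sum>K\<in>cells D. B K)" for x
    unfolding reconstruct_def by (intro order_trans[OF sum_abs] sum_mono B)
  then show ?thesis by (rule that)
qed

lemma integrable_reconstruct:
  fixes h :: "real \<Rightarrow> real"
  assumes v: "v \<in> V_space k D" and h: "continuous_on UNIV h"
  shows "integrable (lebesgue_on \<Omega>) (\<lambda>x. h (reconstruct D v x))"
proof -
  obtain B where B: "\<And>x. \<bar>reconstruct D v x\<bar> \<le> B" using reconstruct_bounded[OF v] by blast
  have "bounded {-B..B}" by simp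
  then obtain C where C: "\<And>t. t \<in> {-B..B} \<Longrightarrow> \<bar>h t\<bar> \<le> C"
    using continuous_bounded_on_bounded[OF _ h] by metis
  have "\<bar>h (reconstruct D v x)\<bar> \<le> C" for x
    using B[of x] by (intro C) auto
  moreover have "(\<lambda>x. h (reconstruct D v x)) \<in> borel_measurable borel"
    using measurable_comp[OF reconstruct_measurable[OF v] borel_measurable_continuous_onI[OF h]]
    by (simp add: comp_def)
  ultimately show ?thesis
    by (intro integrable_lebesgue_on_bounded[OF domain])
qed

lemma borel_measurable_lebesgue_on_reconstruct:
  "v \<in> V_space k D \<Longrightarrow> reconstruct D v \<in> borel_measurable (lebesgue_on \<Omega>)"
  using integrable_reconstruct[of v k "\<lambda>t. t"] by (auto intro: borel_measurable_integrable continuous_on_id)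

lemma integrable_mult_reconstruct:
  assumes v: "v \<in> V_space k D" and f: "integrable (lebesgue_on \<Omega>) f"
  shows "integrable (lebesgue_on \<Omega>) (\<lambda>x. f x * reconstruct D v x :: real)"
proof -
  obtain B where B: "\<And>x. \<bar>reconstruct D v x\<bar> \<le> B" using reconstruct_bounded[OF v] by blast
  note [measurable] = borel_measurable_lebesgue_on_reconstruct[OF v] borel_measurable_integrable[OF f]
  show ?thesis
  proof (rule Bochner_Integration.integrable_bound)
    show "integrable (lebesgue_on \<Omega>) (\<lambda>x. B * f x)" using f by simp
    have "\<bar>f x\<bar> * \<bar>reconstruct D v x\<bar> \<le> \<bar>B\<bar> * \<bar>f x\<bar>" for x
      using mult_right_mono[OF order_trans[OF B[of x] abs_ge_self], of "\<bar>f x\<bar>"] by (simp add: mult.commute)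
    then show "AE x in lebesgue_on \<Omega>. norm (f x * reconstruct D v x) \<le> norm (B * f x)"
      by (simp add: abs_mult)
  qed measurable
qed

text \<open>The closures of the cells cover the domain, so what the open cells miss lies on their
  frontiers, hence in the closures of faces, and these are contained in hyperplanes.\<close>

lemma AE_in_cells: "AE x in lebesgue_on \<Omega>. \<exists>K\<in>cells D. x \<in> K"
proof -
  have neg: "negligible (closure \<sigma>)" if "\<sigma> \<in> faces D" for \<sigma>
  proof -
    obtain n b where n: "n \<noteq> 0" "\<sigma> \<subseteq> {x. n \<bullet> x = b}" using face_props(6)[OF \<open>\<sigma> \<in> faces D\<close>] by auto
    then have "closure \<sigma> \<subseteq> {x. n \<bullet> x = b}"
      by (intro closure_minimal closed_hyperplane)
    then show ?thesis using negligible_hyperplane[of n b] n(1) negligible_subset by blast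
  qed
  have "negligible (\<Union>\<sigma>\<in>faces D. closure \<sigma>)"
    using mesh neg by (intro negligible_Union) (auto simp: polytopal_discretisation_def)
  moreover have "\<Omega> - \<Union>(cells D) \<subseteq> (\<Union>\<sigma>\<in>faces D. closure \<sigma>)"
  proof
    fix x assume x: "x \<in> \<Omega> - \<Union>(cells D)"
    have "closure \<Omega> = (\<Union>K\<in>cells D. closure K)"
      using mesh unfolding polytopal_discretisation_def by (elim conjE)
    then obtain K where K: "K \<in> cells D" "x \<in> closure K"
      using x closure_subset[of \<Omega>] by blast
    then have "x \<in> frontier K"
      using x interior_subset[of K] by (auto simp: frontier_def)
    then show "x \<in> (\<Union>\<sigma>\<in>faces D. closure \<sigma>)"
      using cell_props(5,7)[OF K(1)] by blast
  qed
  ultimately have "negligible (\<Omega> - \<Union>(cells D))" using negligible_subset by blast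
  then have "AE x in lebesgue. x \<notin> \<Omega> - \<Union>(cells D)"
    by (intro AE_not_in) (simp add: negligible_iff_null_sets)
  then show ?thesis
    using domain(1) by (subst AE_restrict_space_iff) (auto elim: eventually_mono)
qed

lemma sum_integral_cells:
  fixes g :: "real^'n \<Rightarrow> real"
  assumes g: "integrable (lebesgue_on \<Omega>) g"
  shows "(\<Sum>K\<in>cells D. \<integral>x. g x \<partial>lebesgue_on K) = (\<integral>x. g x \<partial>lebesgue_on \<Omega>)"
proof -
  have K: "integrable (lebesgue_on \<Omega>) (\<lambda>x. indicator K x * g x)"
      "(\<integral>x. g x \<partial>lebesgue_on K) = (\<integral>x. indicator K x * g x \<partial>lebesgue_on \<Omega>)" if "K \<in> cells D" for K
  proof -
    note Kp = cell_props(1,2)[OF that]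
    have "K \<in> sets (lebesgue_on \<Omega>)"
      using Kp domain(1) by (auto simp: sets_restrict_space_iff)
    then show "integrable (lebesgue_on \<Omega>) (\<lambda>x. indicator K x * g x)"
      using integrable_mult_indicator[of K "lebesgue_on \<Omega>" g] g by simp
    have "(\<integral>x. g x \<partial>lebesgue_on K) = (\<integral>x. indicator K x * g x \<partial>lebesgue)"
      using Kp(2) by (subst integral_restrict_space) auto
    also have "\<dots> = (\<integral>x. indicator \<Omega> x *\<^sub>R (indicator K x * g x) \<partial>lebesgue)"
      using Kp(1) by (intro Bochner_Integration.integral_cong) (auto split: split_indicator)
    also have "\<dots> = (\<integral>x. indicator K x * g x \<partial>lebesgue_on \<Omega>)"
      using domain(1) by (subst integral_restrict_space) auto
    finally show "(\<integral>x. g x \<partial>lebesgue_on K) = (\<integral>x. indicator K x * g x \<partial>lebesgue_on \<Omega>)" .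
  qed
  have "(\<Sum>K\<in>cells D. \<integral>x. g x \<partial>lebesgue_on K) = (\<integral>x. (\<Sum>K\<in>cells D. indicator K x * g x) \<partial>lebesgue_on \<Omega>)"
    using K by simp
  also have "\<dots> = (\<integral>x. g x \<partial>lebesgue_on \<Omega>)"
  proof (rule integral_cong_AE)
    show "(\<lambda>x. \<Sum>K\<in>cells D. indicator K x * g x) \<in> borel_measurable (lebesgue_on \<Omega>)"
      by (intro borel_measurable_sum borel_measurable_integrable K)
    show "AE x in lebesgue_on \<Omega>. (\<Sum>K\<in>cells D. indicator K x * g x) = g x"
      using AE_in_cells
    proof eventually_elim
      case (elim x)
      then obtain K where "K \<in> cells D" "x \<in> K" by blast
      \<comment> \<open>An auxiliary element whose value on every cell is \<open>g\<close> turns the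
        sum into a reconstruction.\<close>
      from reconstruct_on_cell[OF this, of "\<lparr>cell = \<lambda>_. g, face = undefined\<rparr>"]
      show ?case by (simp add: reconstruct_def)
    qed
  qed (rule borel_measurable_integrable[OF g])
  finally show ?thesis .
qed

lemma c_nl_pos:
  assumes "(\<integral>x. u0 x \<partial>lebesgue_on \<Omega>) > 0"
  shows "c_nl \<Omega> D k \<phi> u0 > 0"
proof -
  let ?E = "\<lambda>x. exp (- reconstruct D (interp_potential \<Omega> D k \<phi>) x)"
  have int: "integrable (lebesgue_on \<Omega>) ?E"
    by (rule integrable_reconstruct[OF interp_potential_in_V_space]) (intro continuous_intros)
  have "(\<integral>x. ?E x \<partial>lebesgue_on \<Omega>) \<noteq> 0"
  proof
    assume "(\<integral>x. ?E x \<partial>lebesgue_on \<Omega>) = 0"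
    \<comment> \<open>An exponential can vanish almost everywhere only if the domain is null, and
      then \<open>u0\<close> would have no mass.\<close>
    then have "AE x in lebesgue_on \<Omega>. ?E x = 0"
      using integral_nonneg_eq_0_iff_AE[OF int] by simp
    then have "AE x in lebesgue_on \<Omega>. u0 x = 0"
      by eventually_elim simp
    then have "(\<integral>x. u0 x \<partial>lebesgue_on \<Omega>) = 0" by (rule integral_eq_zero_AE)
    then show False using assms by simp
  qed
  moreover have "(\<integral>x. ?E x \<partial>lebesgue_on \<Omega>) \<ge> 0" by simp
  ultimately have "(\<integral>x. ?E x \<partial>lebesgue_on \<Omega>) > 0" by linarith
  then show ?thesis unfolding c_nl_def using assms by (intro divide_pos_pos)
qed

end

section \<open>A priori relations for a given solution of the scheme\<close>

locale nonlinear_scheme = polytopal_mesh \<Omega> D for \<Omega> :: "(real^'n::finite) set" and D +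
  fixes \<Lambda> :: "real^'n \<Rightarrow> real^'n^'n" and lam :: real and \<phi> u0 :: "real^'n \<Rightarrow> real"
    and \<Delta>t \<epsilon> :: real and k :: nat and l :: "nat \<Rightarrow> 'n dofs"
  assumes elliptic: "lam > 0" "AE x in lebesgue_on \<Omega>. \<forall>\<xi>. (\<Lambda> x *v \<xi>) \<bullet> \<xi> \<ge> lam * (norm \<xi>)\<^sup>2"
    and initial: "integrable (lebesgue_on \<Omega>) u0" "AE x in lebesgue_on \<Omega>. u0 x \<ge> 0"
      "integrable (lebesgue_on \<Omega>) (\<lambda>x. u0 x * ln (u0 x))"
    and mass_pos: "(\<integral>x. u0 x \<partial>lebesgue_on \<Omega>) > 0"
    and time_step: "\<Delta>t > 0" and eps: "\<epsilon> \<ge> 0"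
    and solution: "scheme_solution \<Omega> D k \<Lambda> \<phi> u0 \<Delta>t \<epsilon> l"
begin

abbreviation "u \<equiv> discrete_density D u0 l"
abbreviation "potential_interp \<equiv> interp_potential \<Omega> D k \<phi>"
abbreviation "u_inf \<equiv> equilibrium \<Omega> D k \<phi> u0"
abbreviation "c \<equiv> c_nl \<Omega> D k \<phi> u0"
abbreviation "w \<equiv> quasi_fermi \<Omega> D k \<phi> u0 l"

lemma solution_in_V_space: "n \<ge> 1 \<Longrightarrow> l n \<in> V_space k D"
  using solution by (simp add: scheme_solution_def)

lemma integrable_density: "integrable (lebesgue_on \<Omega>) (u n)"
proof (cases "n = 0")
  case False
  then have "l n \<in> V_space k D" by (intro solution_in_V_space) simp
  from integrable_reconstruct[OF this continuous_on_exp[OF continuous_on_id]]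
  show ?thesis using False by (simp add: discrete_density_def[abs_def])
qed (simp add: discrete_density_def[abs_def] initial)

lemma density_nonneg: "AE x in lebesgue_on \<Omega>. u n x \<ge> 0"
  using initial(2) by (cases "n = 0") (auto simp: discrete_density_def)

text \<open>On each cell the local densities and test values agree with the global density and
  reconstruction, so the sum over cells is one integral over the domain.\<close>

lemma scheme_on_domain:
  assumes v: "v \<in> V_space k D"
  shows "(\<integral>x. (u (n + 1) x - u n x) * reconstruct D v x \<partial>lebesgue_on \<Omega>)
    = - \<Delta>t * T_form D k \<Lambda> \<epsilon> (l (n + 1)) (dofs_add (l (n + 1)) potential_interp) v"
proof -
  have int: "integrable (lebesgue_on \<Omega>) (\<lambda>x. (u (n + 1) x - u n x) / \<Delta>t * reconstruct D v x)"
    by (intro integrable_mult_reconstruct[OF v] Bochner_Integration.integrable_divide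
        Bochner_Integration.integrable_diff integrable_density)
  have dens: "local_density u0 l m K x = u m x" if "K \<in> cells D" "x \<in> K" for m K x
    using reconstruct_on_cell[OF that] by (simp add: local_density_def discrete_density_def)
  have "(\<Sum>K\<in>cells D. \<integral>x. (local_density u0 l (n + 1) K x - local_density u0 l n K x) / \<Delta>t * cell v K x \<partial>lebesgue_on K)
      = (\<Sum>K\<in>cells D. \<integral>x. (u (n + 1) x - u n x) / \<Delta>t * reconstruct D v x \<partial>lebesgue_on K)"
    by (intro sum.cong Bochner_Integration.integral_cong refl) (simp add: dens reconstruct_on_cell)
  also have "\<dots> = (\<integral>x. (u (n + 1) x - u n x) / \<Delta>t * reconstruct D v x \<partial>lebesgue_on \<Omega>)"
    by (rule sum_integral_cells[OF int])
  also have "\<dots> = (\<integral>x. (u (n + 1) x - u n x) * reconstruct D v x \<partial>lebesgue_on \<Omega>) / \<Delta>t"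
    by (simp flip: integral_divide_zero)
  finally have eq: "(\<Sum>K\<in>cells D. \<integral>x. (local_density u0 l (n + 1) K x - local_density u0 l n K x) / \<Delta>t * cell v K x \<partial>lebesgue_on K)
      = (\<integral>x. (u (n + 1) x - u n x) * reconstruct D v x \<partial>lebesgue_on \<Omega>) / \<Delta>t" .
  have "(\<integral>x. (u (n + 1) x - u n x) * reconstruct D v x \<partial>lebesgue_on \<Omega>) / \<Delta>t
      + T_form D k \<Lambda> \<epsilon> (l (n + 1)) (dofs_add (l (n + 1)) potential_interp) v = 0"
    using conjunct2[OF solution[unfolded scheme_solution_def], rule_format, OF v, of n] unfolding eq .
  then show ?thesis using time_step by (simp add: field_simps)
qed

lemma mass_step: "(\<integral>x. u (n + 1) x \<partial>lebesgue_on \<Omega>) = (\<integral>x. u n x \<partial>lebesgue_on \<Omega>)"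
proof -
  have "(\<integral>x. (u (n + 1) x - u n x) * reconstruct D dofs_one x \<partial>lebesgue_on \<Omega>) = 0"
    using scheme_on_domain[OF dofs_one_in_V_space, of n] by (simp add: T_form_one)
  \<comment> \<open>The reconstruction of \<open>dofs_one\<close> equals one on the cells, that is,
    almost everywhere.\<close>
  moreover have "(\<integral>x. (u (n + 1) x - u n x) * reconstruct D dofs_one x \<partial>lebesgue_on \<Omega>)
      = (\<integral>x. u (n + 1) x - u n x \<partial>lebesgue_on \<Omega>)"
  proof (rule integral_cong_AE)
    show "AE x in lebesgue_on \<Omega>. (u (n + 1) x - u n x) * reconstruct D dofs_one x = u (n + 1) x - u n x"
      using AE_in_cells by eventually_elim (auto simp: reconstruct_on_cell dofs_one_def)
  qed (intro borel_measurable_integrable integrable_mult_reconstruct[OF dofs_one_in_V_space]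
      Bochner_Integration.integrable_diff integrable_density)+
  ultimately show ?thesis
    using integrable_density by simp
qed

lemma mass_conserved: "(\<integral>x. u n x \<partial>lebesgue_on \<Omega>) = (\<integral>x. u0 x \<partial>lebesgue_on \<Omega>)"
proof (induction n)
  case 0
  show ?case by (simp add: discrete_density_def)
next
  case (Suc n)
  then show ?case using mass_step[of n] by simp
qed

lemma equilibrium_pos: "u_inf x > 0"
  using c_nl_pos[OF mass_pos, of k \<phi>] by (simp add: equilibrium_def)

lemma ln_equilibrium: "ln (u_inf x) = ln c - reconstruct D potential_interp x"
  using c_nl_pos[OF mass_pos, of k \<phi>] by (simp add: equilibrium_def ln_mult)

text \<open>After expansion the terms are controlled separately: \<open>u n x * ln (u n x)\<close>
  by the finite initial entropy or by boundedness of a reconstruction, and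
  \<open>u n x * ln (u_inf x)\<close> because the interpolated potential is bounded.\<close>

lemma entropy_density_integrable:
  "integrable (lebesgue_on \<Omega>) (\<lambda>x. u_inf x * Phi1 (u n x / u_inf x))"
proof -
  note \<phi>V = interp_potential_in_V_space[of k \<phi>]
  have inf: "integrable (lebesgue_on \<Omega>) u_inf"
    unfolding equilibrium_def[abs_def]
    by (rule integrable_reconstruct[OF \<phi>V]) (intro continuous_intros)
  have ulnu: "integrable (lebesgue_on \<Omega>) (\<lambda>x. u n x * ln (u n x))"
  proof (cases "n = 0")
    case False
    then have "l n \<in> V_space k D" by (intro solution_in_V_space) simp
    from integrable_reconstruct[OF this, of "\<lambda>t. exp t * t"]
    show ?thesis using False by (simp add: discrete_density_def continuous_intros)
  qed (simp add: discrete_density_def initial)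
  have "integrable (lebesgue_on \<Omega>) (\<lambda>x. ln c * u n x - u n x * reconstruct D potential_interp x)"
    using integrable_mult_reconstruct[OF \<phi>V integrable_density] integrable_density by simp
  then have "integrable (lebesgue_on \<Omega>) (\<lambda>x. u n x * ln (u_inf x))"
    by (simp add: ln_equilibrium algebra_simps)
  then have int: "integrable (lebesgue_on \<Omega>) (\<lambda>x. u n x * ln (u n x) - u n x * ln (u_inf x) - u n x + u_inf x)"
    using ulnu inf integrable_density by simp
  note [measurable] = borel_measurable_integrable[OF inf] borel_measurable_integrable[OF integrable_density[of n]]
  show ?thesis
  proof (rule integrable_cong_AE_imp[OF int])
    show "AE x in lebesgue_on \<Omega>. u n x * ln (u n x) - u n x * ln (u_inf x) - u n x + u_inf x
        = u_inf x * Phi1 (u n x / u_inf x)"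
      using density_nonneg[of n] by eventually_elim (simp add: scaled_Phi1_eq equilibrium_pos)
  qed measurable
qed

lemma entropy_nonneg: "discrete_entropy \<Omega> D k \<phi> u0 l n \<ge> 0"
  unfolding discrete_entropy_def
proof (rule integral_nonneg_AE)
  show "AE x in lebesgue_on \<Omega>. 0 \<le> u_inf x * Phi1 (u n x / u_inf x)"
    using density_nonneg[of n]
    by eventually_elim (use equilibrium_pos in \<open>simp add: Phi1_nonneg less_imp_le\<close>)
qed

lemma dissipation_nonneg: "discrete_dissipation \<Omega> D k \<Lambda> \<phi> u0 \<epsilon> l n \<ge> 0"
  unfolding discrete_dissipation_def by (rule T_form_nonneg[OF elliptic eps])

lemma cell_quasi_fermi: "cell (w n) K x = cell (dofs_add (l n) potential_interp) K x + (- ln c)"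
  and face_quasi_fermi: "face (w n) \<sigma> x = face (dofs_add (l n) potential_interp) \<sigma> x + (- ln c)"
  by (simp_all add: quasi_fermi_def dofs_add_def dofs_scale_def dofs_one_def)

lemma quasi_fermi_in_V_space: "n \<ge> 1 \<Longrightarrow> w n \<in> V_space k D"
  unfolding quasi_fermi_def
  by (intro dofs_add_in_V_space solution_in_V_space interp_potential_in_V_space)
    (auto simp: V_space_def dofs_scale_def dofs_one_def polys_const)

text \<open>Identifies the slope of the entropy density at \<open>u n x\<close> with the test
  function. The restriction on \<open>n\<close> is essential, since \<open>u 0\<close> is the
  initial datum and not an exponential of a reconstruction.\<close>

lemma ln_density_minus_ln_equilibrium:
  assumes "K \<in> cells D" "x \<in> K" "n \<ge> 1"
  shows "ln (u n x) - ln (u_inf x) = reconstruct D (w n) x"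
  using assms
  by (simp add: ln_equilibrium discrete_density_def reconstruct_on_cell cell_quasi_fermi dofs_add_def)

lemma entropy_dissipation:
  "(discrete_entropy \<Omega> D k \<phi> u0 l (n + 1) - discrete_entropy \<Omega> D k \<phi> u0 l n) / \<Delta>t
    + discrete_dissipation \<Omega> D k \<Lambda> \<phi> u0 \<epsilon> l (n + 1) \<le> 0"
proof -
  have V: "l (n + 1) \<in> V_space k D" "w (n + 1) \<in> V_space k D"
    by (simp_all add: solution_in_V_space quasi_fermi_in_V_space)
  have "discrete_entropy \<Omega> D k \<phi> u0 l (n + 1) - discrete_entropy \<Omega> D k \<phi> u0 l n
      = (\<integral>x. u_inf x * Phi1 (u (n + 1) x / u_inf x) - u_inf x * Phi1 (u n x / u_inf x) \<partial>lebesgue_on \<Omega>)"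
    unfolding discrete_entropy_def
    by (rule Bochner_Integration.integral_diff[symmetric]) (rule entropy_density_integrable)+
  \<comment> \<open>The only inequality of the argument: the tangent is taken at the new time level,
    where the density is an exponential and therefore positive.\<close>
  also have "\<dots> \<le> (\<integral>x. (u (n + 1) x - u n x) * reconstruct D (w (n + 1)) x \<partial>lebesgue_on \<Omega>)"
  proof (rule integral_mono_AE)
    show "AE x in lebesgue_on \<Omega>. u_inf x * Phi1 (u (n + 1) x / u_inf x) - u_inf x * Phi1 (u n x / u_inf x)
        \<le> (u (n + 1) x - u n x) * reconstruct D (w (n + 1)) x"
      using density_nonneg[of n] AE_in_cells
    proof eventually_elim
      case (elim x)
      then obtain K where K: "K \<in> cells D" "x \<in> K" by blast
      have "u (n + 1) x > 0" by (simp add: discrete_density_def)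
      from scaled_Phi1_diff_le[OF elim(1) this equilibrium_pos[of x]] show ?case
        by (simp only: ln_density_minus_ln_equilibrium[OF K le_add2])
    qed
  qed (intro Bochner_Integration.integrable_diff entropy_density_integrable
      integrable_mult_reconstruct[OF V(2)] integrable_density)+
  also have "\<dots> = - \<Delta>t * T_form D k \<Lambda> \<epsilon> (l (n + 1)) (dofs_add (l (n + 1)) potential_interp) (w (n + 1))"
    by (rule scheme_on_domain[OF V(2)])
  \<comment> \<open>The scheme contains the sum of \<open>l (n + 1)\<close> and the potential, the
    dissipation contains \<open>w (n + 1)\<close>; they differ by the constant
    \<open>- ln c\<close>, which gradients and jumps do not see.\<close>
  also have "T_form D k \<Lambda> \<epsilon> (l (n + 1)) (dofs_add (l (n + 1)) potential_interp) (w (n + 1))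
      = discrete_dissipation \<Omega> D k \<Lambda> \<phi> u0 \<epsilon> l (n + 1)"
    unfolding discrete_dissipation_def
    by (rule T_form_add_const[OF V(1) dofs_add_in_V_space[OF V(1) interp_potential_in_V_space] V(2,2)
          cell_quasi_fermi face_quasi_fermi])
  finally show ?thesis using time_step by (simp add: field_simps)
qed

end

theorem proposition4:
  fixes \<Omega> :: "(real^'n::finite) set"
    and \<Lambda> :: "real^'n \<Rightarrow> real^'n^'n"
    and lam :: real
    and \<phi> u0 :: "real^'n \<Rightarrow> real"
    and M \<Delta>t \<epsilon> :: real
    and k :: nat
    and D :: "'n discretisation"
    and l :: "nat \<Rightarrow> 'n dofs"
  assumes dim: "CARD('n) = 2 \<or> CARD('n) = 3"
    and domain: "open \<Omega>" "bounded \<Omega>" "connected \<Omega>" "lipschitz_polytopal_in UNIV \<Omega>"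
    and Lambda_bounded: "\<And>i j. Linf \<Omega> (\<lambda>x. \<Lambda> x $ i $ j)"
    and elliptic: "lam > 0" "AE x in lebesgue_on \<Omega>. \<forall>\<xi>. (\<Lambda> x *v \<xi>) \<bullet> \<xi> \<ge> lam * (norm \<xi>)\<^sup>2"
    and potential: "W1inf \<Omega> \<phi>"
    and initial: "integrable (lebesgue_on \<Omega>) u0" "AE x in lebesgue_on \<Omega>. u0 x \<ge> 0"
      "integrable (lebesgue_on \<Omega>) (\<lambda>x. u0 x * ln (u0 x))"
    and mass: "M = (\<integral>x. u0 x \<partial>lebesgue_on \<Omega>)" "M > 0"
    and time_step: "\<Delta>t > 0"
    and mesh: "polytopal_discretisation \<Omega> D"
    and Lambda_regular: "\<And>K i j. K \<in> cells D \<Longrightarrow> W1inf K (\<lambda>x. \<Lambda> x $ i $ j)"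
    and eps: "\<epsilon> \<ge> 0"
    and solution: "scheme_solution \<Omega> D k \<Lambda> \<phi> u0 \<Delta>t \<epsilon> l"
  shows "(\<forall>n\<ge>1. (\<integral>x. discrete_density D u0 l n x \<partial>lebesgue_on \<Omega>) = (\<integral>x. u0 x \<partial>lebesgue_on \<Omega>) \<and>
                (\<integral>x. u0 x \<partial>lebesgue_on \<Omega>) = M) \<and>
         (\<forall>n. discrete_entropy \<Omega> D k \<phi> u0 l n \<ge> 0) \<and>
         (\<forall>n\<ge>1. discrete_dissipation \<Omega> D k \<Lambda> \<phi> u0 \<epsilon> l n \<ge> 0) \<and>
         (\<forall>n. (discrete_entropy \<Omega> D k \<phi> u0 l (n + 1) - discrete_entropy \<Omega> D k \<phi> u0 l n) / \<Delta>t
               + discrete_dissipation \<Omega> D k \<Lambda> \<phi> u0 \<epsilon> l (n + 1) \<le> 0)"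
proof -
  interpret nonlinear_scheme \<Omega> D \<Lambda> lam \<phi> u0 \<Delta>t \<epsilon> k l
    using assms by unfold_locales auto
  show ?thesis
    using mass_conserved entropy_nonneg dissipation_nonneg entropy_dissipation mass(1) by blast
qed

end
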